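(* Work under the conventions $e^{-0\cdot\infty}=0=e^{-\infty\cdot0}$. Let $\psi$ be a Laplace dual symbol, vanishing at infinity, and put $\phi(x,y):=\psi(x,y)e^{-xy}$, $(x,y)\in[0,\infty]^2$. Let $\mathcal{X}$ and $\mathcal{Y}$ be the pregenerators associated to $\psi|_{[0,\infty]\times(0,\infty)}$ and $\hat\psi|_{[0,\infty]\times(0,\infty)}$, respectively. Fix $x_0,y_0\in[0,\infty]$, let $(X,\mathbb{P}_{x_0})$ be a $\mathbb{D}^{\mathrm{m}\infty}_{[0,\infty]}$-valued solution to the martingale problem for $(\mathcal{X},\delta_{x_0})$ and let $(Y,\mathbb{P}^{y_0})$ be a $\mathbb{D}^{\mathrm{m}\infty}_{[0,\infty]}$-valued solution to the martingale problem for $(\mathcal{Y},\delta_{y_0})$. Set, for $m,n\in\mathbb{N}$ and $\delta,\epsilon\in(0,\infty)$, $$\sigma_m^+=\inf\{t\ge0:X_t>m\},\quad \sigma_\delta^-=\inf\{t\ge0:X_t<\delta\},\quad \tau_n^+=\inf\{t\ge0:Y_t>n\},\quad \tau_\epsilon^-=\inf\{t\ge0:Y_t<\epsilon\}.$$ Write $\mathbb{P}:=\mathbb{P}_{x_0}\times\mathbb{P}^{y_0}$ with expectation $\mathbb{E}$. For random times $\sigma$ and $\tau$ under $\mathbb{P}_{x_0}$ and $\mathbb{P}^{y_0}$, respectively, consider the conditions (A) $\int_0^T\int_0^T\mathbb{E}[\phi_\pm(X_{s\wedge\sigma},Y_{t\wedge\tau})]\mathbf{1}_{[0,T]}(s+t)\,\mathrm{d}s\,\mathrm{d}t<\infty$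 for all $T\in[0,\infty)$ (with the sign $+$ for all $T$, or with the sign $-$ for all $T$); (B) $\mathbb{E}[|\phi(X_\sigma,Y_\tau)|;\sigma+\tau\le t]<\infty$ for a.e. $t\in[0,\infty)$. Suppose one of (I)–(IV) is met. (I) (A) holds with $\sigma\equiv\infty\equiv\tau$; the process $(\mathbf{1}_{\{Y_t<\infty\}}-\int_0^t\phi(0,Y_s)\,\mathrm{d}s)_{t\in[0,\infty)}$ is a martingale; $Y$ has $0$ non-sticky and $y_0>0$. (II) For all $(m,n)\in\mathbb{N}^2$, (A) and (B) hold with $\sigma=\sigma_m^+$, $\tau=\tau_n^+$; $\lim_{y\to\infty}\phi(x,y)=0$ for all $x\in(0,\infty)$ and $\lim_{x\to\infty}\phi(x,y)=0$ for all $y\in(0,\infty)$; $X$ and $Y$ have $0$ non-sticky and $x_0>0$, $y_0>0$. (III) For all $(n,\epsilon)\in\mathbb{N}\times(0,\infty)$, (A) holds with $\sigma=\infty$, $\tau=\tau_n^+\wedge\tau_\epsilon^-$; $\phi(\cdot,y)$ is continuous at zero for all $y\in[0,\infty)$; $\sup_{(x,y)\in[0,m]\times(\epsilon,n)}|\phi(x,y)|<\infty$ for all $(m,n,\epsilon)\in(0,\infty)^3$; $\phi(\cdot,0)$ vanishes on $[0,\infty]$; $X$ has $\infty$ non-sticky; there is a.s. no continuous explosion for $Y$ at $\infty$; and $Y$ is $\mathbb{D}^{\mathrm{m}0}_{[0,\infty]}$-valued. (IV) For all $(\delta,\epsilon)\in(0,\infty)^2$, (A) and (B) hold with $\sigma=\sigma_\delta^-$,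 $\tau=\tau_\epsilon^-$; $\phi(x,\cdot)$ is continuous at zero for all $x\in[0,\infty)$ and $\phi(\cdot,y)$ is continuous at zero for all $y\in[0,\infty)$; $\sup_{(x,y)\in[0,m]^2}|\phi(x,y)|<\infty$ for all $m\in[0,\infty)$; $\phi(0,\cdot)$ and $\phi(\cdot,0)$ vanish on $[0,\infty]$; $X$ and $Y$ are both $\mathbb{D}^{\mathrm{m}0}_{[0,\infty]}$-valued and have $\infty$ non-sticky. Then $$\mathbb{E}_{x_0}[e^{-X_ty_0}]=\mathbb{E}^{y_0}[e^{-x_0Y_t}],\qquad t\in[0,\infty).$$
   Context: $e^{-\infty}=0$, $x\cdot\infty=\infty\cdot x=\infty$ for $x\in(0,\infty]$. For $y\in(0,\infty)$, $\mathsf{e}^y(u)=e^{-uy}$ on $[0,\infty]$, $\mathsf{e}^y(\infty)=0$; $\mathcal{D}$ is the linear span of $\{\mathsf{e}^y:y\in(0,\infty)\}$. $\phi_+=\max(\phi,0)$, $\phi_-=\max(-\phi,0)$, $\mathbb{E}[Z;A]=\mathbb{E}[Z\mathbf{1}_A]$, $\inf\emptyset=\infty$; random times are $[0,\infty]$-valued. Laplace symbol: a map $\psi:[0,\infty]\times(0,\infty)\to\mathbb{R}$ of the form - $\psi(x,y)=\int(e^{-uy}-1+uy\mathbf{1}_{[-1,1]}(u))\nu_x(\mathrm{d}u)+a_xy^2-b_xy-c_x$ for $x\in(0,\infty)$, with $\nu_x$ a measure on $[-x,\infty)$, $\nu_x(\{0\})=0$, $\int1\wedge u^2\,\nu_x(\mathrm{d}u)<\infty$,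 $a_x,c_x\in[0,\infty)$, $b_x\in\mathbb{R}$; - $\psi(0,y)=\int(e^{-uy}-1)\nu_0(\mathrm{d}u)-d_0y-c_0$, with $\nu_0$ a measure on $(0,\infty)$, $\int1\wedge u\,\nu_0(\mathrm{d}u)<\infty$, $d_0,c_0\in[0,\infty)$; - $\psi(\infty,y)=\int e^{-uy}\nu_\infty(\mathrm{d}u)+k_\infty$, with $\nu_\infty$ a measure on $(0,\infty)$ with finite Laplace transform on $(0,\infty)$ and $k_\infty\in[0,\infty)$; with $(0,\infty)\ni x\mapsto(\nu_x,a_x,b_x,c_x)$ measurable (i.e. $a_x,b_x,c_x$ and $x\mapsto\int g(u)(1\wedge u^2)\nu_x(\mathrm{d}u)$ Borel for bounded Borel $g$). The pregenerator associated to $\psi$ is the linear operator $\mathcal{X}$ on $\mathcal{D}$ determined by $(\mathcal{X}\mathsf{e}^y)(x)=\psi(x,y)e^{-xy}$ for $x\in[0,\infty)$ and $(\mathcal{X}\mathsf{e}^y)(\infty)=\psi(\infty,y)$, $y\in(0,\infty)$. For $\psi:[0,\infty]^2\to\mathbb{R}$ put $\hat\psi(x,y):=\psi(y,x)$; $\psi$ is a Laplace dual symbol if both $\psi|_{[0,\infty]\times(0,\infty)}$ and $\hat\psi|_{[0,\infty]\times(0,\infty)}$ are Laplace symbols. It vanishes at infinity if $\psi=0$ on $(\{\infty\}\times[0,\infty])\cup([0,\infty]\times\{\infty\})$. A solution $(X,\mathbb{P})$ to the martingale problem for $(\mathcal{X},\mu)$ is a $[0,\infty]$-valued progressively measurable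 process $X$ under a probability $\mathbb{P}$ with $X_0$ of law $\mu$ such that for each $f\in\mathcal{D}$, $(f(X_t)-\int_0^t\mathcal{X}f(X_s)\mathrm{d}s)_{t\ge0}$ is a martingale in the natural filtration of $X$ (integrals a.s. well-defined and finite). $\mathbb{D}_{[0,\infty]}$ is the space of càdlàg paths $\omega:[0,\infty)\to[0,\infty]$. For $z\in\{0,\infty\}$ let $\zeta_z(\omega)=\inf\{t\ge0:\omega_{t-}=z\text{ or }\omega_t=z\}$ ($\omega_{0-}:=\omega_0$) and $\mathbb{D}^{\mathrm{m}z}_{[0,\infty]}=\{\omega\in\mathbb{D}_{[0,\infty]}:\text{if }\zeta_z(\omega)<\infty\text{ then }\omega_t=z\text{ for all }t\ge\zeta_z(\omega)\}$. No continuous explosion at $\infty$ means: $\zeta_\infty(\omega)<\infty$ implies $\omega_{\zeta_\infty(\omega)-}\in[0,\infty)$. For the process $X$ under the single law $\mathbb{P}_{x_0}$, "$X$ has $z\in\{0,\infty\}$ non-sticky" means: if $x_0\ne z$ then $\mathbb{P}_{x_0}(X_t\ne z)=1$ for all $t\in[0,\infty)$; similarly for $Y$ under $\mathbb{P}^{y_0}$. *)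

theory Defs
  imports "HOL-Probability.Probability"
begin

text \<open>
  The state space \<open>[0,\<infinity>]\<close> is the type \<^typ>\<open>ennreal\<close>; time \<open>[0,\<infinity>)\<close> is the set of nonnegative reals,
  and the values of a path or process at negative times are irrelevant throughout. Random times
  are \<^typ>\<open>ennreal\<close>-valued.
\<close>

section \<open>Laplace kernel, Laplace symbols and pregenerators\<close>

text \<open>
  The kernel \<open>e\<^sup>-\<^sup>x\<^sup>y\<close> with \<open>e\<^sup>-\<^sup>\<infinity> = 0\<close> and the convention that the exponent is \<open>-\<infinity>\<close> also for
  \<open>0 \<cdot> \<infinity>\<close> and \<open>\<infinity> \<cdot> 0\<close>. It is spelled out by cases because the library has \<open>0 * \<infinity> = 0\<close> in \<^typ>\<open>ennreal\<close>.
\<close>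

definition lap :: "ennreal \<Rightarrow> ennreal \<Rightarrow> real" where
  "lap x y = (if x = top \<or> y = top then 0 else exp (- (enn2real x * enn2real y)))"

definition laplace_symbol :: "(ennreal \<Rightarrow> real \<Rightarrow> real) \<Rightarrow> bool" where
  "laplace_symbol \<psi> \<longleftrightarrow>
    (\<exists>(\<nu> :: real \<Rightarrow> real measure) (a :: real \<Rightarrow> real) (b :: real \<Rightarrow> real) (c :: real \<Rightarrow> real)
       (\<nu>0 :: real measure) (d0 :: real) (c0 :: real) (\<nu>inf :: real measure) (kinf :: real).
      (\<forall>x>0. sets (\<nu> x) = sets borel \<and> emeasure (\<nu> x) {..<-x} = 0 \<and> emeasure (\<nu> x) {0} = 0 \<and>
             (\<integral>\<^sup>+ u. ennreal (min 1 (u\<^sup>2)) \<partial>\<nu> x) < \<infinity> \<and> 0 \<le> a x \<and> 0 \<le> c x \<and>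
             (\<forall>y>0. \<psi> (ennreal x) y =
                (\<integral>u. (exp (- (u * y)) - 1 + u * y * indicator {-1..1} u) \<partial>\<nu> x)
                + a x * y\<^sup>2 - b x * y - c x)) \<and>
      (sets \<nu>0 = sets borel \<and> emeasure \<nu>0 {..0} = 0 \<and>
             (\<integral>\<^sup>+ u. ennreal (min 1 u) \<partial>\<nu>0) < \<infinity> \<and> 0 \<le> d0 \<and> 0 \<le> c0 \<and>
             (\<forall>y>0. \<psi> 0 y = (\<integral>u. (exp (- (u * y)) - 1) \<partial>\<nu>0) - d0 * y - c0)) \<and>
      (sets \<nu>inf = sets borel \<and> emeasure \<nu>inf {..0} = 0 \<and>
             (\<forall>y>0. (\<integral>\<^sup>+ u. ennreal (exp (- (u * y))) \<partial>\<nu>inf) < \<infinity>) \<and> 0 \<le> kinf \<and>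
             (\<forall>y>0. \<psi> top y = (\<integral>u. exp (- (u * y)) \<partial>\<nu>inf) + kinf)) \<and>
      a \<in> borel_measurable (restrict_space borel {0<..}) \<and>
      b \<in> borel_measurable (restrict_space borel {0<..}) \<and>
      c \<in> borel_measurable (restrict_space borel {0<..}) \<and>
      (\<forall>g :: real \<Rightarrow> real. g \<in> borel_measurable borel \<longrightarrow> bounded (range g) \<longrightarrow>
         (\<lambda>x. \<integral>u. g u * min 1 (u\<^sup>2) \<partial>\<nu> x) \<in> borel_measurable (restrict_space borel {0<..})))"

definition laplace_dual_symbol :: "(ennreal \<Rightarrow> ennreal \<Rightarrow> real) \<Rightarrow> bool" where
  "laplace_dual_symbol \<psi> \<longleftrightarrow>
     laplace_symbol (\<lambda>x y. \<psi> x (ennreal y)) \<and> laplace_symbol (\<lambda>x y. \<psi> (ennreal y) x)"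

definition vanishes_at_infinity :: "(ennreal \<Rightarrow> ennreal \<Rightarrow> real) \<Rightarrow> bool" where
  "vanishes_at_infinity \<psi> \<longleftrightarrow> (\<forall>y. \<psi> top y = 0) \<and> (\<forall>x. \<psi> x top = 0)"

text \<open>The linear combination of the functions \<open>u \<mapsto> e\<^sup>-\<^sup>u\<^sup>y\<close>, \<open>y \<in> A\<close>, with coefficients \<open>c\<close>.\<close>

definition lap_comb :: "real set \<Rightarrow> (real \<Rightarrow> real) \<Rightarrow> ennreal \<Rightarrow> real" where
  "lap_comb A c = (\<lambda>u. \<Sum>y\<in>A. c y * lap u (ennreal y))"

text \<open>The domain \<open>\<D>\<close> of the pregenerators.\<close>

definition lap_span :: "(ennreal \<Rightarrow> real) set" where
  "lap_span = {lap_comb A c | A c. finite A \<and> A \<subseteq> {0<..}}"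

definition pregenerator_exp :: "(ennreal \<Rightarrow> real \<Rightarrow> real) \<Rightarrow> real \<Rightarrow> ennreal \<Rightarrow> real" where
  "pregenerator_exp \<psi> y x = (if x = top then \<psi> top y else \<psi> x y * lap x (ennreal y))"

text \<open>
  The linear extension of \<^const>\<open>pregenerator_exp\<close> from the exponentials to their span; it is well
  defined since the exponentials are linearly independent (\<open>pregenerator_lap_comb\<close> below).
\<close>

definition pregenerator ::
    "(ennreal \<Rightarrow> real \<Rightarrow> real) \<Rightarrow> (ennreal \<Rightarrow> real) \<Rightarrow> (ennreal \<Rightarrow> real)" where
  "pregenerator \<psi> f =
     (THE g. \<exists>A c. finite A \<and> A \<subseteq> {0<..} \<and> f = lap_comb A c \<and>
                   g = (\<lambda>x. \<Sum>y\<in>A. c y * pregenerator_exp \<psi> y x))"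

lemma exp_sum_independent:
  fixes A :: "real set"
  assumes "finite A" "\<And>u. u \<ge> 0 \<Longrightarrow> (\<Sum>y\<in>A. c y * exp (- (u * y))) = 0"
  shows "\<forall>y\<in>A. c y = 0"
  using assms
proof (induction A rule: finite_linorder_min_induct)
  case empty
  then show ?case by simp
next
  case (insert b A)
  have nb: "b \<notin> A" using insert.hyps(2) by auto
  have eq: "(\<Sum>y\<in>A. c y * exp (- (u * (y - b)))) = - c b" if "u \<ge> 0" for u
  proof -
    have "0 = exp (u * b) * (c b * exp (- (u * b)) + (\<Sum>y\<in>A. c y * exp (- (u * y))))"
      using insert.prems[OF that] insert.hyps(1) nb by simp
    also have "\<dots> = c b + (\<Sum>y\<in>A. c y * exp (- (u * (y - b))))"
    proof -
      have "exp (u * b) * (c b * exp (- (u * b))) = c b"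
        by (simp add: exp_minus)
      moreover have "exp (u * b) * (c y * exp (- (u * y))) = c y * exp (- (u * (y - b)))" for y
        by (simp add: exp_add[symmetric] algebra_simps flip: exp_add)
      ultimately show ?thesis
        by (simp only: distrib_left sum_distrib_left)
    qed
    finally show ?thesis by simp
  qed
  have "((\<lambda>u. \<Sum>y\<in>A. c y * exp (- (u * (y - b)))) \<longlongrightarrow> (\<Sum>y\<in>A. c y * 0)) at_top"
  proof (intro tendsto_sum tendsto_mult tendsto_const)
    fix y assume "y \<in> A"
    then have "0 < y - b" using insert.hyps(2) by auto
    then have "filterlim (\<lambda>u. u * (y - b)) at_top at_top"
      by (rule filterlim_at_top_mult_tendsto_pos[OF tendsto_const _ filterlim_ident])
    then have "filterlim (\<lambda>u. - (u * (y - b))) at_bot at_top"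
      by (simp add: filterlim_uminus_at_top)
    then show "((\<lambda>u. exp (- (u * (y - b)))) \<longlongrightarrow> 0) at_top"
      by (rule filterlim_compose[OF exp_at_bot])
  qed
  moreover have "((\<lambda>u. \<Sum>y\<in>A. c y * exp (- (u * (y - b)))) \<longlongrightarrow> - c b) at_top"
    by (rule tendsto_eventually, rule eventually_at_top_linorderI[of 0], rule eq)
  ultimately have cb: "c b = 0"
    using tendsto_unique[OF trivial_limit_at_top_linorder] by fastforce
  have "\<forall>y\<in>A. c y = 0"
    using insert.prems insert.hyps(1) nb cb by (intro insert.IH) auto
  with cb show ?case by simp
qed

lemma lap_comb_eq_imp:
  assumes "finite A" "A \<subseteq> {0<..}" "finite B" "B \<subseteq> {0<..}" "lap_comb A c = lap_comb B d"
  shows "(\<Sum>y\<in>A. c y * h y) = (\<Sum>y\<in>B. d y * h y)"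
proof -
  define c' where "c' y = (if y \<in> A then c y else 0)" for y
  define d' where "d' y = (if y \<in> B then d y else 0)" for y
  have c': "(\<Sum>y\<in>A. c y * k y) = (\<Sum>y\<in>A \<union> B. c' y * k y)" for k :: "real \<Rightarrow> real"
    using assms(1,3) by (intro sum.mono_neutral_cong_left) (auto simp: c'_def)
  have d': "(\<Sum>y\<in>B. d y * k y) = (\<Sum>y\<in>A \<union> B. d' y * k y)" for k :: "real \<Rightarrow> real"
    using assms(1,3) by (intro sum.mono_neutral_cong_left) (auto simp: d'_def)
  have "\<forall>y\<in>A \<union> B. c' y - d' y = 0"
  proof (rule exp_sum_independent)
    show "finite (A \<union> B)" using assms by simp
    fix u :: real assume u: "u \<ge> 0"
    have lap: "lap (ennreal u) (ennreal y) = exp (- (u * y))" if "y \<in> A \<union> B" for y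
      using that assms(2,4) u by (auto simp: lap_def enn2real_ennreal less_imp_le subset_eq)
    have "(\<Sum>y\<in>A \<union> B. c' y * lap (ennreal u) (ennreal y))
        = (\<Sum>y\<in>A \<union> B. d' y * lap (ennreal u) (ennreal y))"
      using fun_cong[OF assms(5), of "ennreal u"] by (simp add: lap_comb_def c' d')
    then show "(\<Sum>y\<in>A \<union> B. (c' y - d' y) * exp (- (u * y))) = 0"
      using lap by (simp add: left_diff_distrib sum_subtractf)
  qed
  then show ?thesis by (simp add: c' d')
qed

lemma pregenerator_lap_comb:
  assumes "finite A" "A \<subseteq> {0<..}"
  shows "pregenerator \<psi> (lap_comb A c) = (\<lambda>x. \<Sum>y\<in>A. c y * pregenerator_exp \<psi> y x)"
  unfolding pregenerator_def
proof (rule the_equality)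
  show "\<exists>A' c'. finite A' \<and> A' \<subseteq> {0<..} \<and> lap_comb A c = lap_comb A' c' \<and>
      (\<lambda>x. \<Sum>y\<in>A. c y * pregenerator_exp \<psi> y x) = (\<lambda>x. \<Sum>y\<in>A'. c' y * pregenerator_exp \<psi> y x)"
    using assms by blast
next
  fix g
  assume "\<exists>A' c'. finite A' \<and> A' \<subseteq> {0<..} \<and> lap_comb A c = lap_comb A' c' \<and>
      g = (\<lambda>x. \<Sum>y\<in>A'. c' y * pregenerator_exp \<psi> y x)"
  then obtain A' c' where *: "finite A'" "A' \<subseteq> {0<..}" "lap_comb A c = lap_comb A' c'"
    and g: "g = (\<lambda>x. \<Sum>y\<in>A'. c' y * pregenerator_exp \<psi> y x)"
    by blast
  show "g = (\<lambda>x. \<Sum>y\<in>A. c y * pregenerator_exp \<psi> y x)"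
    unfolding g using lap_comb_eq_imp[OF assms *] by simp
qed

section \<open>Martingale problems\<close>

definition natural_filtration :: "'a measure \<Rightarrow> (real \<Rightarrow> 'a \<Rightarrow> ennreal) \<Rightarrow> real \<Rightarrow> 'a measure" where
  "natural_filtration M X t =
     sigma (space M) (\<Union>s\<in>{0..t}. {X s -` B \<inter> space M | B. B \<in> sets borel})"

definition martingale :: "'a measure \<Rightarrow> (real \<Rightarrow> 'a measure) \<Rightarrow> (real \<Rightarrow> 'a \<Rightarrow> real) \<Rightarrow> bool" where
  "martingale M F Z \<longleftrightarrow>
     filtration (space M) F \<and> (\<forall>t. subalgebra M (F t)) \<and>
     (\<forall>t\<ge>0. Z t \<in> borel_measurable (F t) \<and> integrable M (Z t)) \<and>
     (\<forall>s t. 0 \<le> s \<and> s \<le> t \<longrightarrow> (AE \<omega> in M. real_cond_exp M (F s) (Z t) \<omega> = Z s \<omega>))"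

text \<open>
  The process \<open>f(X\<^sub>t) - \<integral>\<^sub>0\<^sup>t g(X\<^sub>s) ds\<close> is a martingale in the natural filtration of \<open>X\<close>, the integrals
  being a.s. well-defined and finite.
\<close>

definition compensated_martingale ::
    "'a measure \<Rightarrow> (real \<Rightarrow> 'a \<Rightarrow> ennreal) \<Rightarrow> (ennreal \<Rightarrow> real) \<Rightarrow> (ennreal \<Rightarrow> real) \<Rightarrow> bool" where
  "compensated_martingale M X f g \<longleftrightarrow>
     (\<forall>t\<ge>0. AE \<omega> in M. set_integrable lborel {0..t} (\<lambda>s. g (X s \<omega>))) \<and>
     martingale M (natural_filtration M X)
       (\<lambda>t \<omega>. f (X t \<omega>) - (LINT s:{0..t}|lborel. g (X s \<omega>)))"

definition progressively_measurable :: "'a measure \<Rightarrow> (real \<Rightarrow> 'a \<Rightarrow> ennreal) \<Rightarrow> bool" where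
  "progressively_measurable M X \<longleftrightarrow>
     (\<forall>t\<ge>0. subalgebra M (natural_filtration M X t) \<and>
       (\<lambda>(s, \<omega>). X s \<omega>) \<in>
         borel_measurable (restrict_space borel {0..t} \<Otimes>\<^sub>M natural_filtration M X t))"

definition solves_martingale_problem ::
    "((ennreal \<Rightarrow> real) \<Rightarrow> (ennreal \<Rightarrow> real)) \<Rightarrow> ennreal measure \<Rightarrow>
     'a measure \<Rightarrow> (real \<Rightarrow> 'a \<Rightarrow> ennreal) \<Rightarrow> bool" where
  "solves_martingale_problem G \<mu> M X \<longleftrightarrow>
     prob_space M \<and> progressively_measurable M X \<and> distr M borel (X 0) = \<mu> \<and>
     (\<forall>f\<in>lap_span. compensated_martingale M X f (G f))"

section \<open>Path spaces and random times\<close>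

definition cadlag :: "(real \<Rightarrow> ennreal) \<Rightarrow> bool" where
  "cadlag \<omega> \<longleftrightarrow>
     (\<forall>t\<ge>0. (\<omega> \<longlongrightarrow> \<omega> t) (at_right t)) \<and> (\<forall>t>0. \<exists>l. (\<omega> \<longlongrightarrow> l) (at_left t))"

definition left_limit :: "(real \<Rightarrow> ennreal) \<Rightarrow> real \<Rightarrow> ennreal" where
  "left_limit \<omega> t = (if t = 0 then \<omega> 0 else Lim (at_left t) \<omega>)"

definition zeta :: "ennreal \<Rightarrow> (real \<Rightarrow> ennreal) \<Rightarrow> ennreal" where
  "zeta z \<omega> = Inf (ennreal ` {t. 0 \<le> t \<and> (left_limit \<omega> t = z \<or> \<omega> t = z)})"

text \<open>The space of cadlag paths that are stuck at \<open>z\<close> once they have reached (or approached) it.\<close>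

definition cadlag_absorbed :: "ennreal \<Rightarrow> (real \<Rightarrow> ennreal) set" where
  "cadlag_absorbed z =
     {\<omega>. cadlag \<omega> \<and> (zeta z \<omega> < \<infinity> \<longrightarrow> (\<forall>t\<ge>0. zeta z \<omega> \<le> ennreal t \<longrightarrow> \<omega> t = z))}"

definition no_continuous_explosion :: "(real \<Rightarrow> ennreal) \<Rightarrow> bool" where
  "no_continuous_explosion \<omega> \<longleftrightarrow>
     (zeta top \<omega> < \<infinity> \<longrightarrow> left_limit \<omega> (enn2real (zeta top \<omega>)) < \<infinity>)"

definition nonsticky :: "'a measure \<Rightarrow> (real \<Rightarrow> 'a \<Rightarrow> ennreal) \<Rightarrow> ennreal \<Rightarrow> ennreal \<Rightarrow> bool" where
  "nonsticky M X x0 z \<longleftrightarrow>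
     (x0 \<noteq> z \<longrightarrow> (\<forall>t\<ge>0. measure M {\<omega> \<in> space M. X t \<omega> \<noteq> z} = 1))"

definition time_above :: "(real \<Rightarrow> 'a \<Rightarrow> ennreal) \<Rightarrow> ennreal \<Rightarrow> 'a \<Rightarrow> ennreal" where
  "time_above X r \<omega> = Inf (ennreal ` {t. 0 \<le> t \<and> X t \<omega> > r})"

definition time_below :: "(real \<Rightarrow> 'a \<Rightarrow> ennreal) \<Rightarrow> ennreal \<Rightarrow> 'a \<Rightarrow> ennreal" where
  "time_below X r \<omega> = Inf (ennreal ` {t. 0 \<le> t \<and> X t \<omega> < r})"

text \<open>\<open>X\<close> at a random time; only meaningful where the random time is finite.\<close>

definition at_time :: "(real \<Rightarrow> 'a \<Rightarrow> ennreal) \<Rightarrow> ('a \<Rightarrow> ennreal) \<Rightarrow> 'a \<Rightarrow> ennreal" where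
  "at_time X \<sigma> \<omega> = X (enn2real (\<sigma> \<omega>)) \<omega>"

definition stopped :: "(real \<Rightarrow> 'a \<Rightarrow> ennreal) \<Rightarrow> ('a \<Rightarrow> ennreal) \<Rightarrow> real \<Rightarrow> 'a \<Rightarrow> ennreal" where
  "stopped X \<sigma> s = at_time X (\<lambda>\<omega>. min (ennreal s) (\<sigma> \<omega>))"

section \<open>The integrability conditions\<close>

text \<open>Condition (A): the first disjunct is the one for \<open>\<phi>\<^sub>+\<close>, the second for \<open>\<phi>\<^sub>-\<close>.\<close>

definition cond_A ::
    "'a measure \<Rightarrow> 'b measure \<Rightarrow> (ennreal \<Rightarrow> ennreal \<Rightarrow> real) \<Rightarrow> (real \<Rightarrow> 'a \<Rightarrow> ennreal) \<Rightarrow>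
     (real \<Rightarrow> 'b \<Rightarrow> ennreal) \<Rightarrow> ('a \<Rightarrow> ennreal) \<Rightarrow> ('b \<Rightarrow> ennreal) \<Rightarrow> bool" where
  "cond_A M N \<phi> X Y \<sigma> \<tau> \<longleftrightarrow>
     (\<forall>T\<ge>0. (\<integral>\<^sup>+ t\<in>{0..T}. (\<integral>\<^sup>+ s\<in>{0..T}.
        (\<integral>\<^sup>+ (\<omega>, \<eta>). ennreal (max (\<phi> (stopped X \<sigma> s \<omega>) (stopped Y \<tau> t \<eta>)) 0) \<partial>(M \<Otimes>\<^sub>M N))
          * indicator {0..T} (s + t) \<partial>lborel) \<partial>lborel) < \<infinity>) \<or>
     (\<forall>T\<ge>0. (\<integral>\<^sup>+ t\<in>{0..T}. (\<integral>\<^sup>+ s\<in>{0..T}.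
        (\<integral>\<^sup>+ (\<omega>, \<eta>). ennreal (max (- \<phi> (stopped X \<sigma> s \<omega>) (stopped Y \<tau> t \<eta>)) 0) \<partial>(M \<Otimes>\<^sub>M N))
          * indicator {0..T} (s + t) \<partial>lborel) \<partial>lborel) < \<infinity>)"

definition cond_B ::
    "'a measure \<Rightarrow> 'b measure \<Rightarrow> (ennreal \<Rightarrow> ennreal \<Rightarrow> real) \<Rightarrow> (real \<Rightarrow> 'a \<Rightarrow> ennreal) \<Rightarrow>
     (real \<Rightarrow> 'b \<Rightarrow> ennreal) \<Rightarrow> ('a \<Rightarrow> ennreal) \<Rightarrow> ('b \<Rightarrow> ennreal) \<Rightarrow> bool" where
  "cond_B M N \<phi> X Y \<sigma> \<tau> \<longleftrightarrow>
     (AE t in lborel. 0 \<le> t \<longrightarrow>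
        (\<integral>\<^sup>+ (\<omega>, \<eta>). ennreal \<bar>\<phi> (at_time X \<sigma> \<omega>) (at_time Y \<tau> \<eta>)\<bar>
           * indicator {(\<omega>, \<eta>). \<sigma> \<omega> + \<tau> \<eta> \<le> ennreal t} (\<omega>, \<eta>) \<partial>(M \<Otimes>\<^sub>M N)) < \<infinity>)"

end

theory Submission
  imports Defs
begin

text \<open>
  Let \<open>F\<close> and \<open>G\<close> be the processes \<open>X\<close> and \<open>Y\<close> stopped at hitting times \<open>\<sigma>\<close> and \<open>\<tau>\<close> of open sets, and let
  \<open>f(s,t) = E[exp(-F\<^sub>s G\<^sub>t)]\<close>. The stopped martingale problems express \<open>f(s,t) - f(0,t)\<close> and
  \<open>f(s,t) - f(s,0)\<close> as time integrals of \<open>E[\<phi>(F,G)]\<close> up to \<open>\<sigma>\<close> and \<open>\<tau>\<close>, respectively. Integrated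
  along the antidiagonal \<open>s + t = U\<close>, both become integrals over the triangle \<open>s + t \<le> U\<close> in which the
  contributions of \<open>{s < \<sigma>, t < \<tau>}\<close> are equal; they cancel since they are absolutely integrable: condition (A) bounds one sign of \<open>\<phi>\<close>, and the other
  sign follows because increments of the kernel are bounded by one. What remains of
  \<open>\<integral>\<^sub>0\<^sup>U (f(s,0) - f(0,s)) ds\<close> are increments of the kernel with one argument frozen at its stopped value,
  hence bounded terms, which vanish as the sets shrink to the absorbing point. Thus
  \<open>f(s,0) = f(0,s)\<close> for almost every \<open>s\<close>, and for every \<open>s\<close> by right-continuity.

  Fubini and optional stopping are unproblematic because \<open>\<phi>(\<cdot>,y)\<close> is bounded for each \<open>y \<in> (0,\<infinity>)\<close>:
  by duality it is a Laplace exponent with jump measure on \<open>[-y,\<infinity>)\<close>, damped by \<open>exp(-xy)\<close>.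
\<close>

section \<open>The Laplace kernel and hitting times of paths\<close>

text \<open>Two obstacles shape the proof. The first is the kernel itself: it is 0 at the corners
  (0,\<infinity>) and (\<infinity>,0), but takes all values between 0 and 1 near them. Every limit
  has to stay away from these corners, and this is what non-stickiness, absorption and the absence
  of continuous explosion achieve. The second is the exponent 0. The function with exponent 0 is the
  indicator of [0,\<infinity>); it lies outside the domain of the generators, and no bound on
  \<open>\<phi>\<close> is available on the axes. Yet a stopped process may sit at 0, and then the
  other one needs a Dynkin formula with exponent 0. The cases differ mainly in its source. In (I),
  \<open>Y\<close> avoids 0 and the formula for \<open>Y\<close> is the assumed martingale. In (II)
  both stopped processes avoid 0. In (III) the formula for \<open>X\<close> reads 1 - 1 = 0, as
  \<open>\<phi>\<close> vanishes on that axis, and the one for \<open>Y\<close> is a limit of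
  formulas with positive exponents. In (IV) both read 1 - 1 = 0.\<close>

lemma tendsto_exp_enn2real:
  fixes x :: ennreal
  assumes "(f \<longlongrightarrow> x) F"
  shows "((\<lambda>k. if f k = top then 0 else exp (- enn2real (f k)))
           \<longlongrightarrow> (if x = top then 0 else exp (- enn2real x))) F"
proof (cases "x = top")
  case True
  have "((\<lambda>k. if f k = top then 0 else exp (- enn2real (f k))) \<longlongrightarrow> 0) F"
  proof (rule order_tendstoI)
    fix a :: real assume "a < 0"
    then show "\<forall>\<^sub>F k in F. a < (if f k = top then 0 else exp (- enn2real (f k)))"
      by (intro always_eventually) (auto intro: less_trans[OF _ exp_gt_zero])
  next
    fix a :: real assume a: "0 < a"
    \<comment> \<open>Beyond -ln a the exponential is below a; the maximum with 0 covers a \<ge> 1,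
      where the threshold would be negative.\<close>
    have "\<forall>\<^sub>F k in F. ennreal (max 0 (- ln a)) < f k"
      using order_tendstoD(1)[OF assms, of "ennreal (max 0 (- ln a))"] True by simp
    then show "\<forall>\<^sub>F k in F. (if f k = top then 0 else exp (- enn2real (f k))) < a"
    proof eventually_elim
      case (elim k)
      show ?case
      proof (cases "f k = top")
        case False
        then have "max 0 (- ln a) < enn2real (f k)"
        proof -
          have "f k = ennreal (enn2real (f k))" using False by (simp add: less_top)
          with elim have "ennreal (max 0 (- ln a)) < ennreal (enn2real (f k))" by argo
          then show ?thesis by (subst (asm) ennreal_less_iff) auto
        qed
        then have "exp (- enn2real (f k)) < exp (ln a)" by simp
        then show ?thesis using a False by simp
      qed (use a in simp)
    qed
  qed
  then show ?thesis using True by simp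
next
  case False
  then obtain r where r: "x = ennreal r" "0 \<le> r" by (cases x) auto
  have "\<forall>\<^sub>F k in F. f k < top"
    using order_tendstoD(2)[OF assms, of top] False by (simp add: less_top)
  then have "\<forall>\<^sub>F k in F. exp (- enn2real (f k)) = (if f k = top then 0 else exp (- enn2real (f k)))"
    by eventually_elim auto
  moreover have "((\<lambda>k. exp (- enn2real (f k))) \<longlongrightarrow> exp (- enn2real x)) F"
    using tendsto_enn2real[of f r F] assms r by (auto intro!: tendsto_intros)
  ultimately show ?thesis using False by (simp add: tendsto_cong)
qed

text \<open>At the two excluded corners the product in \<open>ennreal\<close> is 0 and the
  right-hand side would be 1, whereas \<open>lap\<close> is 0. The case of an infinite product is
  separate because \<open>enn2real top = 0\<close>.\<close>

lemma lap_eq_mult: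
  assumes "\<not> (x = 0 \<and> y = top)" "\<not> (x = top \<and> y = 0)"
  shows "lap x y = (if x * y = top then 0 else exp (- enn2real (x * y)))"
  using assms by (auto simp: lap_def enn2real_mult ennreal_mult_eq_top_iff ennreal_top_mult ennreal_mult_top)

text \<open>Multiplication on [0,\<infinity>] is continuous away from the corners, and so is the
  kernel. At the corners it is not: \<open>lap x 0\<close> is 1 for all finite \<open>x\<close> but
  0 for \<open>x = top\<close>.\<close>

lemma tendsto_lap:
  assumes f: "(f \<longlongrightarrow> x) F" and g: "(g \<longlongrightarrow> y) F"
    and xy: "\<not> (x = 0 \<and> y = top)" "\<not> (x = top \<and> y = 0)"
  shows "((\<lambda>k. lap (f k) (g k)) \<longlongrightarrow> lap x y) F"
proof -
  \<comment> \<open>The two functions must eventually avoid the corners as well, since the product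
    formula for \<open>lap\<close> is applied along the filter and not only at the limit.\<close>
  have ev0: "\<forall>\<^sub>F k in F. h k \<noteq> 0" if "(h \<longlongrightarrow> z) F" "z \<noteq> 0" for h :: "_ \<Rightarrow> ennreal" and z
    using order_tendstoD(1)[OF that(1), of 0] that(2) by (auto simp: zero_less_iff_neq_zero elim: eventually_mono)
  have evt: "\<forall>\<^sub>F k in F. h k \<noteq> top" if "(h \<longlongrightarrow> z) F" "z \<noteq> top" for h :: "_ \<Rightarrow> ennreal" and z
    using order_tendstoD(2)[OF that(1), of top] that(2) by (auto simp: less_top elim: eventually_mono)
  have "\<forall>\<^sub>F k in F. \<not> (f k = 0 \<and> g k = top)"
    using ev0[OF f] evt[OF g] xy(1) by (cases "x = 0") (auto elim: eventually_mono)
  moreover have "\<forall>\<^sub>F k in F. \<not> (f k = top \<and> g k = 0)"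
    using evt[OF f] ev0[OF g] xy(2) by (cases "x = top") (auto elim: eventually_mono)
  ultimately have "\<forall>\<^sub>F k in F. (if f k * g k = top then 0 else exp (- enn2real (f k * g k))) = lap (f k) (g k)"
    by eventually_elim (simp add: lap_eq_mult)
  moreover have "((\<lambda>k. f k * g k) \<longlongrightarrow> x * y) F"
    by (rule tendsto_mult_ennreal[OF f g]) (use xy in auto)
  note tendsto_exp_enn2real[OF this]
  ultimately show ?thesis
    unfolding lap_eq_mult[OF xy] by (rule tendsto_cong[THEN iffD1])
qed

lemma lap_bounds: "0 \<le> lap x y" "lap x y \<le> 1" "\<bar>lap x y\<bar> \<le> 1"
  by (auto simp: lap_def)

lemma lap_commute: "lap x y = lap y x"
  by (auto simp: lap_def mult.commute)

lemma lap_top [simp]: "lap top y = 0" "lap x top = 0"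
  by (auto simp: lap_def)

lemma lap_zero: "lap 0 y = indicator {..<top} y" "lap x 0 = indicator {..<top} x"
  by (auto simp: lap_def less_top)

lemma measurable_lap [measurable]:
  assumes [measurable]: "f \<in> borel_measurable M" "g \<in> borel_measurable M"
  shows "(\<lambda>x. lap (f x) (g x)) \<in> borel_measurable M"
  unfolding lap_def by measurable

section \<open>Hitting times of sets by right-continuous paths\<close>

definition hit_time :: "ennreal set \<Rightarrow> (real \<Rightarrow> ennreal) \<Rightarrow> ennreal" where
  "hit_time A p = Inf (ennreal ` {t. 0 \<le> t \<and> p t \<in> A})"

lemma hit_time_empty [simp]: "hit_time {} p = top"
  by (simp add: hit_time_def)

lemma hit_time_Un: "hit_time (A \<union> B) p = min (hit_time A p) (hit_time B p)"
proof -
  have "{t. 0 \<le> t \<and> p t \<in> A \<union> B} = {t. 0 \<le> t \<and> p t \<in> A} \<union> {t. 0 \<le> t \<and> p t \<in> B}" by auto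
  then show ?thesis
    by (simp add: hit_time_def image_Un Inf_union_distrib inf_min)
qed

lemma hit_time_antimono: "A \<subseteq> B \<Longrightarrow> hit_time B p \<le> hit_time A p"
  unfolding hit_time_def by (intro Inf_superset_mono image_mono) auto

lemma hit_time_le: "0 \<le> t \<Longrightarrow> p t \<in> A \<Longrightarrow> hit_time A p \<le> ennreal t"
  unfolding hit_time_def by (rule Inf_lower) auto

lemma hit_time_less_iff: "hit_time A p < ennreal t \<longleftrightarrow> (\<exists>r. 0 \<le> r \<and> r < t \<and> p r \<in> A)"
  unfolding hit_time_def Inf_less_iff by (auto simp: ennreal_less_iff)

text \<open>The path may enter \<open>A\<close> only immediately after the infimum, so membership in
  the closure is the best possible. If the value were outside the closure, right-continuity would
  keep the path out of \<open>A\<close> for a while longer, which would delay the hit.\<close>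

lemma hit_time_attained:
  assumes rc: "(p \<longlongrightarrow> p t) (at_right t)" and t: "0 \<le> t" and hit: "hit_time A p = ennreal t"
  shows "p t \<in> closure A"
proof (rule ccontr)
  assume n: "p t \<notin> closure A"
  have "\<forall>\<^sub>F r in at_right t. p r \<in> - closure A"
    by (rule topological_tendstoD[OF rc]) (use n in auto)
  then obtain b where b: "t < b" "\<And>r. t < r \<Longrightarrow> r < b \<Longrightarrow> p r \<notin> closure A"
    unfolding eventually_at_right_field by auto
  have "hit_time A p < ennreal b" using hit b t by (simp add: ennreal_less_iff)
  then obtain r where r: "0 \<le> r" "r < b" "p r \<in> A" unfolding hit_time_less_iff by auto
  have "t \<le> r" using hit_time_le[OF r(1), of p A] r hit t by (simp add: ennreal_le_iff)
  moreover have "p r \<in> closure A" using r(3) closure_subset by blast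
  ultimately show False using b(2)[of r] n r(2) by (cases "r = t") auto
qed

text \<open>A bounded increasing sequence of times either reaches its limit, and is then eventually
  constant, or stays strictly below it, and then the path values converge to the left limit.\<close>

lemma cadlag_incseq:
  assumes p: "cadlag p" and inc: "incseq \<sigma>" and s: "\<And>k. 0 \<le> \<sigma> k" "\<And>k. \<sigma> k \<le> s"
  obtains t where "0 \<le> t" "t \<le> s" "\<And>k. \<sigma> k \<le> t"
    "(\<exists>K. \<forall>k\<ge>K. \<sigma> k = t) \<or> ((\<forall>k. \<sigma> k < t) \<and> \<sigma> \<longlonglongrightarrow> t \<and> (\<lambda>k. p (\<sigma> k)) \<longlonglongrightarrow> left_limit p t)"
proof -
  obtain t where t: "\<sigma> \<longlonglongrightarrow> t" "\<And>k. \<sigma> k \<le> t"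
    using incseq_convergent[OF inc, of s] s by blast
  have ts: "t \<le> s" using t(1) s(2) by (meson LIMSEQ_le_const2)
  have t0: "0 \<le> t" using t(2)[of 0] s(1)[of 0] by simp
  show ?thesis
  proof (cases "\<exists>K. \<sigma> K = t")
    case True
    then obtain K where "\<sigma> K = t" by auto
    then have "\<forall>k\<ge>K. \<sigma> k = t" using t(2) inc by (metis incseqD antisym)
    then show ?thesis using that[of t] t0 ts t(2) by blast
  next
    case False
    then have less: "\<sigma> k < t" for k using t(2)[of k] by (metis order_le_less)
    then have tpos: "0 < t" using s(1)[of 0] by (meson order_le_less_trans)
    then obtain l where l: "(p \<longlongrightarrow> l) (at_left t)" using p unfolding cadlag_def by auto
    have "filterlim \<sigma> (at_left t) sequentially"
      using t(1) less by (auto simp: filterlim_at intro: always_eventually less_imp_neq)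
    from filterlim_compose[OF l this] have "(\<lambda>k. p (\<sigma> k)) \<longlonglongrightarrow> l" .
    moreover have "left_limit p t = l"
      unfolding left_limit_def using tpos tendsto_Lim[OF _ l] by simp
    ultimately show ?thesis using that[of t] t0 ts t less by blast
  qed
qed

lemma absorbedD:
  assumes "p \<in> cadlag_absorbed z" "0 \<le> t" "p t = z \<or> left_limit p t = z" "t \<le> s"
  shows "p s = z"
proof -
  have "zeta z p \<le> ennreal t" unfolding zeta_def by (rule Inf_lower) (use assms in auto)
  also have "\<dots> \<le> ennreal s" using assms by (simp add: ennreal_leI)
  finally have "zeta z p \<le> ennreal s" .
  moreover have "zeta z p < \<infinity>" using \<open>zeta z p \<le> ennreal s\<close> by (simp add: le_less_trans)
  ultimately show ?thesis using assms unfolding cadlag_absorbed_def by auto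
qed

lemma absorbed_cadlag: "p \<in> cadlag_absorbed z \<Longrightarrow> cadlag p"
  by (simp add: cadlag_absorbed_def)

lemma cadlag_right: "cadlag p \<Longrightarrow> 0 \<le> t \<Longrightarrow> (p \<longlongrightarrow> p t) (at_right t)"
  by (simp add: cadlag_def)

section \<open>Stopped paths along shrinking sets\<close>

definition stop_path :: "(real \<Rightarrow> ennreal) \<Rightarrow> ennreal \<Rightarrow> real \<Rightarrow> ennreal" where
  "stop_path p \<sigma> s = p (enn2real (min (ennreal s) \<sigma>))"

lemma stop_path_before: "0 \<le> s \<Longrightarrow> ennreal s \<le> \<sigma> \<Longrightarrow> stop_path p \<sigma> s = p s"
  by (simp add: stop_path_def min_def)

lemma stop_path_after: "0 \<le> s \<Longrightarrow> \<sigma> \<le> ennreal s \<Longrightarrow> stop_path p \<sigma> s = p (enn2real \<sigma>)"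
  by (simp add: stop_path_def min_def)

lemma stop_path_closure:
  assumes "cadlag p" "0 \<le> s" "hit_time A p \<le> ennreal s"
  shows "stop_path p (hit_time A p) s \<in> closure A"
proof -
  have "hit_time A p = ennreal (enn2real (hit_time A p))"
    using assms by (metis ennreal_enn2real le_less_trans ennreal_less_top)
  then show ?thesis using assms hit_time_attained[of p "enn2real (hit_time A p)" A]
    by (simp add: stop_path_after cadlag_right)
qed

text \<open>Smaller sets are hit later, so the hitting times increase. Either they pass
  \<open>s\<close>, or they all stay below \<open>s\<close> and \<open>cadlag_incseq\<close>
  applies: in the case \<open>jump\<close> the limit time is reached, and in the case
  \<open>approach\<close> only the left limit there is seen.\<close>

lemma stop_path_hit_cases:
  fixes A :: "nat \<Rightarrow> ennreal set"
  assumes p: "cadlag p" and anti: "antimono A" and s: "0 \<le> s"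
  obtains (before) K where "\<And>k. K \<le> k \<Longrightarrow> ennreal s < hit_time (A k) p"
      "\<And>k. K \<le> k \<Longrightarrow> stop_path p (hit_time (A k) p) s = p s"
  | (jump) K t where "0 \<le> t" "t \<le> s" "\<And>k. stop_path p (hit_time (A k) p) s \<in> closure (A k)"
      "\<And>k. K \<le> k \<Longrightarrow> stop_path p (hit_time (A k) p) s = p t"
  | (approach) t \<sigma> where "0 \<le> t" "t \<le> s" "\<And>k. stop_path p (hit_time (A k) p) s \<in> closure (A k)"
      "\<And>k. stop_path p (hit_time (A k) p) s = p (\<sigma> k)" "\<And>k. 0 \<le> \<sigma> k" "\<sigma> \<longlonglongrightarrow> t" "\<And>k. \<sigma> k < t"
      "(\<lambda>k. stop_path p (hit_time (A k) p) s) \<longlonglongrightarrow> left_limit p t"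
proof (cases "\<exists>K. ennreal s < hit_time (A K) p")
  case True
  then obtain K where K: "ennreal s < hit_time (A K) p" by auto
  have "ennreal s < hit_time (A k) p" if "K \<le> k" for k
    using K hit_time_antimono[OF antimonoD[OF anti that]] by (rule less_le_trans)
  note less = this
  show ?thesis
  proof (rule before[of K])
    fix k assume "K \<le> k"
    then show "ennreal s < hit_time (A k) p" by (rule less)
    then show "stop_path p (hit_time (A k) p) s = p s" using s by (intro stop_path_before) (auto intro: less_imp_le)
  qed
next
  case False
  then have le: "hit_time (A k) p \<le> ennreal s" for k by (simp add: not_less)
  have cl: "stop_path p (hit_time (A k) p) s \<in> closure (A k)" for k
    by (rule stop_path_closure[OF p s le])
  define \<sigma> where "\<sigma> k = enn2real (hit_time (A k) p)" for k
  have eq: "stop_path p (hit_time (A k) p) s = p (\<sigma> k)" for k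
    using s le by (simp add: stop_path_after \<sigma>_def)
  have h: "hit_time (A k) p = ennreal (\<sigma> k)" for k
    unfolding \<sigma>_def using le[of k] by (metis ennreal_enn2real le_less_trans ennreal_less_top)
  have b0: "0 \<le> \<sigma> k" for k by (simp add: \<sigma>_def)
  have b: "\<sigma> k \<le> s" for k using le[of k] s unfolding h by (simp add: ennreal_le_iff)
  have inc: "incseq \<sigma>"
  proof (rule incseq_SucI)
    fix k
    have "ennreal (\<sigma> k) \<le> ennreal (\<sigma> (Suc k))"
      unfolding h[symmetric] by (rule hit_time_antimono[OF antimonoD[OF anti]]) simp
    then show "\<sigma> k \<le> \<sigma> (Suc k)" by (simp add: ennreal_le_iff b0)
  qed
  from cadlag_incseq[OF p inc b0 b] obtain t' where t': "0 \<le> t'" "t' \<le> s" "\<And>k. \<sigma> k \<le> t'"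
    "(\<exists>K. \<forall>k\<ge>K. \<sigma> k = t') \<or> ((\<forall>k. \<sigma> k < t') \<and> \<sigma> \<longlonglongrightarrow> t' \<and> (\<lambda>k. p (\<sigma> k)) \<longlonglongrightarrow> left_limit p t')"
    by blast
  show ?thesis
    using t'(4)
  proof
    assume "\<exists>K. \<forall>k\<ge>K. \<sigma> k = t'"
    then show ?thesis using jump[of t'] t' cl eq by metis
  next
    assume "(\<forall>k. \<sigma> k < t') \<and> \<sigma> \<longlonglongrightarrow> t' \<and> (\<lambda>k. p (\<sigma> k)) \<longlonglongrightarrow> left_limit p t'"
    then show ?thesis using approach[of t' \<sigma>] t' cl eq b0 by simp
  qed
qed

text \<open>If all sets are hit by time \<open>s\<close>, the values at the hitting times tend to
  \<open>z\<close>. By the trichotomy the path is at \<open>z\<close>, or has left limit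
  \<open>z\<close>, at some time up to \<open>s\<close>; absorption then gives
  \<open>p s = z\<close>, the same limit.\<close>

lemma stop_path_absorbed_tendsto:
  fixes A :: "nat \<Rightarrow> ennreal set"
  assumes p: "p \<in> cadlag_absorbed z" and anti: "antimono A"
    and lim: "\<And>x. (\<And>k. x k \<in> closure (A k)) \<Longrightarrow> x \<longlonglongrightarrow> z" and s: "0 \<le> s"
  shows "(\<lambda>k. stop_path p (hit_time (A k) p) s) \<longlonglongrightarrow> p s"
using absorbed_cadlag[OF p] anti s
proof (cases rule: stop_path_hit_cases)
  case (before K)
  then show ?thesis by (intro tendsto_eventually eventually_sequentiallyI[of K]) auto
next
  case (jump K t)
  have "(\<lambda>k. stop_path p (hit_time (A k) p) s) \<longlonglongrightarrow> p t"
    using jump(4) by (intro tendsto_eventually eventually_sequentiallyI[of K]) auto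
  with lim[of "\<lambda>k. stop_path p (hit_time (A k) p) s"] jump(3) have "p t = z" using LIMSEQ_unique by blast
  then have "p s = z" using absorbedD[OF p jump(1) _ jump(2)] by simp
  then show ?thesis using lim jump(3) by auto
next
  case (approach t \<sigma>)
  with lim[of "\<lambda>k. stop_path p (hit_time (A k) p) s"] have "left_limit p t = z" using LIMSEQ_unique by blast
  then have "p s = z" using absorbedD[OF p approach(1) _ approach(2)] by simp
  then show ?thesis using lim approach(3) by auto
qed

text \<open>The sets now shrink to two points. At \<open>top\<close> equality is obtained and not
  mere convergence: the kernel with other argument 0 is 1 at every finite value but 0 at
  \<open>top\<close>, so convergence would be too weak there.\<close>

lemma stop_path_two_sided:
  fixes A :: "nat \<Rightarrow> ennreal set"
  assumes p: "p \<in> cadlag_absorbed 0" "p \<in> cadlag_absorbed top" "no_continuous_explosion p"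
    and anti: "antimono A"
    and A: "\<And>x l. (\<And>k. x k \<in> closure (A k)) \<Longrightarrow> x \<longlonglongrightarrow> l \<Longrightarrow> l = 0 \<or> l = top" and s: "0 \<le> s"
  shows "(\<exists>K. \<forall>k\<ge>K. stop_path p (hit_time (A k) p) s = p s \<and> (ennreal s < hit_time (A k) p \<or> p s = top))
     \<or> (p s = 0 \<and> (\<lambda>k. stop_path p (hit_time (A k) p) s) \<longlonglongrightarrow> 0)"
using absorbed_cadlag[OF p(1)] anti s
proof (cases rule: stop_path_hit_cases)
  case (before K)
  then show ?thesis by (intro disjI1 exI[of _ K]) auto
next
  case (jump K t)
  have l: "(\<lambda>k. stop_path p (hit_time (A k) p) s) \<longlonglongrightarrow> p t"
    using jump(4) by (intro tendsto_eventually eventually_sequentiallyI[of K]) auto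
  from A[of "\<lambda>k. stop_path p (hit_time (A k) p) s"] jump(3) l have "p t = 0 \<or> p t = top" by blast
  then have "(p t = 0 \<and> p s = 0) \<or> (p t = top \<and> p s = top)"
    using absorbedD[OF p(1) jump(1) _ jump(2)] absorbedD[OF p(2) jump(1) _ jump(2)] by auto
  then show ?thesis using jump(4) l by (elim disjE) fastforce+
next
  case (approach t \<sigma>)
  from A[of "\<lambda>k. stop_path p (hit_time (A k) p) s", OF approach(3,8)]
  consider "left_limit p t = 0" | "left_limit p t = top" by blast
  then show ?thesis
  proof cases
    case 1
    then show ?thesis using absorbedD[OF p(1) approach(1) _ approach(2)] approach(8) by simp
  next
    case 2
    have ps: "p s = top" using absorbedD[OF p(2) approach(1) _ approach(2)] 2 by simp
    show ?thesis
    \<comment> \<open>If the path is at \<open>top\<close> at one of the hitting times, absorption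
      makes all later stopped values equal to \<open>top\<close>. Otherwise it is finite along the
      sequence, \<open>t\<close> is exactly the explosion time, and the left limit
      \<open>top\<close> there is a continuous explosion.\<close>
    proof (cases "\<exists>K. p (\<sigma> K) = top")
      case True
      have z: "zeta top p \<le> ennreal t" unfolding zeta_def by (rule Inf_lower) (use 2 approach in auto)
      obtain K where K: "p (\<sigma> K) = top" using True by auto
      have "\<forall>\<^sub>F k in sequentially. \<sigma> K < \<sigma> k"
        using order_tendstoD(1)[OF approach(6,7)] .
      then obtain K' where "\<And>k. K' \<le> k \<Longrightarrow> \<sigma> K < \<sigma> k" unfolding eventually_sequentially by auto
      then have "p (\<sigma> k) = top" if "K' \<le> k" for k
        using absorbedD[OF p(2) approach(5), of K "\<sigma> k"] K that by (simp add: less_imp_le)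
      then show ?thesis using ps approach(4) by metis
    next
      case False
      have z: "zeta top p \<le> ennreal t" unfolding zeta_def by (rule Inf_lower) (use 2 approach in auto)
      have "ennreal t \<le> zeta top p"
        unfolding zeta_def
      proof (rule Inf_greatest)
        fix x assume "x \<in> ennreal ` {t. 0 \<le> t \<and> (left_limit p t = top \<or> p t = top)}"
        then obtain r where x: "x = ennreal r" and r: "0 \<le> r" "left_limit p r = top \<or> p r = top" by auto
        show "ennreal t \<le> x"
          unfolding x
        proof (rule ccontr)
          assume "\<not> ennreal t \<le> ennreal r"
          then have "r < t" using r by (simp add: not_le ennreal_less_iff)
          from order_tendstoD(1)[OF approach(6) this] obtain k where "r < \<sigma> k"
            unfolding eventually_sequentially by auto
          then have "p (\<sigma> k) = top" using absorbedD[OF p(2) r(1), of "\<sigma> k"] r(2) by auto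
          then show False using False by auto
        qed
      qed
      with z have "zeta top p = ennreal t" by simp
      then have "left_limit p t < top"
        using p(3) approach(1) unfolding no_continuous_explosion_def by simp
      then show ?thesis using 2 by simp
    qed
  qed
qed

text \<open>The corner with \<open>y = top\<close> is harmless because the kernel is then constantly
  0. At the corner with \<open>p t = top\<close> and \<open>y = 0\<close>, absorption makes the path
  constant from \<open>t\<close> on.\<close>

lemma lap_right_continuous:
  assumes p: "p \<in> cadlag_absorbed top" and t: "0 \<le> t"
  shows "((\<lambda>r. lap (p r) y) \<longlongrightarrow> lap (p t) y) (at_right t)"
proof -
  have rc: "(p \<longlongrightarrow> p t) (at_right t)" using p t by (simp add: absorbed_cadlag cadlag_right)
  consider "y = top" | "p t = top" | "y \<noteq> top" "p t \<noteq> top" by blast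
  then show ?thesis
  proof cases
    case 2
    then have "\<forall>\<^sub>F r in at_right t. p r = top"
      using absorbedD[OF p t] by (auto intro: eventually_at_rightI[of t "t + 1"])
    then show ?thesis using 2 by (intro tendsto_eventually) (auto elim: eventually_mono)
  qed (auto intro!: tendsto_lap rc)
qed

section \<open>Laplace symbols\<close>

lemma abs_exp_minus_one_minus_le:
  fixes v :: real
  shows "\<bar>exp v - 1 - v\<bar> \<le> v\<^sup>2 * exp \<bar>v\<bar>"
proof -
  obtain t where t: "\<bar>t\<bar> \<le> \<bar>v\<bar>" "exp v = (\<Sum>m<2. v ^ m / fact m) + exp t / fact 2 * v ^ 2"
    using Maclaurin_exp_le[of v 2] by auto
  then have "exp v - 1 - v = exp t / 2 * v\<^sup>2" by (simp add: numeral_2_eq_2)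
  moreover have "exp t / 2 * v\<^sup>2 \<le> exp \<bar>v\<bar> * v\<^sup>2"
  proof (rule mult_right_mono)
    have "exp t \<le> exp \<bar>v\<bar>" using t(1) by simp
    then show "exp t / 2 \<le> exp \<bar>v\<bar>" by (smt (verit) exp_gt_zero field_sum_of_halves)
  qed simp
  moreover have "0 \<le> exp t / 2 * v\<^sup>2" by simp
  ultimately show ?thesis by (metis abs_of_nonneg mult.commute)
qed

text \<open>The first bound is v \<le> exp v at v = cy. The second squares the first with c/2 in
  place of c, whence the 4.\<close>

lemma mult_exp_minus_le:
  fixes c y :: real
  assumes "0 < c" "0 \<le> y"
  shows "y * exp (- (c * y)) \<le> 1 / c" "y\<^sup>2 * exp (- (c * y)) \<le> 4 / c\<^sup>2"
proof -
  have *: "y * exp (- (c * y)) \<le> 1 / c" if "0 < c" for c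
  proof -
    have "c * y \<le> exp (c * y)" using exp_ge_add_one_self[of "c * y"] by linarith
    then show ?thesis using that by (simp add: exp_minus field_simps)
  qed
  show "y * exp (- (c * y)) \<le> 1 / c" by (rule *) fact
  have "(y * exp (- ((c / 2) * y)))\<^sup>2 \<le> (1 / (c / 2))\<^sup>2"
    using *[of "c / 2"] assms by (intro power_mono) auto
  moreover have "(exp (- ((c / 2) * y)))\<^sup>2 = exp (- (c * y))"
    by (simp add: power2_eq_square flip: exp_add)
  ultimately show "y\<^sup>2 * exp (- (c * y)) \<le> 4 / c\<^sup>2"
    by (simp add: power_mult_distrib power_divide)
qed

definition levy_integrand :: "real \<Rightarrow> real \<Rightarrow> real" where
  "levy_integrand y u = exp (- (u * y)) - 1 + u * y * indicator {-1..1} u"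

lemma measurable_levy_integrand [measurable]: "levy_integrand y \<in> borel_measurable borel"
  unfolding levy_integrand_def by measurable

lemma levy_integrand_small:
  assumes "\<bar>u\<bar> \<le> 1" "0 \<le> y"
  shows "\<bar>levy_integrand y u\<bar> \<le> u\<^sup>2 * (y\<^sup>2 * exp (\<bar>u\<bar> * y))"
proof -
  have "levy_integrand y u = exp (- (u * y)) - 1 - (- (u * y))"
    using assms by (simp add: levy_integrand_def indicator_def abs_le_iff)
  then show ?thesis using abs_exp_minus_one_minus_le[of "- (u * y)"] assms
    by (simp add: power_mult_distrib abs_mult mult.assoc)
qed

text \<open>A dominating function uniform in y \<le> Y, for continuity in \<open>y\<close>. The
  quadratic bound gives the first summand of the constant; for |u| > 1 the integrand is exp(-uy) -
  1, where u \<ge> -x bounds the exponential by exp(xY).\<close>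

lemma levy_integrand_bound:
  assumes "0 < y" "y \<le> Y" "- x \<le> u" "0 < x"
  shows "\<bar>levy_integrand y u\<bar> \<le> (Y\<^sup>2 * exp Y + exp (x * Y) + 1) * min 1 (u\<^sup>2)"
proof (cases "\<bar>u\<bar> \<le> 1")
  case True
  have "\<bar>levy_integrand y u\<bar> \<le> u\<^sup>2 * (y\<^sup>2 * exp (\<bar>u\<bar> * y))"
    by (rule levy_integrand_small) (use True assms in auto)
  also have "\<dots> \<le> u\<^sup>2 * (Y\<^sup>2 * exp (1 * Y))"
    by (intro mult_left_mono mult_mono power_mono exp_le_cancel_iff[THEN iffD2]) (use assms True in auto)
  also have "\<dots> \<le> u\<^sup>2 * (Y\<^sup>2 * exp Y + exp (x * Y) + 1)"
    by (intro mult_left_mono) (auto intro: add_nonneg_nonneg)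
  also have "u\<^sup>2 = min 1 (u\<^sup>2)" using True by (simp add: abs_square_le_1)
  finally show ?thesis by (simp add: mult.commute)
next
  case False
  have "1 < u\<^sup>2" using False by (metis not_le one_less_power power2_abs zero_less_numeral)
  then have "min 1 (u\<^sup>2) = 1" by simp
  moreover have "levy_integrand y u = exp (- (u * y)) - 1"
    using False by (auto simp: levy_integrand_def indicator_def)
  moreover have "exp (- (u * y)) \<le> exp (x * Y)"
  proof -
    have "(- u) * y \<le> x * y" using assms by (intro mult_right_mono) auto
    also have "\<dots> \<le> x * Y" using assms by (intro mult_left_mono) auto
    finally show ?thesis by simp
  qed
  moreover have "0 \<le> Y\<^sup>2 * exp Y" by simp
  ultimately have "\<bar>levy_integrand y u\<bar> \<le> Y\<^sup>2 * exp Y + exp (x * Y) + 1"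
    using exp_gt_zero[of "- (u * y)"] by linarith
  then show ?thesis using \<open>min 1 (u\<^sup>2) = 1\<close> by simp
qed

text \<open>
  For small \<open>|u|\<close> the factor \<open>exp(|u|y)\<close> of the quadratic bound is absorbed by half of the damping; for
  \<open>|u| > x/2\<close> the bound is uniform by \<open>u \<ge> -x\<close>, and there the quadratic weight is bounded below.
\<close>
lemma levy_integrand_damped_bound:
  assumes "0 < y" "- x \<le> u" "0 < x"
  shows "\<bar>levy_integrand y u * exp (- (x * y))\<bar> \<le> (16 / x\<^sup>2 + (2 + 1 / x) * (4 / x\<^sup>2) + 2) * min 1 (u\<^sup>2)"
    (is "_ \<le> ?C * _")
proof -
  \<comment> \<open>Each summand serves one range of u: 2 for |u| > 1, 16/x^2 = 4/(x/2)^2 for small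
    |u|, and the middle one for |u| > x/2, where 4u^2/x^2 exceeds 1.\<close>
  have C: "16 / x\<^sup>2 \<le> ?C" "(2 + 1 / x) * (4 / x\<^sup>2) \<le> ?C" "2 \<le> ?C" using assms by auto
  \<comment> \<open>A downward jump has size at most x, so the growth of exp(-uy) is compensated by
    the damping factor.\<close>
  have e: "exp (- (u * y)) * exp (- (x * y)) \<le> 1"
  proof -
    have "0 \<le> (u + x) * y" using assms by (intro mult_nonneg_nonneg) auto
    then show ?thesis by (simp add: algebra_simps flip: exp_add)
  qed
  have e1: "exp (- (x * y)) \<le> 1" using assms by simp
  consider "1 < \<bar>u\<bar>" | "\<bar>u\<bar> \<le> 1" "\<bar>u\<bar> \<le> x / 2" | "\<bar>u\<bar> \<le> 1" "x / 2 < \<bar>u\<bar>" by linarith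
  then show ?thesis
  proof cases
    case 1
    have "1 < u\<^sup>2" using 1 by (metis one_less_power power2_abs zero_less_numeral)
    then have "min 1 (u\<^sup>2) = 1" by simp
    moreover have "levy_integrand y u * exp (- (x * y)) = exp (- (u * y)) * exp (- (x * y)) - exp (- (x * y))"
      using 1 by (auto simp: levy_integrand_def indicator_def algebra_simps)
    moreover have "\<bar>exp (- (u * y)) * exp (- (x * y)) - exp (- (x * y))\<bar> \<le> 2"
      using e e1 exp_gt_zero[of "- (x * y)"] mult_pos_pos[OF exp_gt_zero[of "- (u * y)"] exp_gt_zero[of "- (x * y)"]]
      by linarith
    ultimately show ?thesis using C(3) by simp
  next
    case 2
    have m: "min 1 (u\<^sup>2) = u\<^sup>2" using 2 by (simp add: abs_square_le_1)
    have "\<bar>levy_integrand y u * exp (- (x * y))\<bar> \<le> (u\<^sup>2 * (y\<^sup>2 * exp (\<bar>u\<bar> * y))) * exp (- (x * y))"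
      using levy_integrand_small[of u y] 2 assms by (simp add: abs_mult)
    also have "\<dots> = u\<^sup>2 * (y\<^sup>2 * exp (\<bar>u\<bar> * y - x * y))"
      by (simp add: exp_diff exp_minus field_simps)
    also have "\<dots> \<le> u\<^sup>2 * (y\<^sup>2 * exp (- ((x / 2) * y)))"
    proof -
      have "\<bar>u\<bar> * y \<le> (x / 2) * y" using 2 assms by (intro mult_right_mono) auto
      then show ?thesis by (intro mult_left_mono) auto
    qed
    also have "\<dots> \<le> u\<^sup>2 * (4 / (x / 2)\<^sup>2)"
      using assms by (intro mult_left_mono mult_exp_minus_le(2)) auto
    also have "\<dots> = (16 / x\<^sup>2) * u\<^sup>2" by (simp add: power_divide)
    also have "\<dots> \<le> ?C * u\<^sup>2" by (intro mult_right_mono C) auto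
    finally show ?thesis by (simp only: m)
  next
    case 3
    have m: "min 1 (u\<^sup>2) = u\<^sup>2" using 3 by (simp add: abs_square_le_1)
    have "levy_integrand y u * exp (- (x * y))
        = exp (- (u * y)) * exp (- (x * y)) - exp (- (x * y)) + u * (y * exp (- (x * y)))"
      using 3 by (auto simp: levy_integrand_def indicator_def algebra_simps)
    moreover have "\<bar>exp (- (u * y)) * exp (- (x * y)) - exp (- (x * y))\<bar> \<le> 2"
      using e e1 exp_gt_zero[of "- (x * y)"] mult_pos_pos[OF exp_gt_zero[of "- (u * y)"] exp_gt_zero[of "- (x * y)"]]
      by linarith
    moreover have "\<bar>u * (y * exp (- (x * y)))\<bar> \<le> 1 * (1 / x)"
      unfolding abs_mult[of u] using 3 assms mult_exp_minus_le(1)[of x y] by (intro mult_mono) auto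
    ultimately have "\<bar>levy_integrand y u * exp (- (x * y))\<bar> \<le> 2 + 1 / x" by linarith
    also have "\<dots> \<le> (2 + 1 / x) * (4 / x\<^sup>2 * u\<^sup>2)"
    proof -
      have "(x / 2)\<^sup>2 \<le> \<bar>u\<bar>\<^sup>2" using 3 assms by (intro power_mono) auto
      then have "1 \<le> 4 / x\<^sup>2 * u\<^sup>2" using assms by (simp add: field_simps)
      then have "(2 + 1 / x) * 1 \<le> (2 + 1 / x) * (4 / x\<^sup>2 * u\<^sup>2)" using assms by (intro mult_left_mono) auto
      then show ?thesis by simp
    qed
    also have "\<dots> = ((2 + 1 / x) * (4 / x\<^sup>2)) * u\<^sup>2" by simp
    also have "\<dots> \<le> ?C * u\<^sup>2" by (intro mult_right_mono C) auto
    finally show ?thesis by (simp only: m)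
  qed
qed

lemma laplace_symbol_interior:
  assumes "laplace_symbol \<psi>" "0 < x"
  obtains \<mu> :: "real measure" and a b c where "sets \<mu> = sets borel" "AE u in \<mu>. - x \<le> u"
    "integrable \<mu> (\<lambda>u. min 1 (u\<^sup>2))"
    "\<And>y. 0 < y \<Longrightarrow> \<psi> (ennreal x) y = (\<integral>u. levy_integrand y u \<partial>\<mu>) + a * y\<^sup>2 - b * y - c"
proof -
  obtain \<nu> a b c where *: "\<And>x. x > 0 \<Longrightarrow> sets (\<nu> x) = sets borel \<and> emeasure (\<nu> x) {..<-x} = 0 \<and> emeasure (\<nu> x) {0} = 0 \<and>
             (\<integral>\<^sup>+ u. ennreal (min 1 (u\<^sup>2)) \<partial>\<nu> x) < \<infinity> \<and> 0 \<le> a x \<and> 0 \<le> c x \<and>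
             (\<forall>y>0. \<psi> (ennreal x) y =
                (\<integral>u. (exp (- (u * y)) - 1 + u * y * indicator {-1..1} u) \<partial>\<nu> x)
                + a x * y\<^sup>2 - b x * y - c x)"
    using assms(1) unfolding laplace_symbol_def by blast
  note x = *[OF assms(2)]
  have [measurable_cong]: "sets (\<nu> x) = sets borel" using x by simp
  show ?thesis
  proof (rule that[of "\<nu> x" "a x" "b x" "c x"])
    show "AE u in \<nu> x. - x \<le> u"
      by (rule AE_I[of _ _ "{..<-x}"]) (use x in \<open>auto simp: not_le\<close>)
    show "integrable (\<nu> x) (\<lambda>u. min 1 (u\<^sup>2))"
      by (rule integrableI_nonneg) (use x in auto)
  qed (use x in \<open>auto simp: levy_integrand_def\<close>)
qed

text \<open>After damping each term of the exponent is bounded in \<open>y\<close> separately: the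
  jump integral by \<open>levy_integrand_damped_bound\<close>, the quadratic and linear terms by
  \<open>mult_exp_minus_le\<close>.\<close>

lemma laplace_symbol_interior_bounded:
  assumes "laplace_symbol \<psi>" "0 < x"
  obtains C where "\<And>y. 0 < y \<Longrightarrow> \<bar>\<psi> (ennreal x) y * exp (- (x * y))\<bar> \<le> C"
proof -
  from laplace_symbol_interior[OF assms] obtain \<mu> :: "real measure" and a b c
    where \<mu>: "sets \<mu> = sets borel" "AE u in \<mu>. - x \<le> u" "integrable \<mu> (\<lambda>u. min 1 (u\<^sup>2))"
      and \<psi>: "\<And>y. 0 < y \<Longrightarrow> \<psi> (ennreal x) y = (\<integral>u. levy_integrand y u \<partial>\<mu>) + a * y\<^sup>2 - b * y - c"
    by blast
  note [measurable_cong] = \<mu>(1)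
  define C where "C = 16 / x\<^sup>2 + (2 + 1 / x) * (4 / x\<^sup>2) + 2"
  show ?thesis
  proof (rule that)
    fix y :: real assume y: "0 < y"
    have "\<bar>(\<integral>u. levy_integrand y u \<partial>\<mu>) * exp (- (x * y))\<bar> = \<bar>\<integral>u. levy_integrand y u * exp (- (x * y)) \<partial>\<mu>\<bar>"
      by simp
    also have "\<dots> \<le> (\<integral>u. C * min 1 (u\<^sup>2) \<partial>\<mu>)"
    proof (rule order_trans[OF integral_abs_bound integral_mono_AE])
      have ae: "AE u in \<mu>. \<bar>levy_integrand y u * exp (- (x * y))\<bar> \<le> C * min 1 (u\<^sup>2)"
        using \<mu>(2) by eventually_elim (unfold C_def, rule levy_integrand_damped_bound[OF y _ assms(2)])
      show i: "integrable \<mu> (\<lambda>u. C * min 1 (u\<^sup>2))" using \<mu>(3) by simp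
      have "integrable \<mu> (\<lambda>u. levy_integrand y u * exp (- (x * y)))"
        by (rule Bochner_Integration.integrable_bound[OF i])
           (use ae in \<open>auto elim!: eventually_mono intro: order_trans[OF _ abs_ge_self]\<close>)
      then show "integrable \<mu> (\<lambda>u. \<bar>levy_integrand y u * exp (- (x * y))\<bar>)" by (rule integrable_abs)
      show "AE u in \<mu>. \<bar>levy_integrand y u * exp (- (x * y))\<bar> \<le> C * min 1 (u\<^sup>2)" by (rule ae)
    qed
    finally have 1: "\<bar>(\<integral>u. levy_integrand y u \<partial>\<mu>) * exp (- (x * y))\<bar> \<le> (\<integral>u. C * min 1 (u\<^sup>2) \<partial>\<mu>)" .
    have 2: "\<bar>a * (y\<^sup>2 * exp (- (x * y)))\<bar> \<le> \<bar>a\<bar> * (4 / x\<^sup>2)"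
      unfolding abs_mult[of a] using mult_exp_minus_le(2)[of x y] assms y by (intro mult_left_mono) auto
    have 3: "\<bar>b * (y * exp (- (x * y)))\<bar> \<le> \<bar>b\<bar> * (1 / x)"
      unfolding abs_mult[of b] using mult_exp_minus_le(1)[of x y] assms y by (intro mult_left_mono) auto
    have 4: "\<bar>c * exp (- (x * y))\<bar> \<le> \<bar>c\<bar> * 1"
      unfolding abs_mult[of c] using assms y by (intro mult_left_mono) auto
    have "\<psi> (ennreal x) y * exp (- (x * y)) = (\<integral>u. levy_integrand y u \<partial>\<mu>) * exp (- (x * y))
        + a * (y\<^sup>2 * exp (- (x * y))) - b * (y * exp (- (x * y))) - c * exp (- (x * y))"
      unfolding \<psi>[OF y] by (simp only: left_diff_distrib distrib_right mult.assoc)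
    then show "\<bar>\<psi> (ennreal x) y * exp (- (x * y))\<bar>
        \<le> (\<integral>u. C * min 1 (u\<^sup>2) \<partial>\<mu>) + \<bar>a\<bar> * (4 / x\<^sup>2) + \<bar>b\<bar> * (1 / x) + \<bar>c\<bar> * 1"
      using 1 2 3 4 by linarith
  qed
qed

lemma convergent_real_bounded_above:
  fixes f :: "nat \<Rightarrow> real"
  assumes "f \<longlonglongrightarrow> l"
  obtains B where "\<And>n. f n \<le> B"
  using convergent_imp_bounded[OF assms] unfolding bounded_iff by (auto simp: abs_le_iff)

text \<open>Together with the same statement for the dual symbol this gives separate continuity,
  from which joint measurability is derived. The domination is uniform because a convergent sequence
  of arguments is bounded by some \<open>Y\<close>.\<close>

lemma laplace_symbol_interior_continuous:
  assumes "laplace_symbol \<psi>" "0 < x"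
  shows "continuous_on {0<..} (\<psi> (ennreal x))"
proof -
  from laplace_symbol_interior[OF assms] obtain \<mu> :: "real measure" and a b c
    where \<mu>: "sets \<mu> = sets borel" "AE u in \<mu>. - x \<le> u" "integrable \<mu> (\<lambda>u. min 1 (u\<^sup>2))"
      and \<psi>: "\<And>y. 0 < y \<Longrightarrow> \<psi> (ennreal x) y = (\<integral>u. levy_integrand y u \<partial>\<mu>) + a * y\<^sup>2 - b * y - c"
    by blast
  note [measurable_cong] = \<mu>(1)
  have "continuous_on {0<..} (\<lambda>y. (\<integral>u. levy_integrand y u \<partial>\<mu>))"
    unfolding continuous_on_sequentially
  proof (intro allI ballI impI, elim conjE, unfold comp_def)
    fix f :: "nat \<Rightarrow> real" and y
    assume f: "\<forall>n. f n \<in> {0<..}" "f \<longlonglongrightarrow> y" and y: "y \<in> {0<..}"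
    obtain Y where Y: "\<And>n. f n \<le> Y" using convergent_real_bounded_above[OF f(2)] by blast
    show "(\<lambda>n. \<integral>u. levy_integrand (f n) u \<partial>\<mu>) \<longlonglongrightarrow> (\<integral>u. levy_integrand y u \<partial>\<mu>)"
    proof (rule integral_dominated_convergence)
      show "integrable \<mu> (\<lambda>u. (Y\<^sup>2 * exp Y + exp (x * Y) + 1) * min 1 (u\<^sup>2))" using \<mu>(3) by simp
      show "AE u in \<mu>. (\<lambda>n. levy_integrand (f n) u) \<longlonglongrightarrow> levy_integrand y u"
        unfolding levy_integrand_def using f(2) by (auto intro!: tendsto_intros)
      show "AE u in \<mu>. norm (levy_integrand (f n) u) \<le> (Y\<^sup>2 * exp Y + exp (x * Y) + 1) * min 1 (u\<^sup>2)" for n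
        using \<mu>(2)
      proof eventually_elim
        case (elim u)
        then show ?case using levy_integrand_bound[of "f n" Y x u] f(1) Y assms(2) by auto
      qed
    qed auto
  qed
  then have "continuous_on {0<..} (\<lambda>y. (\<integral>u. levy_integrand y u \<partial>\<mu>) + a * y\<^sup>2 - b * y - c)"
    by (intro continuous_intros)
  then show ?thesis
    by (rule continuous_on_eq) (simp add: \<psi>)
qed

text \<open>From state 0 all jumps are upward and need no compensation, so the integrand is
  negative. The sign is what case (I) relies on, where \<open>\<phi>\<close> on this axis has no
  bound.\<close>

lemma laplace_symbol_zero:
  assumes "laplace_symbol \<psi>"
  shows "continuous_on {0<..} (\<psi> 0)" "\<And>y. 0 < y \<Longrightarrow> \<psi> 0 y \<le> 0"
proof -
  obtain \<mu> :: "real measure" and d c :: real where *: "sets \<mu> = sets borel" "emeasure \<mu> {..0} = 0"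
     "(\<integral>\<^sup>+ u. ennreal (min 1 u) \<partial>\<mu>) < \<infinity>" "0 \<le> d" "0 \<le> c"
     and \<psi>: "\<And>y. 0 < y \<Longrightarrow> \<psi> 0 y = (\<integral>u. (exp (- (u * y)) - 1) \<partial>\<mu>) - d * y - c"
    using assms unfolding laplace_symbol_def by blast
  note [measurable_cong] = *(1)
  have pos: "AE u in \<mu>. 0 < u"
    by (rule AE_I[of _ _ "{..0}"]) (use * in \<open>auto simp: not_le\<close>)
  have int: "integrable \<mu> (\<lambda>u. min 1 u)"
    by (rule integrableI_nonneg) (use * pos in \<open>auto elim!: eventually_mono\<close>)
  have "continuous_on {0<..} (\<lambda>y. (\<integral>u. (exp (- (u * y)) - 1) \<partial>\<mu>))"
    unfolding continuous_on_sequentially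
  proof (intro allI ballI impI, elim conjE, unfold comp_def)
    fix f :: "nat \<Rightarrow> real" and y
    assume f: "\<forall>n. f n \<in> {0<..}" "f \<longlonglongrightarrow> y" and y: "y \<in> {0<..}"
    obtain Y where Y: "\<And>n. f n \<le> Y" using convergent_real_bounded_above[OF f(2)] by blast
    show "(\<lambda>n. \<integral>u. (exp (- (u * f n)) - 1) \<partial>\<mu>) \<longlonglongrightarrow> (\<integral>u. (exp (- (u * y)) - 1) \<partial>\<mu>)"
    proof (rule integral_dominated_convergence)
      \<comment> \<open>For u > 0 the integrand has modulus at most min(1, uY), which is at most (1
        + Y) min(1, u).\<close>
      show "integrable \<mu> (\<lambda>u. (1 + Y) * min 1 u)" using int by simp
      show "AE u in \<mu>. (\<lambda>n. exp (- (u * f n)) - 1) \<longlonglongrightarrow> exp (- (u * y)) - 1"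
        using f(2) by (auto intro!: tendsto_intros)
      show "AE u in \<mu>. norm (exp (- (u * f n)) - 1) \<le> (1 + Y) * min 1 u" for n
        using pos
      proof eventually_elim
        case (elim u)
        have fn: "0 < f n" "f n \<le> Y" using f(1) Y by auto
        have 1: "exp (- (u * f n)) \<le> 1" using elim fn by simp
        have "1 - u * f n \<le> exp (- (u * f n))" using exp_ge_add_one_self[of "- (u * f n)"] by simp
        moreover have "u * f n \<le> u * Y" using elim fn by (intro mult_left_mono) auto
        ultimately have "1 - exp (- (u * f n)) \<le> u * Y" by linarith
        moreover have "0 \<le> u * Y" "0 \<le> Y" using elim fn by auto
        moreover have "0 < exp (- (u * f n))" by simp
        ultimately show ?case using 1 elim by (auto simp: min_def algebra_simps)
      qed
    qed auto
  qed
  then have "continuous_on {0<..} (\<lambda>y. (\<integral>u. (exp (- (u * y)) - 1) \<partial>\<mu>) - d * y - c)"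
    by (intro continuous_intros)
  then show "continuous_on {0<..} (\<psi> 0)"
    by (rule continuous_on_eq) (simp add: \<psi>)
  fix y :: real assume y: "0 < y"
  have "AE u in \<mu>. 0 \<le> - (exp (- (u * y)) - 1)"
    using pos by eventually_elim (use y in simp)
  then have "0 \<le> (\<integral>u. - (exp (- (u * y)) - 1) \<partial>\<mu>)" by (rule integral_nonneg_AE)
  then have "(\<integral>u. exp (- (u * y)) - 1 \<partial>\<mu>) \<le> 0"
    unfolding integral_minus by linarith
  then show "\<psi> 0 y \<le> 0" using \<psi>[OF y] * y by (smt (verit) mult_nonneg_nonneg)
qed

text \<open>The argument for Caratheodory functions: discretize \<open>x\<close>, so that only
  countably many sections occur, each measurable by continuity in \<open>y\<close>; then refine the
  grid and use continuity in \<open>x\<close>.\<close>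

lemma separately_continuous_measurable:
  fixes h :: "real \<Rightarrow> real \<Rightarrow> real"
  assumes h1: "\<And>x. 0 < x \<Longrightarrow> continuous_on {0<..} (h x)"
    and h2: "\<And>y. 0 < y \<Longrightarrow> continuous_on {0<..} (\<lambda>x. h x y)"
  shows "(\<lambda>(x, y). if 0 < x \<and> 0 < y then h x y else 0) \<in> borel_measurable (borel \<Otimes>\<^sub>M borel)"
proof -
  define H where "H x y = (if 0 < x \<and> 0 < y then h x y else 0)" for x y
  \<comment> \<open>Rounding upwards keeps positive numbers positive and nonpositive ones
    nonpositive, so the extension by 0 outside the quadrant commutes with the
    discretization.\<close>
  define q where "q n x = real_of_int \<lceil>x * real (Suc n)\<rceil> / real (Suc n)" for n x
  have H: "H x \<in> borel_measurable borel" for x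
  proof (cases "0 < x")
    case True
    have "(\<lambda>y. if y \<in> {0<..} then h x y else 0) \<in> borel_measurable borel"
      by (rule borel_measurable_continuous_on_if) (auto intro: h1 True)
    then show ?thesis using True by (simp add: H_def [abs_def])
  qed (simp add: H_def [abs_def])
  have m: "(\<lambda>z. H (q n (fst z)) (snd z)) \<in> borel_measurable (borel \<Otimes>\<^sub>M borel)" for n
  proof -
    have "(\<lambda>z :: real \<times> real. (\<lambda>i z. H (real_of_int i / real (Suc n)) (snd z)) \<lceil>fst z * real (Suc n)\<rceil> z)
        \<in> borel_measurable (borel \<Otimes>\<^sub>M borel)"
    proof (rule measurable_compose_countable[where f = "\<lambda>i z. H (real_of_int i / real (Suc n)) (snd z)"])
      show "(\<lambda>z. H (real_of_int i / real (Suc n)) (snd z)) \<in> borel_measurable (borel \<Otimes>\<^sub>M borel)" for i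
        by (rule measurable_compose[OF measurable_snd H])
      show "(\<lambda>z :: real \<times> real. \<lceil>fst z * real (Suc n)\<rceil>) \<in> borel \<Otimes>\<^sub>M borel \<rightarrow>\<^sub>M count_space UNIV"
        by measurable
    qed
    then show ?thesis by (simp add: q_def)
  qed
  have qx: "(\<lambda>n. q n x) \<longlonglongrightarrow> x" "\<And>n. 0 < x \<Longrightarrow> 0 < q n x" "\<And>n. x \<le> 0 \<Longrightarrow> q n x \<le> 0" for x
  proof -
    have lo: "x \<le> q n x" and hi: "q n x \<le> x + 1 / real (Suc n)" for n
    proof -
      have "x * real (Suc n) \<le> real_of_int \<lceil>x * real (Suc n)\<rceil>" by simp
      then show "x \<le> q n x" unfolding q_def by (subst pos_le_divide_eq) auto
      have "real_of_int \<lceil>x * real (Suc n)\<rceil> \<le> x * real (Suc n) + 1" by (simp add: of_int_ceiling_le_add_one)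
      then show "q n x \<le> x + 1 / real (Suc n)"
        unfolding q_def by (subst pos_divide_le_eq) (auto simp: distrib_right simp del: of_nat_Suc)
    qed
    have "(\<lambda>n. x + 1 / real (Suc n)) \<longlonglongrightarrow> x + 0"
      by (intro tendsto_add tendsto_const LIMSEQ_Suc[OF lim_1_over_n])
    then show "(\<lambda>n. q n x) \<longlonglongrightarrow> x"
      using tendsto_sandwich[of "\<lambda>_. x" "\<lambda>n. q n x" sequentially "\<lambda>n. x + 1 / real (Suc n)" x] lo hi by simp
    show "0 < x \<Longrightarrow> 0 < q n x" for n using lo[of n] by simp
    show "q n x \<le> 0" if "x \<le> 0" for n
    proof -
      have "\<lceil>x * real (Suc n)\<rceil> \<le> 0" using that by (simp add: ceiling_le_zero mult_nonpos_nonneg del: of_nat_Suc)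
      then show ?thesis unfolding q_def by (intro divide_nonpos_nonneg) auto
    qed
  qed
  have "(\<lambda>z. H (fst z) (snd z)) \<in> borel_measurable (borel \<Otimes>\<^sub>M borel)"
  proof (rule borel_measurable_LIMSEQ_real[OF _ m])
    fix z :: "real \<times> real"
    show "(\<lambda>n. H (q n (fst z)) (snd z)) \<longlonglongrightarrow> H (fst z) (snd z)"
    proof (cases "0 < fst z \<and> 0 < snd z")
      case True
      then have "isCont (\<lambda>x. h x (snd z)) (fst z)"
        using h2[of "snd z"] by (simp add: continuous_on_eq_continuous_at open_greaterThan)
      then have "(\<lambda>n. h (q n (fst z)) (snd z)) \<longlonglongrightarrow> h (fst z) (snd z)"
        by (rule isCont_tendsto_compose) (rule qx)
      then show ?thesis using True qx(2) by (simp add: H_def)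
    next
      case False
      then have "H (q n (fst z)) (snd z) = 0" for n
        using qx(3)[of "fst z" n] by (auto simp: H_def not_less)
      then show ?thesis using False by (auto simp: H_def)
    qed
  qed
  then show ?thesis by (simp add: H_def case_prod_beta)
qed

lemma measurable_dual_symbol:
  assumes "laplace_dual_symbol \<psi>" "vanishes_at_infinity \<psi>"
  shows "(\<lambda>(x, y). \<psi> x y) \<in> borel_measurable (borel \<Otimes>\<^sub>M borel)"
proof -
  have \<psi>1: "laplace_symbol (\<lambda>x y. \<psi> x (ennreal y))" and \<psi>2: "laplace_symbol (\<lambda>x y. \<psi> (ennreal y) x)"
    using assms(1) by (auto simp: laplace_dual_symbol_def)
  define H where "H = (\<lambda>(x, y). if 0 < x \<and> 0 < y then \<psi> (ennreal x) (ennreal y) else 0)"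
  \<comment> \<open>The symbol conditions govern only positive arguments on each axis. The value at
    the origin is arbitrary, and the two axis functions carry it as an isolated value.\<close>
  define K1 where "K1 y = (if y \<in> {0<..} then \<psi> 0 (ennreal y) else \<psi> 0 0)" for y
  define K2 where "K2 x = (if x \<in> {0<..} then \<psi> (ennreal x) 0 else \<psi> 0 0)" for x
  have [measurable]: "H \<in> borel_measurable (borel \<Otimes>\<^sub>M borel)"
    unfolding H_def by (rule separately_continuous_measurable)
      (auto intro: laplace_symbol_interior_continuous[OF \<psi>1] laplace_symbol_interior_continuous[OF \<psi>2])
  have [measurable]: "K1 \<in> borel_measurable borel"
    unfolding K1_def by (rule borel_measurable_continuous_on_if) (auto intro: laplace_symbol_zero[OF \<psi>1])
  have [measurable]: "K2 \<in> borel_measurable borel"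
    unfolding K2_def by (rule borel_measurable_continuous_on_if) (auto intro: laplace_symbol_zero[OF \<psi>2])
  have "(\<lambda>(x, y). \<psi> x y) = (\<lambda>(x, y). if x = top \<or> y = top then 0 else if x = 0 then K1 (enn2real y)
      else if y = 0 then K2 (enn2real x) else H (enn2real x, enn2real y))"
  proof (intro ext, clarify)
    fix x y :: ennreal
    show "\<psi> x y = (if x = top \<or> y = top then 0 else if x = 0 then K1 (enn2real y)
      else if y = 0 then K2 (enn2real x) else H (enn2real x, enn2real y))"
      using assms(2)
      by (cases x; cases y) (auto simp: vanishes_at_infinity_def K1_def K2_def H_def not_less)
  qed
  also have "\<dots> \<in> borel_measurable (borel \<Otimes>\<^sub>M borel)" by measurable
  finally show ?thesis .
qed

section \<open>Optional stopping\<close>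

lemma natural_filtration_sets:
  assumes "0 \<le> s" "s \<le> t" "B \<in> sets borel"
  shows "X s -` B \<inter> space M \<in> sets (natural_filtration M X t)"
  unfolding natural_filtration_def
proof (subst sets_measure_of)
  show "X s -` B \<inter> space M
      \<in> sigma_sets (space M) (\<Union>s\<in>{0..t}. {X s -` B \<inter> space M |B. B \<in> sets borel})"
    using assms by (intro sigma_sets.Basic UN_I[of s]) auto
qed auto

lemma space_natural_filtration [simp]: "space (natural_filtration M X t) = space M"
  unfolding natural_filtration_def by (subst space_measure_of) auto

text \<open>The only place where conditional expectations are evaluated: later arguments use just
  that increments are orthogonal to events of the past.\<close>

lemma martingale_increment:
  assumes "prob_space M" and Z: "martingale M F Z" and st: "0 \<le> s" "s \<le> t" and A: "A \<in> sets (F s)"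
  shows "(\<integral>x. indicator A x * (Z t x - Z s x) \<partial>M) = 0"
proof -
  interpret prob_space M by fact
  have sub: "subalgebra M (F s)" and int: "integrable M (Z t)" "integrable M (Z s)"
    and ae: "AE \<omega> in M. real_cond_exp M (F s) (Z t) \<omega> = Z s \<omega>"
    using Z st by (auto simp: martingale_def)
  interpret finite_measure_subalgebra M "F s" by unfold_locales (rule sub)
  have [measurable]: "A \<in> sets M" using A sub by (auto simp: subalgebra_def)
  note [measurable] = borel_measurable_integrable[OF int(1)] borel_measurable_integrable[OF int(2)]
  have "(\<integral>x\<in>A. Z t x \<partial>M) = (\<integral>x\<in>A. real_cond_exp M (F s) (Z t) x \<partial>M)"
    by (rule real_cond_exp_intA[OF int(1) A])
  also have "\<dots> = (\<integral>x\<in>A. Z s x \<partial>M)"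
    unfolding set_lebesgue_integral_def
    by (rule integral_cong_AE) (use ae in \<open>auto elim: eventually_mono\<close>)
  finally have "(\<integral>x. indicator A x * Z t x \<partial>M) = (\<integral>x. indicator A x * Z s x \<partial>M)"
    by (simp add: set_lebesgue_integral_def)
  moreover have "integrable M (\<lambda>x. indicator A x * Z t x)" "integrable M (\<lambda>x. indicator A x * Z s x)"
    using integrable_mult_indicator[OF \<open>A \<in> sets M\<close> int(1)] integrable_mult_indicator[OF \<open>A \<in> sets M\<close> int(2)] by auto
  ultimately show ?thesis by (simp add: right_diff_distrib)
qed

text \<open>A right-continuous path that visits an open set stays in it for a short while, hence
  also visits it at a rational time. The strict inequality leaves room for that later time.\<close>

lemma hit_time_less_rat:
  assumes p: "cadlag p" and A: "open A"
  shows "hit_time A p < y \<longleftrightarrow> (\<exists>r\<in>\<rat>. 0 \<le> r \<and> ennreal r < y \<and> p r \<in> A)"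
proof
  assume "hit_time A p < y"
  then obtain t where t: "0 \<le> t" "p t \<in> A" "ennreal t < y" by (auto simp: hit_time_def Inf_less_iff)
  have "\<forall>\<^sub>F r in at_right t. p r \<in> A"
    by (rule topological_tendstoD[OF cadlag_right[OF p t(1)] A t(2)])
  then obtain b where b: "t < b" "\<And>r. t < r \<Longrightarrow> r < b \<Longrightarrow> p r \<in> A"
    unfolding eventually_at_right_field by auto
  obtain c where c: "t < c" "ennreal c \<le> y"
  proof (cases y)
    case (real c)
    then show ?thesis using that[of c] t by (simp add: ennreal_less_iff)
  next
    case top
    then show ?thesis using that[of "t + 1"] by simp
  qed
  obtain r where r: "t < r" "r < min b c" "r \<in> \<rat>" using Rats_dense_in_real[of t "min b c"] b c by auto
  have "ennreal r < ennreal c" using r t by (simp add: ennreal_less_iff)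
  also note c(2)
  finally show "\<exists>r\<in>\<rat>. 0 \<le> r \<and> ennreal r < y \<and> p r \<in> A"
    using r t b by (intro bexI[of _ r]) auto
next
  assume "\<exists>r\<in>\<rat>. 0 \<le> r \<and> ennreal r < y \<and> p r \<in> A"
  then show "hit_time A p < y" using hit_time_le[of _ p A] by (meson le_less_trans)
qed

text \<open>Writes the value at a random index \<open>J\<close> as the terminal value minus the
  increments after \<open>J\<close>. The weight of each increment is decided at its left end, so the
  martingale property removes it in expectation.\<close>

lemma grid_telescope:
  fixes z :: "nat \<Rightarrow> real"
  assumes "J \<le> n" "\<And>j. j < n \<Longrightarrow> P j \<longleftrightarrow> J \<le> j"
  shows "z n - (\<Sum>j<n. of_bool (P j) * (z (Suc j) - z j)) = z J"
proof -
  have "(\<Sum>j<n. of_bool (P j) * (z (Suc j) - z j)) = (\<Sum>j\<in>{J..<n}. z (Suc j) - z j)"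
    by (rule sum.mono_neutral_cong_right) (use assms in auto)
  also have "\<dots> = z n - z J" using assms(1) by (rule sum_Suc_diff')
  finally show ?thesis by simp
qed

text \<open>Values at negative times are arbitrary; clipping the time at 0 allows joint
  measurability to be stated on the whole line.\<close>

locale cadlag_process = prob_space M for M :: "'a measure" +
  fixes X :: "real \<Rightarrow> 'a \<Rightarrow> ennreal"
  assumes measurable_process: "(\<lambda>(s, \<omega>). X (max 0 s) \<omega>) \<in> borel_measurable (borel \<Otimes>\<^sub>M M)"
    and cadlag_paths: "\<And>\<omega>. \<omega> \<in> space M \<Longrightarrow> cadlag (\<lambda>t. X t \<omega>)"
begin

abbreviation hit :: "ennreal set \<Rightarrow> 'a \<Rightarrow> ennreal" where
  "hit A \<omega> \<equiv> hit_time A (\<lambda>t. X t \<omega>)"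

lemma measurable_at: "0 \<le> t \<Longrightarrow> X t \<in> borel_measurable M"
  using measurable_compose_Pair1[OF _ measurable_process, of t] by simp

lemma measurable_hit:
  assumes "open A"
  shows "hit A \<in> borel_measurable M"
proof (rule borel_measurableI_less)
  fix y :: ennreal
  have "{\<omega> \<in> space M. hit A \<omega> < y} = (\<Union>r\<in>{r\<in>\<rat>. 0 \<le> r \<and> ennreal r < y}. {\<omega> \<in> space M. X r \<omega> \<in> A})"
    using hit_time_less_rat[OF cadlag_paths assms] by auto
  also have "\<dots> \<in> sets M"
  proof (rule sets.countable_UN'')
    show "countable {r \<in> \<rat>. 0 \<le> r \<and> ennreal r < y}"
      by (rule countable_subset[OF _ countable_rat]) auto
    fix r assume "r \<in> {r \<in> \<rat>. 0 \<le> r \<and> ennreal r < y}"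
    then have [measurable]: "X r \<in> borel_measurable M" by (intro measurable_at) auto
    have [measurable]: "A \<in> sets borel" using assms by simp
    show "{\<omega> \<in> space M. X r \<omega> \<in> A} \<in> sets M" by measurable
  qed
  finally show "{\<omega> \<in> space M. hit A \<omega> < y} \<in> sets M" .
qed

text \<open>The inequality has to be strict: whether the path enters \<open>A\<close> immediately
  after \<open>t\<close> is in general not known at time \<open>t\<close>, because the natural
  filtration need not be right-continuous.\<close>

lemma hit_less_natural_filtration:
  assumes "open A"
  shows "{\<omega> \<in> space M. hit A \<omega> < ennreal t} \<in> sets (natural_filtration M X t)"
proof -
  have "{\<omega> \<in> space M. hit A \<omega> < ennreal t} = (\<Union>r\<in>{r\<in>\<rat>. 0 \<le> r \<and> ennreal r < ennreal t}. X r -` A \<inter> space M)"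
    using hit_time_less_rat[OF cadlag_paths assms] by auto
  also have "\<dots> \<in> sets (natural_filtration M X t)"
  proof (rule sets.countable_UN'')
    show "countable {r \<in> \<rat>. 0 \<le> r \<and> ennreal r < ennreal t}"
      by (rule countable_subset[OF _ countable_rat]) auto
    fix r assume "r \<in> {r \<in> \<rat>. 0 \<le> r \<and> ennreal r < ennreal t}"
    then have "0 \<le> r" "r \<le> t" by (auto simp: ennreal_less_iff)
    then show "X r -` A \<inter> space M \<in> sets (natural_filtration M X t)"
      using assms by (intro natural_filtration_sets) auto
  qed
  finally show ?thesis .
qed

lemma measurable_stopped:
  assumes [measurable]: "\<sigma> \<in> borel_measurable M"
  shows "(\<lambda>(s, \<omega>). stopped X \<sigma> s \<omega>) \<in> borel_measurable (borel \<Otimes>\<^sub>M M)"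
proof -
  have "(\<lambda>z. (enn2real (min (ennreal (fst z)) (\<sigma> (snd z))), snd z)) \<in> borel \<Otimes>\<^sub>M M \<rightarrow>\<^sub>M borel \<Otimes>\<^sub>M M"
    by measurable
  from measurable_compose[OF this measurable_process] show ?thesis
    by (simp add: stopped_def at_time_def case_prod_beta)
qed

lemma stopped_eq_stop_path: "stopped X (hit A) s \<omega> = stop_path (\<lambda>t. X t \<omega>) (hit A \<omega>) s"
  by (simp add: stopped_def at_time_def stop_path_def)

text \<open>
  The telescoping sum \<open>W n\<close> below is \<open>Z\<close> at the first grid point after the hitting time; its expectation needs
  only that the event of a hit strictly before a grid point lies in the natural filtration at that point.
\<close>
lemma optional_stopping:
  assumes Z: "martingale M (natural_filtration M X) Z"
    and rc: "\<And>\<omega> s. \<omega> \<in> space M \<Longrightarrow> 0 \<le> s \<Longrightarrow> ((\<lambda>r. Z r \<omega>) \<longlongrightarrow> Z s \<omega>) (at_right s)"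
    and bound: "\<And>\<omega> s. \<omega> \<in> space M \<Longrightarrow> 0 \<le> s \<Longrightarrow> s \<le> t \<Longrightarrow> \<bar>Z s \<omega>\<bar> \<le> C"
    and A: "open A" and t: "0 \<le> t"
  shows "(\<integral>\<omega>. Z (enn2real (min (ennreal t) (hit A \<omega>))) \<omega> \<partial>M) = (\<integral>\<omega>. Z 0 \<omega> \<partial>M)"
    and "integrable M (\<lambda>\<omega>. Z (enn2real (min (ennreal t) (hit A \<omega>))) \<omega>)"
proof -
  note [measurable] = measurable_hit[OF A]
  define g where "g n j = t * real j / real (Suc n)" for n j :: nat
  have g: "0 \<le> g n j" "j \<le> k \<Longrightarrow> g n j \<le> g n k" "g n (Suc n) = t" "g n 0 = 0" for n j k
    using t by (auto simp: g_def divide_right_mono mult_left_mono simp del: of_nat_Suc)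
  define W where "W n \<omega> = Z t \<omega> - (\<Sum>j<Suc n. of_bool (hit A \<omega> < ennreal (g n j)) * (Z (g n (Suc j)) \<omega> - Z (g n j) \<omega>))"
    for n \<omega>
  define T where "T \<omega> = enn2real (min (ennreal t) (hit A \<omega>))" for \<omega>
  have int: "integrable M (Z s)" if "0 \<le> s" for s using Z that by (auto simp: martingale_def)
  have int2: "integrable M (\<lambda>\<omega>. of_bool (hit A \<omega> < ennreal (g n j)) * (Z (g n (Suc j)) \<omega> - Z (g n j) \<omega>))" for n j
  proof (rule Bochner_Integration.integrable_bound)
    show "integrable M (\<lambda>\<omega>. Z (g n (Suc j)) \<omega> - Z (g n j) \<omega>)" by (intro Bochner_Integration.integrable_diff int g)
    note [measurable] = borel_measurable_integrable[OF int[OF g(1)]]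
    show "(\<lambda>\<omega>. of_bool (hit A \<omega> < ennreal (g n j)) * (Z (g n (Suc j)) \<omega> - Z (g n j) \<omega>)) \<in> borel_measurable M"
      by measurable
  qed (auto simp: of_bool_def)
  have zero: "(\<integral>\<omega>. of_bool (hit A \<omega> < ennreal (g n j)) * (Z (g n (Suc j)) \<omega> - Z (g n j) \<omega>) \<partial>M) = 0" for n j
  proof -
    let ?A = "{\<omega> \<in> space M. hit A \<omega> < ennreal (g n j)}"
    have "(\<integral>\<omega>. indicator ?A \<omega> * (Z (g n (Suc j)) \<omega> - Z (g n j) \<omega>) \<partial>M) = 0"
      by (rule martingale_increment[OF prob_space_axioms Z]) (auto intro: g hit_less_natural_filtration[OF A])
    also have "(\<integral>\<omega>. indicator ?A \<omega> * (Z (g n (Suc j)) \<omega> - Z (g n j) \<omega>) \<partial>M)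
       = (\<integral>\<omega>. of_bool (hit A \<omega> < ennreal (g n j)) * (Z (g n (Suc j)) \<omega> - Z (g n j) \<omega>) \<partial>M)"
      by (rule Bochner_Integration.integral_cong) (auto simp: indicator_def)
    finally show ?thesis .
  qed
  have intW: "integrable M (W n)" for n
    unfolding W_def by (intro Bochner_Integration.integrable_diff Bochner_Integration.integrable_sum int int2 t)
  have EW: "(\<integral>\<omega>. W n \<omega> \<partial>M) = (\<integral>\<omega>. Z 0 \<omega> \<partial>M)" for n
  proof -
    have "(\<integral>\<omega>. W n \<omega> \<partial>M) = (\<integral>\<omega>. Z t \<omega> \<partial>M)
        - (\<integral>\<omega>. (\<Sum>j<Suc n. of_bool (hit A \<omega> < ennreal (g n j)) * (Z (g n (Suc j)) \<omega> - Z (g n j) \<omega>)) \<partial>M)"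
      unfolding W_def by (intro Bochner_Integration.integral_diff int t Bochner_Integration.integrable_sum int2)
    also have "(\<integral>\<omega>. (\<Sum>j<Suc n. of_bool (hit A \<omega> < ennreal (g n j)) * (Z (g n (Suc j)) \<omega> - Z (g n j) \<omega>)) \<partial>M) = 0"
      by (simp only: Bochner_Integration.integral_sum[OF int2] zero sum.neutral_const)
    finally have "(\<integral>\<omega>. W n \<omega> \<partial>M) = (\<integral>\<omega>. Z t \<omega> \<partial>M)" by simp
    moreover have "(\<integral>\<omega>. indicator (space M) \<omega> * (Z t \<omega> - Z 0 \<omega>) \<partial>M) = 0"
      by (rule martingale_increment[OF prob_space_axioms Z]) (use t sets.top[of "natural_filtration M X 0"] in auto)
    moreover have "(\<integral>\<omega>. indicator (space M) \<omega> * (Z t \<omega> - Z 0 \<omega>) \<partial>M) = (\<integral>\<omega>. Z t \<omega> \<partial>M) - (\<integral>\<omega>. Z 0 \<omega> \<partial>M)"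
      by (subst Bochner_Integration.integral_diff[symmetric]) (auto intro: int t intro!: Bochner_Integration.integral_cong)
    ultimately show ?thesis by simp
  qed
  \<comment> \<open>Every \<open>W n\<close> is a value of \<open>Z\<close> at some time in [0,t],
    hence bounded by \<open>C\<close>, and these times converge to the stopping time from the right
    or equal it. This permits dominated convergence.\<close>
  have W: "\<exists>r. (\<forall>n. 0 \<le> r n \<and> r n \<le> t \<and> W n \<omega> = Z (r n) \<omega>) \<and> (\<lambda>n. Z (r n) \<omega>) \<longlonglongrightarrow> Z (T \<omega>) \<omega>" if \<omega>: "\<omega> \<in> space M" for \<omega>
  proof (cases "hit A \<omega> < ennreal t")
    case False
    then have T: "T \<omega> = t" using t by (simp add: T_def min_absorb1 not_less)
    have "W n \<omega> = Z t \<omega>" for n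
    proof -
      have "\<not> hit A \<omega> < ennreal (g n j)" if "j < Suc n" for j
        using False g(2)[of j "Suc n" n] g(3)[of n] that by (meson less_imp_le ennreal_leI le_less_trans less_le_trans not_less)
      then show ?thesis by (simp add: W_def del: sum.lessThan_Suc)
    qed
    then show ?thesis using t T by (intro exI[of _ "\<lambda>_. t"]) auto
  next
    case True
    define s where "s = enn2real (hit A \<omega>)"
    have h: "hit A \<omega> = ennreal s" unfolding s_def using True by (metis ennreal_enn2real less_trans ennreal_less_top)
    have s0: "0 \<le> s" by (simp add: s_def)
    have s: "0 \<le> s" "s < t" using True ennreal_less_iff[OF s0, of t] s0 unfolding h by auto
    have T: "T \<omega> = s" using s by (simp add: T_def h min_absorb2 ennreal_leI)
    \<comment> \<open>The index of the first grid point strictly after \<open>s\<close>. The added 1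
      also moves on when \<open>s\<close> is itself a grid point, in accordance with the strict
      events in \<open>W\<close>.\<close>
    define J where "J n = nat \<lfloor>s * real (Suc n) / t\<rfloor> + 1" for n
    have lessJ: "s < g n j \<longleftrightarrow> J n \<le> j" for n j
    proof -
      have fl: "0 \<le> \<lfloor>s * real (Suc n) / t\<rfloor>" using s t by (simp add: zero_le_floor)
      have "s < g n j \<longleftrightarrow> s * real (Suc n) / t < real j"
        using s by (simp add: g_def field_simps)
      also have "\<dots> \<longleftrightarrow> \<lfloor>s * real (Suc n) / t\<rfloor> < int j"
        by (simp add: floor_less_iff)
      also have "\<dots> \<longleftrightarrow> J n \<le> j"
      proof -
        have "k < int j \<longleftrightarrow> nat k + 1 \<le> j" if "0 \<le> k" for k using that by linarith
        from this[OF fl] show ?thesis unfolding J_def .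
      qed
      finally show ?thesis .
    qed
    have Jn: "J n \<le> Suc n" for n using lessJ[of n "Suc n"] g(3)[of n] s by simp
    have lo: "s < g n (J n)" for n using lessJ by simp
    have hi: "g n (J n) \<le> s + t / real (Suc n)" for n
    proof -
      have "\<not> s < g n (J n - 1)" unfolding lessJ by (simp add: J_def)
      moreover have "g n (J n) = g n (J n - 1) + t / real (Suc n)"
      proof -
        have "real (J n) = real (J n - 1) + 1" by (simp add: J_def)
        then have "t * real (J n) / real (Suc n) = (t * real (J n - 1) + t) / real (Suc n)"
          by (simp only: distrib_left mult_1_right)
        then show ?thesis unfolding g_def by (simp only: add_divide_distrib)
      qed
      ultimately show ?thesis by simp
    qed
    have "(\<lambda>n. s + t / real (Suc n)) \<longlonglongrightarrow> s + 0"
      by (intro tendsto_add tendsto_const LIMSEQ_Suc[OF lim_const_over_n])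
    then have "(\<lambda>n. g n (J n)) \<longlonglongrightarrow> s"
      using tendsto_sandwich[of "\<lambda>_. s" "\<lambda>n. g n (J n)" sequentially "\<lambda>n. s + t / real (Suc n)" s] lo hi
      by (simp add: less_imp_le)
    then have "filterlim (\<lambda>n. g n (J n)) (at_right s) sequentially"
      using lo by (auto simp: filterlim_at intro!: always_eventually less_imp_neq[symmetric])
    from filterlim_compose[OF rc[OF \<omega> s(1)] this] have "(\<lambda>n. Z (g n (J n)) \<omega>) \<longlonglongrightarrow> Z (T \<omega>) \<omega>"
      by (simp add: T)
    moreover have "W n \<omega> = Z (g n (J n)) \<omega>" for n
    proof -
      have "W n \<omega> = Z (g n (Suc n)) \<omega> - (\<Sum>j<Suc n. of_bool (hit A \<omega> < ennreal (g n j)) * (Z (g n (Suc j)) \<omega> - Z (g n j) \<omega>))"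
        unfolding W_def g(3) ..
      also have "\<dots> = Z (g n (J n)) \<omega>"
        by (rule grid_telescope[OF Jn]) (simp add: h ennreal_less_iff s lessJ)
      finally show ?thesis .
    qed
    moreover have "g n (J n) \<le> t" for n using g(2)[OF Jn, of n n] g(3)[of n] by simp
    ultimately show ?thesis using g by (intro exI[of _ "\<lambda>n. g n (J n)"]) auto
  qed
  have lim: "(\<lambda>n. W n \<omega>) \<longlonglongrightarrow> Z (T \<omega>) \<omega>" "\<bar>W n \<omega>\<bar> \<le> C" if "\<omega> \<in> space M" for \<omega> n
    using W[OF that] bound[OF that] by auto
  note [measurable] = borel_measurable_integrable[OF intW]
  have [measurable]: "(\<lambda>\<omega>. Z (T \<omega>) \<omega>) \<in> borel_measurable M"
    by (rule borel_measurable_LIMSEQ_real[OF lim(1)]) auto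
  have dom: "integrable M (\<lambda>\<omega>. C)" by simp
  have "(\<lambda>n. \<integral>\<omega>. W n \<omega> \<partial>M) \<longlonglongrightarrow> (\<integral>\<omega>. Z (T \<omega>) \<omega> \<partial>M)"
    by (rule integral_dominated_convergence[OF _ _ dom]) (auto intro!: AE_I2 lim)
  then show "(\<integral>\<omega>. Z (enn2real (min (ennreal t) (hit A \<omega>))) \<omega> \<partial>M) = (\<integral>\<omega>. Z 0 \<omega> \<partial>M)"
    unfolding EW T_def by (simp add: LIMSEQ_const_iff)
  show "integrable M (\<lambda>\<omega>. Z (enn2real (min (ennreal t) (hit A \<omega>))) \<omega>)"
    unfolding T_def[symmetric]
    by (rule integrable_dominated_convergence[OF _ _ dom]) (auto intro!: AE_I2 lim)
qed

end

text \<open>Dynkin's formula for a process \<open>F\<close> stopped at \<open>\<sigma>\<close>, with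
  \<open>c\<close> the initial value of the expectation. The time integral is cut at
  \<open>\<sigma>\<close> by an indicator instead of a random upper limit, so that it lives on a
  product space and Fubini applies.\<close>

definition dynkin :: "'a measure \<Rightarrow> (real \<Rightarrow> 'a \<Rightarrow> ennreal) \<Rightarrow> ('a \<Rightarrow> ennreal) \<Rightarrow>
    (ennreal \<Rightarrow> real) \<Rightarrow> (ennreal \<Rightarrow> real) \<Rightarrow> real \<Rightarrow> bool" where
  "dynkin M F \<sigma> f g c \<longleftrightarrow> (\<forall>s\<ge>0.
     integrable (lborel \<Otimes>\<^sub>M M) (\<lambda>(r, \<omega>). indicator {0..s} r * of_bool (ennreal r < \<sigma> \<omega>) * g (F r \<omega>)) \<and>
     (\<integral>\<omega>. f (F s \<omega>) \<partial>M) - c =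
       (\<integral>(r, \<omega>). indicator {0..s} r * of_bool (ennreal r < \<sigma> \<omega>) * g (F r \<omega>) \<partial>(lborel \<Otimes>\<^sub>M M)))"

section \<open>Dynkin's formula for bounded generators\<close>

context cadlag_process begin

lemma integrable_alive_bounded:
  fixes g :: "ennreal \<Rightarrow> real"
  assumes [measurable]: "\<sigma> \<in> borel_measurable M" "g \<in> borel_measurable borel"
    and g: "\<And>x. \<bar>g x\<bar> \<le> C"
  shows "integrable (lborel \<Otimes>\<^sub>M M)
    (\<lambda>(r, \<omega>). indicator {0..s} r * of_bool (ennreal r < \<sigma> \<omega>) * g (stopped X \<sigma> r \<omega>))"
proof (rule Bochner_Integration.integrable_bound[where f = "\<lambda>z. C * indicator ({0..s} \<times> space M) z"])
  have "emeasure (lborel \<Otimes>\<^sub>M M) ({0..s} \<times> space M) = emeasure lborel {0..s} * emeasure M (space M)"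
    by (rule emeasure_pair_measure_Times) auto
  then have "emeasure (lborel \<Otimes>\<^sub>M M) ({0..s} \<times> space M) < \<infinity>"
    by (simp add: emeasure_space_1 emeasure_lborel_Icc_eq)
  then show "integrable (lborel \<Otimes>\<^sub>M M) (\<lambda>z. C * indicator ({0..s} \<times> space M) z)"
    by (intro integrable_mult_right integrable_real_indicator) auto
  have [measurable]: "(\<lambda>(s, \<omega>). stopped X \<sigma> s \<omega>) \<in> borel_measurable (lborel \<Otimes>\<^sub>M M)"
    using measurable_stopped[OF assms(1)] by simp
  show "(\<lambda>(r, \<omega>). indicator {0..s} r * of_bool (ennreal r < \<sigma> \<omega>) * g (stopped X \<sigma> r \<omega>))
      \<in> borel_measurable (lborel \<Otimes>\<^sub>M M)"
    by measurable
  show "AE z in lborel \<Otimes>\<^sub>M M. norm (case z of (r, \<omega>) \<Rightarrow> indicator {0..s} r * of_bool (ennreal r < \<sigma> \<omega>) * g (stopped X \<sigma> r \<omega>))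
      \<le> norm (C * indicator ({0..s} \<times> space M) z)"
  proof (rule AE_I2)
    fix z :: "real \<times> 'a" assume "z \<in> space (lborel \<Otimes>\<^sub>M M)"
    then obtain r \<omega> where z: "z = (r, \<omega>)" "\<omega> \<in> space M" by (auto simp: space_pair_measure)
    have "0 \<le> C" "\<bar>g (stopped X \<sigma> r \<omega>)\<bar> \<le> C" using g[of 0] g[of "stopped X \<sigma> r \<omega>"] by auto
    then show "norm (case z of (r, \<omega>) \<Rightarrow> indicator {0..s} r * of_bool (ennreal r < \<sigma> \<omega>) * g (stopped X \<sigma> r \<omega>))
      \<le> norm (C * indicator ({0..s} \<times> space M) z)"
      using z(2) unfolding z(1) by (cases "r \<in> {0..s}"; cases "ennreal r < \<sigma> \<omega>") auto
  qed
qed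

text \<open>Optional stopping for \<open>f(X)\<close> minus the time integral of
  \<open>g(X)\<close>: on [0,s] it is bounded by B + Cs, and it is right-continuous because
  \<open>f\<close> is continuous and the integral is Lipschitz in time.\<close>

lemma dynkin_bounded:
  assumes f: "continuous_on UNIV f" "\<And>x. \<bar>f x\<bar> \<le> B"
    and g: "g \<in> borel_measurable borel" "\<And>x. \<bar>g x\<bar> \<le> C"
    and mart: "compensated_martingale M X f g" and A: "open A"
  shows "dynkin M (stopped X (hit A)) (hit A) f g (\<integral>\<omega>. f (X 0 \<omega>) \<partial>M)"
  unfolding dynkin_def
proof (intro allI impI conjI)
  fix s :: real assume s: "0 \<le> s"
  note [measurable] = measurable_hit[OF A] g(1) measurable_process
  note int = integrable_alive_bounded[OF measurable_hit[OF A] g]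
  show "integrable (lborel \<Otimes>\<^sub>M M) (\<lambda>(r, \<omega>). indicator {0..s} r * of_bool (ennreal r < hit A \<omega>) * g (stopped X (hit A) r \<omega>))"
    by (rule int)
  have C: "0 \<le> C" using g(2)[of 0] by simp
  define I where "I t \<omega> = (LINT r:{0..t}|lborel. g (X r \<omega>))" for t \<omega>
  have Xm [measurable]: "(\<lambda>r. X (max 0 r) \<omega>) \<in> borel_measurable borel" if "\<omega> \<in> space M" for \<omega>
    using measurable_Pair1[OF measurable_process that] by simp
  have I_eq: "I t \<omega> = (\<integral>r. indicator {0..t} r * g (X (max 0 r) \<omega>) \<partial>lborel)" for t \<omega>
    unfolding I_def set_lebesgue_integral_def
    by (rule Bochner_Integration.integral_cong) (auto simp: indicator_def)
  have I_int: "integrable lborel (\<lambda>r. indicator {0..t} r * g (X (max 0 r) \<omega>))" if "\<omega> \<in> space M" for t \<omega>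
  proof (rule Bochner_Integration.integrable_bound)
    show "integrable lborel (\<lambda>r. C * indicator {0..t} r)"
      by (intro integrable_mult_right integrable_real_indicator) (auto simp: emeasure_lborel_Icc_eq)
    show "(\<lambda>r. indicator {0..t} r * g (X (max 0 r) \<omega>)) \<in> borel_measurable lborel" using Xm[OF that] by measurable
    show "AE r in lborel. norm (indicator {0..t} r * g (X (max 0 r) \<omega>)) \<le> norm (C * indicator {0..t} r)"
      using g(2) C by (auto simp: indicator_def)
  qed
  have I_diff: "\<bar>I t' \<omega> - I t \<omega>\<bar> \<le> C * (t' - t)" if "\<omega> \<in> space M" "0 \<le> t" "t \<le> t'" for t t' \<omega>
  proof -
    have "I t' \<omega> - I t \<omega> = (\<integral>r. indicator {0..t'} r * g (X (max 0 r) \<omega>) - indicator {0..t} r * g (X (max 0 r) \<omega>) \<partial>lborel)"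
      unfolding I_eq by (rule Bochner_Integration.integral_diff[symmetric]) (rule I_int[OF that(1)])+
    also have "\<bar>\<dots>\<bar> \<le> (\<integral>r. C * indicator {t<..t'} r \<partial>lborel)"
    proof (rule order_trans[OF integral_abs_bound integral_mono])
      show "integrable lborel (\<lambda>r. \<bar>indicator {0..t'} r * g (X (max 0 r) \<omega>) - indicator {0..t} r * g (X (max 0 r) \<omega>)\<bar>)"
        by (intro integrable_abs Bochner_Integration.integrable_diff I_int[OF that(1)])
      show "integrable lborel (\<lambda>r. C * indicator {t<..t'} r)"
        using that by (intro integrable_mult_right integrable_real_indicator) auto
    qed (use g(2) C that in \<open>auto simp: indicator_def\<close>)
    also have "\<dots> = C * (t' - t)" using that by simp
    finally show ?thesis .
  qed
  have I0: "I 0 \<omega> = 0" for \<omega>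
  proof -
    have "AE r in lborel. indicator {0..0} r * g (X (max 0 r) \<omega>) = 0"
      using AE_lborel_singleton[of "0::real"] by eventually_elim (auto simp: indicator_def)
    then show ?thesis unfolding I_eq by (rule integral_eq_zero_AE)
  qed
  define Z where "Z t \<omega> = f (X t \<omega>) - I t \<omega>" for t \<omega>
  have Zm: "martingale M (natural_filtration M X) Z"
    using mart unfolding compensated_martingale_def Z_def I_def by simp
  have rc: "((\<lambda>r. Z r \<omega>) \<longlongrightarrow> Z t \<omega>) (at_right t)" if \<omega>: "\<omega> \<in> space M" and t: "0 \<le> t" for \<omega> t
    unfolding Z_def
  proof (rule tendsto_diff)
    show "((\<lambda>r. f (X r \<omega>)) \<longlongrightarrow> f (X t \<omega>)) (at_right t)"
      using f(1) cadlag_right[OF cadlag_paths[OF \<omega>] t] by (auto intro: continuous_on_tendsto_compose)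
    have "((\<lambda>r. I r \<omega> - I t \<omega>) \<longlongrightarrow> 0) (at_right t)"
    proof (rule Lim_null_comparison)
      show "\<forall>\<^sub>F r in at_right t. norm (I r \<omega> - I t \<omega>) \<le> C * (r - t)"
        by (rule eventually_at_rightI[of t "t + 1"]) (use I_diff[OF \<omega> t] in auto)
      have "((\<lambda>r. C * (r - t)) \<longlongrightarrow> C * (t - t)) (at_right t)" by (intro tendsto_intros)
      then show "((\<lambda>r. C * (r - t)) \<longlongrightarrow> 0) (at_right t)" by simp
    qed
    then show "((\<lambda>r. I r \<omega>) \<longlongrightarrow> I t \<omega>) (at_right t)" by (simp add: LIM_zero_iff)
  qed
  have bound: "\<bar>Z t \<omega>\<bar> \<le> B + C * s" if "\<omega> \<in> space M" "0 \<le> t" "t \<le> s" for \<omega> t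
  proof -
    have "\<bar>I t \<omega>\<bar> \<le> C * t" using I_diff[of \<omega> 0 t] I0 that by simp
    also have "\<dots> \<le> C * s" using C that by (intro mult_left_mono)
    finally show ?thesis using f(2)[of "X t \<omega>"] by (simp add: Z_def)
  qed
  note os = optional_stopping[OF Zm rc bound A s]
  define T where "T \<omega> = enn2real (min (ennreal s) (hit A \<omega>))" for \<omega>
  have T0: "0 \<le> T \<omega>" for \<omega> by (simp add: T_def)
  have IT: "I (T \<omega>) \<omega> = (\<integral>r. indicator {0..s} r * of_bool (ennreal r < hit A \<omega>) * g (stopped X (hit A) r \<omega>) \<partial>lborel)"
    if \<omega>: "\<omega> \<in> space M" for \<omega>
    unfolding I_eq
  proof (rule integral_cong_AE)
    show "(\<lambda>r. indicator {0..T \<omega>} r * g (X (max 0 r) \<omega>)) \<in> borel_measurable lborel" using Xm[OF \<omega>] by measurable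
    have [measurable]: "(\<lambda>r. stopped X (hit A) r \<omega>) \<in> borel_measurable borel"
      using measurable_Pair1[OF measurable_stopped[OF measurable_hit[OF A]] \<omega>] by simp
    show "(\<lambda>r. indicator {0..s} r * of_bool (ennreal r < hit A \<omega>) * g (stopped X (hit A) r \<omega>)) \<in> borel_measurable lborel"
      by measurable
    have e: "ennreal (T \<omega>) = min (ennreal s) (hit A \<omega>)"
      unfolding T_def by (intro ennreal_enn2real) (simp add: min_less_iff_disj)
    show "AE r in lborel. indicator {0..T \<omega>} r * g (X (max 0 r) \<omega>)
        = indicator {0..s} r * of_bool (ennreal r < hit A \<omega>) * g (stopped X (hit A) r \<omega>)"
      \<comment> \<open>Integration up to the stopping time includes its right end, whereas the
        indicator demands a time strictly before the hit; the two can differ only at this single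
        point.\<close>
      using AE_lborel_singleton[of "T \<omega>"]
    proof eventually_elim
      case (elim r)
      show ?case
      proof (cases "0 \<le> r")
        case True
        have "r < T \<omega> \<longleftrightarrow> ennreal r < ennreal (T \<omega>)" using True by (simp add: ennreal_less_iff)
        also have "\<dots> \<longleftrightarrow> r < s \<and> ennreal r < hit A \<omega>" unfolding e using True by (simp add: ennreal_less_iff)
        finally have "r < T \<omega> \<longleftrightarrow> r < s \<and> ennreal r < hit A \<omega>" .
        moreover have "ennreal s < hit A \<omega> \<Longrightarrow> T \<omega> = s" using s by (simp add: T_def min_absorb1 less_imp_le)
        ultimately have "r \<in> {0..T \<omega>} \<longleftrightarrow> r \<in> {0..s} \<and> ennreal r < hit A \<omega>" using elim True
          by (cases "r = s") auto
        moreover have "stopped X (hit A) r \<omega> = X (max 0 r) \<omega>" if "ennreal r < hit A \<omega>"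
          using that True by (simp add: stopped_def at_time_def min_absorb1 less_imp_le)
        ultimately show ?thesis by (auto simp: indicator_def)
      qed simp
    qed
  qed
  interpret P: pair_sigma_finite lborel M ..
  have fint: "integrable M (\<lambda>\<omega>. f (stopped X (hit A) s \<omega>))"
  proof (rule integrable_const_bound[of _ B])
    have [measurable]: "f \<in> borel_measurable borel" by (rule borel_measurable_continuous_onI[OF f(1)])
    have [measurable]: "(\<lambda>\<omega>. stopped X (hit A) s \<omega>) \<in> borel_measurable M"
      using measurable_compose_Pair1[OF _ measurable_stopped[OF measurable_hit[OF A]], of s] by simp
    show "(\<lambda>\<omega>. f (stopped X (hit A) s \<omega>)) \<in> borel_measurable M" by measurable
  qed (use f(2) in auto)
  have "(\<integral>(r, \<omega>). indicator {0..s} r * of_bool (ennreal r < hit A \<omega>) * g (stopped X (hit A) r \<omega>) \<partial>(lborel \<Otimes>\<^sub>M M))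
      = (\<integral>\<omega>. (\<integral>r. indicator {0..s} r * of_bool (ennreal r < hit A \<omega>) * g (stopped X (hit A) r \<omega>) \<partial>lborel) \<partial>M)"
    by (rule P.integral_snd[symmetric, OF int])
  also have "\<dots> = (\<integral>\<omega>. I (T \<omega>) \<omega> \<partial>M)"
    by (rule Bochner_Integration.integral_cong) (auto simp: IT)
  also have "\<dots> = (\<integral>\<omega>. f (stopped X (hit A) s \<omega>) - Z (T \<omega>) \<omega> \<partial>M)"
    by (rule Bochner_Integration.integral_cong) (auto simp: Z_def T_def stopped_def at_time_def)
  also have "\<dots> = (\<integral>\<omega>. f (stopped X (hit A) s \<omega>) \<partial>M) - (\<integral>\<omega>. Z (T \<omega>) \<omega> \<partial>M)"
    by (rule Bochner_Integration.integral_diff[OF fint]) (use os(2) in \<open>simp add: T_def\<close>)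
  also have "(\<integral>\<omega>. Z (T \<omega>) \<omega> \<partial>M) = (\<integral>\<omega>. f (X 0 \<omega>) \<partial>M)"
    using os(1) by (simp add: T_def Z_def I0)
  finally show "(\<integral>\<omega>. f (stopped X (hit A) s \<omega>) \<partial>M) - (\<integral>\<omega>. f (X 0 \<omega>) \<partial>M)
     = (\<integral>(r, \<omega>). indicator {0..s} r * of_bool (ennreal r < hit A \<omega>) * g (stopped X (hit A) r \<omega>) \<partial>(lborel \<Otimes>\<^sub>M M))"
    by simp
qed

end

lemma cadlag_processI:
  assumes "prob_space M" "progressively_measurable M X" "\<And>\<omega>. \<omega> \<in> space M \<Longrightarrow> cadlag (\<lambda>t. X t \<omega>)"
  shows "cadlag_process M X"
proof -
  interpret prob_space M by fact
  show ?thesis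
  proof
    \<comment> \<open>Progressive measurability is a statement on each bounded interval. Clipping
      the time to [0,n] changes nothing for times up to n, and the countably many pieces are then
      glued along the ceiling of the time.\<close>
    have g: "(\<lambda>z. X (min (max 0 (fst z)) (real n)) (snd z)) \<in> borel_measurable (borel \<Otimes>\<^sub>M M)" for n :: nat
    proof -
      have sub: "subalgebra M (natural_filtration M X (real n))" and
        m: "(\<lambda>(s, \<omega>). X s \<omega>) \<in> borel_measurable (restrict_space borel {0..real n} \<Otimes>\<^sub>M natural_filtration M X (real n))"
        using assms(2) by (auto simp: progressively_measurable_def)
      have "(\<lambda>z. (min (max 0 (fst z)) (real n), snd z))
          \<in> borel \<Otimes>\<^sub>M M \<rightarrow>\<^sub>M restrict_space borel {0..real n} \<Otimes>\<^sub>M natural_filtration M X (real n)"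
      proof (rule measurable_Pair)
        show "(\<lambda>z. min (max 0 (fst z)) (real n)) \<in> borel \<Otimes>\<^sub>M M \<rightarrow>\<^sub>M restrict_space borel {0..real n}"
          by (rule measurable_restrict_space2) auto
        show "snd \<in> borel \<Otimes>\<^sub>M M \<rightarrow>\<^sub>M natural_filtration M X (real n)"
          by (rule measurable_compose[OF measurable_snd, of "\<lambda>x. x", simplified])
             (use sub in \<open>auto simp: subalgebra_def measurable_def sets.sets_into_space\<close>)
      qed
      from measurable_compose[OF this m] show ?thesis by simp
    qed
    have "(\<lambda>z. (\<lambda>n z. X (min (max 0 (fst z)) (real n)) (snd z)) (nat \<lceil>fst z\<rceil>) z) \<in> borel_measurable (borel \<Otimes>\<^sub>M M)"
      by (rule measurable_compose_countable[where f = "\<lambda>n z. X (min (max 0 (fst z)) (real n)) (snd z)"]) (use g in measurable)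
    moreover have "min (max 0 s) (real (nat \<lceil>s\<rceil>)) = max 0 s" for s :: real
      by (cases "0 \<le> s") (auto simp: min_def max_def of_nat_ceiling)
    ultimately show "(\<lambda>(s, \<omega>). X (max 0 s) \<omega>) \<in> borel_measurable (borel \<Otimes>\<^sub>M M)"
      by (simp add: case_prod_beta)
  qed (use assms in auto)
qed

section \<open>The identity on a triangle\<close>

text \<open>For almost every section the integrals of the positive and the negative part differ by
  at most 1, so the negative part is controlled by the positive part plus the indicator of [0,U].
  Integrating this over the remaining variables adds only the length of [0,U].\<close>

lemma integrable_one_sided:
  fixes P :: "'p measure" and N :: "'b measure" and h :: "'p \<times> real \<times> 'b \<Rightarrow> real"
  assumes P: "sigma_finite_measure P" and N: "prob_space N"
    and h [measurable]: "h \<in> borel_measurable (P \<Otimes>\<^sub>M (lborel \<Otimes>\<^sub>M N))"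
    and fin: "(\<integral>\<^sup>+ z. ennreal (h z) \<partial>(P \<Otimes>\<^sub>M (lborel \<Otimes>\<^sub>M N))) < \<infinity>"
    and sect: "\<And>t. AE \<eta> in N. integrable P (\<lambda>p. h (p, t, \<eta>)) \<and> \<bar>\<integral>p. h (p, t, \<eta>) \<partial>P\<bar> \<le> indicator {0..U} t"
  shows "integrable (P \<Otimes>\<^sub>M (lborel \<Otimes>\<^sub>M N)) h"
proof -
  interpret P: sigma_finite_measure P by fact
  interpret N: prob_space N by fact
  interpret Q: pair_sigma_finite lborel N ..
  interpret PQ: pair_sigma_finite P "lborel \<Otimes>\<^sub>M N" ..
  have neg: "(\<integral>\<^sup>+ p. ennreal (- h (p, t, \<eta>)) \<partial>P) \<le> (\<integral>\<^sup>+ p. ennreal (h (p, t, \<eta>)) \<partial>P) + indicator {0..U} t"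
    if "integrable P (\<lambda>p. h (p, t, \<eta>)) \<and> \<bar>\<integral>p. h (p, t, \<eta>) \<partial>P\<bar> \<le> indicator {0..U} t" for t \<eta>
  proof -
    have i: "integrable P (\<lambda>p. h (p, t, \<eta>))" and b: "\<bar>\<integral>p. h (p, t, \<eta>) \<partial>P\<bar> \<le> indicator {0..U} t"
      using that by auto
    define u where "u = enn2real (\<integral>\<^sup>+ p. ennreal (h (p, t, \<eta>)) \<partial>P)"
    define v where "v = enn2real (\<integral>\<^sup>+ p. ennreal (- h (p, t, \<eta>)) \<partial>P)"
    have u: "(\<integral>\<^sup>+ p. ennreal (h (p, t, \<eta>)) \<partial>P) = ennreal u" and v: "(\<integral>\<^sup>+ p. ennreal (- h (p, t, \<eta>)) \<partial>P) = ennreal v"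
      using i unfolding u_def v_def by (auto simp: real_integrable_def less_top)
    have uv: "0 \<le> u" "0 \<le> v" by (auto simp: u_def v_def)
    have "(\<integral>p. h (p, t, \<eta>) \<partial>P) = u - v" using real_lebesgue_integral_def[OF i] by (simp add: u_def v_def)
    with b have "v \<le> u + indicator {0..U} t" by linarith
    then have "ennreal v \<le> ennreal (u + indicator {0..U} t)" by (rule ennreal_leI)
    also have "\<dots> = ennreal u + indicator {0..U} t" using uv by (simp add: ennreal_plus ennreal_indicator)
    finally show ?thesis unfolding u v .
  qed
  have "(\<integral>\<^sup>+ z. ennreal (- h z) \<partial>(P \<Otimes>\<^sub>M (lborel \<Otimes>\<^sub>M N))) = (\<integral>\<^sup>+ q. (\<integral>\<^sup>+ p. ennreal (- h (p, q)) \<partial>P) \<partial>(lborel \<Otimes>\<^sub>M N))"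
    by (rule PQ.nn_integral_snd[symmetric]) measurable
  also have "\<dots> = (\<integral>\<^sup>+ t. (\<integral>\<^sup>+ \<eta>. (\<integral>\<^sup>+ p. ennreal (- h (p, t, \<eta>)) \<partial>P) \<partial>N) \<partial>lborel)"
    by (rule N.nn_integral_fst[symmetric]) measurable
  also have "\<dots> \<le> (\<integral>\<^sup>+ t. (\<integral>\<^sup>+ \<eta>. (\<integral>\<^sup>+ p. ennreal (h (p, t, \<eta>)) \<partial>P) + indicator {0..U} t \<partial>N) \<partial>lborel)"
  proof (rule nn_integral_mono, rule nn_integral_mono_AE)
    fix t :: real
    show "AE \<eta> in N. (\<integral>\<^sup>+ p. ennreal (- h (p, t, \<eta>)) \<partial>P) \<le> (\<integral>\<^sup>+ p. ennreal (h (p, t, \<eta>)) \<partial>P) + indicator {0..U} t"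
      using sect[of t] by eventually_elim (rule neg)
  qed
  also have "\<dots> = (\<integral>\<^sup>+ q. (\<integral>\<^sup>+ p. ennreal (h (p, q)) \<partial>P) + indicator {0..U} (fst q) \<partial>(lborel \<Otimes>\<^sub>M N))"
    by (subst N.nn_integral_fst[symmetric]) (auto, measurable)
  also have "\<dots> = (\<integral>\<^sup>+ q. (\<integral>\<^sup>+ p. ennreal (h (p, q)) \<partial>P) \<partial>(lborel \<Otimes>\<^sub>M N)) + (\<integral>\<^sup>+ q. indicator {0..U} (fst q) \<partial>(lborel \<Otimes>\<^sub>M N))"
    by (rule nn_integral_add) measurable
  also have "(\<integral>\<^sup>+ q. indicator {0..U} (fst q) \<partial>(lborel \<Otimes>\<^sub>M N)) = emeasure lborel {0..U}"
    by (subst N.nn_integral_fst[symmetric]) (auto simp: N.emeasure_space_1)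
  also have "(\<integral>\<^sup>+ q. (\<integral>\<^sup>+ p. ennreal (h (p, q)) \<partial>P) \<partial>(lborel \<Otimes>\<^sub>M N)) = (\<integral>\<^sup>+ z. ennreal (h z) \<partial>(P \<Otimes>\<^sub>M (lborel \<Otimes>\<^sub>M N)))"
    by (rule PQ.nn_integral_snd) measurable
  also have "\<dots> + emeasure lborel {0..U} < \<infinity>" using fin by (simp add: emeasure_lborel_Icc_eq)
  finally show ?thesis using fin h by (simp add: real_integrable_def less_top[symmetric])
qed

lemma integrable_indicator_bounded:
  fixes w :: "real \<Rightarrow> real"
  assumes [measurable]: "w \<in> borel_measurable borel" and w: "\<And>t. \<bar>w t\<bar> \<le> C"
  shows "integrable lborel (\<lambda>t. indicator {a..b} t * w t)"
proof (rule Bochner_Integration.integrable_bound)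
  show "integrable lborel (\<lambda>t. C * indicator {a..b} t)"
    by (intro integrable_mult_right integrable_real_indicator) (auto simp: emeasure_lborel_Icc_eq)
  show "AE t in lborel. norm (indicator {a..b} t * w t) \<le> norm (C * indicator {a..b} t)"
    using w by (auto simp: indicator_def intro: order_trans[OF _ abs_ge_self])
qed measurable

lemma (in prob_space) abs_expectation_le:
  fixes f :: "'a \<Rightarrow> real"
  assumes "f \<in> borel_measurable M" "\<And>\<omega>. \<bar>f \<omega>\<bar> \<le> C"
  shows "integrable M f" "\<bar>\<integral>\<omega>. f \<omega> \<partial>M\<bar> \<le> C"
proof -
  show i: "integrable M f" by (rule integrable_const_bound[of _ C]) (use assms in auto)
  have "\<bar>\<integral>\<omega>. f \<omega> \<partial>M\<bar> \<le> (\<integral>\<omega>. \<bar>f \<omega>\<bar> \<partial>M)" by (rule integral_abs_bound)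
  also have "\<dots> \<le> (\<integral>\<omega>. C \<partial>M)" by (rule integral_mono) (use i assms in auto)
  finally show "\<bar>\<integral>\<omega>. f \<omega> \<partial>M\<bar> \<le> C" by (simp add: prob_space)
qed

text \<open>The assumptions are symmetric in the two processes, so one-sided statements are proved
  for one of them and transferred by \<open>stopped_pair_swap\<close>.\<close>

locale stopped_pair = M: prob_space M + N: prob_space N
  for M :: "'a measure" and N :: "'b measure" +
  fixes F :: "real \<Rightarrow> 'a \<Rightarrow> ennreal" and \<sigma> :: "'a \<Rightarrow> ennreal"
    and G :: "real \<Rightarrow> 'b \<Rightarrow> ennreal" and \<tau> :: "'b \<Rightarrow> ennreal"
    and \<phi> :: "ennreal \<Rightarrow> ennreal \<Rightarrow> real"
  assumes F: "(\<lambda>(s, \<omega>). F s \<omega>) \<in> borel_measurable (borel \<Otimes>\<^sub>M M)" and \<sigma>: "\<sigma> \<in> borel_measurable M"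
    and G: "(\<lambda>(t, \<eta>). G t \<eta>) \<in> borel_measurable (borel \<Otimes>\<^sub>M N)" and \<tau>: "\<tau> \<in> borel_measurable N"
    and \<phi>: "(\<lambda>(x, y). \<phi> x y) \<in> borel_measurable (borel \<Otimes>\<^sub>M borel)"
begin

abbreviation time_M :: "(real \<times> 'a) measure" where "time_M \<equiv> lborel \<Otimes>\<^sub>M M"
abbreviation time_N :: "(real \<times> 'b) measure" where "time_N \<equiv> lborel \<Otimes>\<^sub>M N"

abbreviation dynkin_M :: "ennreal \<Rightarrow> ennreal \<Rightarrow> bool" where
  "dynkin_M x0 y \<equiv> dynkin M F \<sigma> (\<lambda>x. lap x y) (\<lambda>x. \<phi> x y) (lap x0 y)"

definition kernel :: "real \<Rightarrow> (real \<times> 'a) \<times> (real \<times> 'b) \<Rightarrow> real" where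
  "kernel U = (\<lambda>((s, \<omega>), (t, \<eta>)). of_bool (0 \<le> s \<and> 0 \<le> t \<and> s + t \<le> U) *
     of_bool (ennreal s < \<sigma> \<omega>) * of_bool (ennreal t < \<tau> \<eta>) * \<phi> (F s \<omega>) (G t \<eta>))"

lemma measurable_F [measurable]:
  assumes [measurable]: "f \<in> borel_measurable K" "g \<in> K \<rightarrow>\<^sub>M M"
  shows "(\<lambda>x. F (f x) (g x)) \<in> borel_measurable K"
  using measurable_compose[OF _ F, of "\<lambda>x. (f x, g x)" K] by simp

lemma measurable_G [measurable]:
  assumes [measurable]: "f \<in> borel_measurable K" "g \<in> K \<rightarrow>\<^sub>M N"
  shows "(\<lambda>x. G (f x) (g x)) \<in> borel_measurable K"
  using measurable_compose[OF _ G, of "\<lambda>x. (f x, g x)" K] by simp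

lemma measurable_phi [measurable]:
  assumes [measurable]: "f \<in> borel_measurable K" "g \<in> borel_measurable K"
  shows "(\<lambda>x. \<phi> (f x) (g x)) \<in> borel_measurable K"
  using measurable_compose[OF _ \<phi>, of "\<lambda>x. (f x, g x)" K] by simp

declare \<sigma> [measurable] \<tau> [measurable]

lemma measurable_kernel [measurable]: "kernel U \<in> borel_measurable (time_M \<Otimes>\<^sub>M time_N)"
  unfolding kernel_def case_prod_beta by measurable

sublocale P: pair_sigma_finite lborel M ..
sublocale Q: pair_sigma_finite lborel N ..
sublocale PQ: pair_sigma_finite "time_M" "time_N" ..
sublocale PN: pair_sigma_finite "time_M" N ..
sublocale MN: pair_sigma_finite M N ..

text \<open>With the second process frozen at time \<open>t\<close>, the triangle leaves the time
  interval [0,U-t] to the first one, and the integral is its Dynkin formula with exponent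
  \<open>G t \<eta>\<close>.\<close>

lemma kernel_section:
  assumes "dynkin_M x0 (G t \<eta>)"
  shows "integrable time_M (\<lambda>p. kernel U (p, t, \<eta>))"
    "(\<integral>p. kernel U (p, t, \<eta>) \<partial>time_M) =
       indicator {0..U} t * (of_bool (ennreal t < \<tau> \<eta>) * ((\<integral>\<omega>. lap (F (U - t) \<omega>) (G t \<eta>) \<partial>M) - lap x0 (G t \<eta>)))"
proof -
  let ?b = "indicator {0..U} t * of_bool (ennreal t < \<tau> \<eta>) :: real"
  let ?k = "\<lambda>(s, \<omega>). indicator {0..U - t} s * of_bool (ennreal s < \<sigma> \<omega>) * \<phi> (F s \<omega>) (G t \<eta>)"
  have eq: "kernel U (p, t, \<eta>) = ?b * ?k p" for p
  proof -
    obtain s \<omega> where p: "p = (s, \<omega>)" by (cases p)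
    have "of_bool (0 \<le> s \<and> 0 \<le> t \<and> s + t \<le> U) = (indicator {0..U} t * indicator {0..U - t} s :: real)"
      by (auto simp: indicator_def)
    then show ?thesis by (simp add: kernel_def p)
  qed
  have "integrable time_M (\<lambda>p. ?b * ?k p) \<and> (\<integral>p. ?b * ?k p \<partial>time_M) =
       ?b * ((\<integral>\<omega>. lap (F (U - t) \<omega>) (G t \<eta>) \<partial>M) - lap x0 (G t \<eta>))"
  proof (cases "t \<in> {0..U}")
    case True
    then have "0 \<le> U - t" by simp
    with assms have "integrable time_M ?k" "(\<integral>\<omega>. lap (F (U - t) \<omega>) (G t \<eta>) \<partial>M) - lap x0 (G t \<eta>) = (\<integral>p. ?k p \<partial>time_M)"
      unfolding dynkin_def by blast+
    then show ?thesis by simp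
  qed simp
  then show "integrable time_M (\<lambda>p. kernel U (p, t, \<eta>))"
    "(\<integral>p. kernel U (p, t, \<eta>) \<partial>time_M) =
       indicator {0..U} t * (of_bool (ennreal t < \<tau> \<eta>) * ((\<integral>\<omega>. lap (F (U - t) \<omega>) (G t \<eta>) \<partial>M) - lap x0 (G t \<eta>)))"
    unfolding eq by (auto simp: mult.assoc)
qed

lemma kernel_section_le:
  assumes "dynkin_M x0 (G t \<eta>)" and \<eta>: "\<eta> \<in> space N"
  shows "\<bar>\<integral>p. kernel U (p, t, \<eta>) \<partial>time_M\<bar> \<le> indicator {0..U} t"
proof -
  have "0 \<le> (\<integral>\<omega>. lap (F (U - t) \<omega>) (G t \<eta>) \<partial>M)" "(\<integral>\<omega>. lap (F (U - t) \<omega>) (G t \<eta>) \<partial>M) \<le> 1"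
  proof -
    have m: "(\<lambda>\<omega>. lap (F (U - t) \<omega>) (G t \<eta>)) \<in> borel_measurable M" by measurable
    show "0 \<le> (\<integral>\<omega>. lap (F (U - t) \<omega>) (G t \<eta>) \<partial>M)" by (rule Bochner_Integration.integral_nonneg) (simp add: lap_bounds)
    show "(\<integral>\<omega>. lap (F (U - t) \<omega>) (G t \<eta>) \<partial>M) \<le> 1"
      using M.abs_expectation_le(2)[OF m lap_bounds(3)] by simp
  qed
  then have "\<bar>(\<integral>\<omega>. lap (F (U - t) \<omega>) (G t \<eta>) \<partial>M) - lap x0 (G t \<eta>)\<bar> \<le> 1"
    using lap_bounds(1,2)[of x0 "G t \<eta>"] by linarith
  then show ?thesis unfolding kernel_section(2)[OF assms(1)]
    by (auto simp: indicator_def)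
qed

lemma half_identity:
  assumes dyn: "\<And>t. 0 \<le> t \<Longrightarrow> AE \<eta> in N. dynkin_M x0 (G t \<eta>)"
    and int: "integrable (time_M \<Otimes>\<^sub>M time_N) (kernel U)"
  shows "(\<integral>z. kernel U z \<partial>(time_M \<Otimes>\<^sub>M time_N)) =
    (\<integral>t. indicator {0..U} t * (\<integral>\<eta>. of_bool (ennreal t < \<tau> \<eta>) *
       ((\<integral>\<omega>. lap (F (U - t) \<omega>) (G t \<eta>) \<partial>M) - lap x0 (G t \<eta>)) \<partial>N) \<partial>lborel)"
proof -
  have int': "integrable (time_M \<Otimes>\<^sub>M time_N) (case_prod (\<lambda>p q. kernel U (p, q)))"
    using int by simp
  have "(\<integral>z. kernel U z \<partial>(time_M \<Otimes>\<^sub>M time_N)) = (\<integral>q. (\<integral>p. kernel U (p, q) \<partial>time_M) \<partial>time_N)"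
    using PQ.integral_snd[OF int'] by simp
  also have "\<dots> = (\<integral>t. (\<integral>\<eta>. (\<integral>p. kernel U (p, t, \<eta>) \<partial>time_M) \<partial>N) \<partial>lborel)"
    by (rule Q.integral_fst'[symmetric]) (rule PQ.integrable_snd[OF int'])
  also have "\<dots> = (\<integral>t. indicator {0..U} t * (\<integral>\<eta>. of_bool (ennreal t < \<tau> \<eta>) *
       ((\<integral>\<omega>. lap (F (U - t) \<omega>) (G t \<eta>) \<partial>M) - lap x0 (G t \<eta>)) \<partial>N) \<partial>lborel)"
  proof (rule Bochner_Integration.integral_cong[OF refl])
    fix t :: real
    show "(\<integral>\<eta>. (\<integral>p. kernel U (p, t, \<eta>) \<partial>time_M) \<partial>N) = indicator {0..U} t * (\<integral>\<eta>. of_bool (ennreal t < \<tau> \<eta>) *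
       ((\<integral>\<omega>. lap (F (U - t) \<omega>) (G t \<eta>) \<partial>M) - lap x0 (G t \<eta>)) \<partial>N)"
    proof (cases "0 \<le> t")
      case True
      have "(\<integral>\<eta>. (\<integral>p. kernel U (p, t, \<eta>) \<partial>time_M) \<partial>N) = (\<integral>\<eta>. indicator {0..U} t * (of_bool (ennreal t < \<tau> \<eta>) *
       ((\<integral>\<omega>. lap (F (U - t) \<omega>) (G t \<eta>) \<partial>M) - lap x0 (G t \<eta>))) \<partial>N)"
      proof (rule integral_cong_AE)
        show "AE \<eta> in N. (\<integral>p. kernel U (p, t, \<eta>) \<partial>time_M) = indicator {0..U} t * (of_bool (ennreal t < \<tau> \<eta>) *
       ((\<integral>\<omega>. lap (F (U - t) \<omega>) (G t \<eta>) \<partial>M) - lap x0 (G t \<eta>)))"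
          using dyn[OF True] by eventually_elim (rule kernel_section)
      qed measurable
      then show ?thesis by simp
    next
      case False
      then have "kernel U (p, t, \<eta>) = 0" for p \<eta> by (cases p) (simp add: kernel_def)
      then show ?thesis using False by simp
    qed
  qed
  finally show ?thesis .
qed

text \<open>The number \<open>e\<close> selects the sign in condition (A). That condition integrates
  the stopped processes also after they have stopped; restricting to times before stopping only
  decreases the part with the chosen sign, and \<open>integrable_one_sided\<close> supplies the
  other.\<close>

lemma integrable_kernel_pos:
  assumes dyn: "\<And>t. 0 \<le> t \<Longrightarrow> AE \<eta> in N. dynkin_M x0 (G t \<eta>)"
    and e: "e = 1 \<or> e = -1"
    and fin: "(\<integral>\<^sup>+ t\<in>{0..U}. (\<integral>\<^sup>+ s\<in>{0..U}. (\<integral>\<^sup>+ (\<omega>, \<eta>). ennreal (max (e * \<phi> (F s \<omega>) (G t \<eta>)) 0) \<partial>(M \<Otimes>\<^sub>M N))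
          * indicator {0..U} (s + t) \<partial>lborel) \<partial>lborel) < \<infinity>"
  shows "integrable (time_M \<Otimes>\<^sub>M time_N) (kernel U)"
proof -
  let ?k = "\<lambda>s t \<omega> \<eta>. ennreal (max (e * \<phi> (F s \<omega>) (G t \<eta>)) 0) * indicator {0..U} (s + t) * indicator {0..U} s * indicator {0..U} t"
  have "(\<integral>\<^sup>+ z. ennreal (e * kernel U z) \<partial>(time_M \<Otimes>\<^sub>M time_N))
     = (\<integral>\<^sup>+ q. (\<integral>\<^sup>+ p. ennreal (e * kernel U (p, q)) \<partial>time_M) \<partial>time_N)"
    by (rule PQ.nn_integral_snd[symmetric]) measurable
  also have "\<dots> = (\<integral>\<^sup>+ t. (\<integral>\<^sup>+ \<eta>. (\<integral>\<^sup>+ p. ennreal (e * kernel U (p, t, \<eta>)) \<partial>time_M) \<partial>N) \<partial>lborel)"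
    by (rule N.nn_integral_fst[symmetric]) measurable
  also have "\<dots> = (\<integral>\<^sup>+ t. (\<integral>\<^sup>+ p. (\<integral>\<^sup>+ \<eta>. ennreal (e * kernel U (p, t, \<eta>)) \<partial>N) \<partial>time_M) \<partial>lborel)"
    by (intro nn_integral_cong PN.Fubini') measurable
  also have "\<dots> = (\<integral>\<^sup>+ t. (\<integral>\<^sup>+ s. (\<integral>\<^sup>+ \<omega>. (\<integral>\<^sup>+ \<eta>. ennreal (e * kernel U ((s, \<omega>), t, \<eta>)) \<partial>N) \<partial>M) \<partial>lborel) \<partial>lborel)"
    by (intro nn_integral_cong M.nn_integral_fst[symmetric]) measurable
  also have "\<dots> \<le> (\<integral>\<^sup>+ t. (\<integral>\<^sup>+ s. (\<integral>\<^sup>+ \<omega>. (\<integral>\<^sup>+ \<eta>. ?k s t \<omega> \<eta> \<partial>N) \<partial>M) \<partial>lborel) \<partial>lborel)"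
    by (intro nn_integral_mono) (auto simp: kernel_def indicator_def intro!: ennreal_leI)
  also have "\<dots> = (\<integral>\<^sup>+ t\<in>{0..U}. (\<integral>\<^sup>+ s\<in>{0..U}. (\<integral>\<^sup>+ (\<omega>, \<eta>). ennreal (max (e * \<phi> (F s \<omega>) (G t \<eta>)) 0) \<partial>(M \<Otimes>\<^sub>M N))
          * indicator {0..U} (s + t) \<partial>lborel) \<partial>lborel)"
    by (simp add: nn_integral_multc N.nn_integral_fst[symmetric])
  finally have fin': "(\<integral>\<^sup>+ z. ennreal (e * kernel U z) \<partial>(time_M \<Otimes>\<^sub>M time_N)) < \<infinity>"
    using fin by (rule le_less_trans)
  have sf: "sigma_finite_measure time_M" by unfold_locales
  have "integrable (time_M \<Otimes>\<^sub>M time_N) (\<lambda>z. e * kernel U z)"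
  proof (rule integrable_one_sided[OF sf N.prob_space_axioms _ fin'])
    fix t :: real
    show "AE \<eta> in N. integrable time_M (\<lambda>p. e * kernel U (p, t, \<eta>)) \<and> \<bar>\<integral>p. e * kernel U (p, t, \<eta>) \<partial>time_M\<bar> \<le> indicator {0..U} t"
    proof (cases "0 \<le> t")
      case True
      show ?thesis
        using dyn[OF True] AE_space
      proof eventually_elim
        case (elim \<eta>)
        then show ?case using kernel_section(1)[OF elim(1)] kernel_section_le[OF elim] e by (auto simp: abs_mult)
      qed
    next
      case False
      then have "kernel U (p, t, \<eta>) = 0" for p \<eta> by (cases p) (simp add: kernel_def)
      then show ?thesis by simp
    qed
  qed measurable
  then show ?thesis using e by auto
qed

end

section \<open>Exchange of the processes and cancellation\<close>

lemma stopped_pair_swap: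
  assumes "stopped_pair M N F \<sigma> G \<tau> \<phi>"
  shows "stopped_pair N M G \<tau> F \<sigma> (\<lambda>y x. \<phi> x y)"
proof -
  interpret stopped_pair M N F \<sigma> G \<tau> \<phi> by fact
  show ?thesis
  proof unfold_locales
    show "(\<lambda>(x, y). \<phi> y x) \<in> borel_measurable (borel \<Otimes>\<^sub>M borel)"
      unfolding case_prod_beta by measurable
  qed (rule F G \<sigma> \<tau>)+
qed

text \<open>The generator duality in pointwise form: both Dynkin formulas are driven by the same
  function \<open>\<phi>\<close>, so the two halves integrate the same kernel.\<close>

lemma kernel_swap:
  assumes "stopped_pair M N F \<sigma> G \<tau> \<phi>"
  shows "stopped_pair.kernel G \<tau> F \<sigma> (\<lambda>y x. \<phi> x y) U (q, p) = stopped_pair.kernel F \<sigma> G \<tau> \<phi> U (p, q)"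
  unfolding stopped_pair.kernel_def[OF assms] stopped_pair.kernel_def[OF stopped_pair_swap[OF assms]]
  by (auto simp: case_prod_beta add.commute)

context stopped_pair begin

abbreviation boundary_M :: "ennreal \<Rightarrow> real \<Rightarrow> real \<Rightarrow> real" where
  "boundary_M x0 U t \<equiv> (\<integral>\<eta>. (\<integral>\<omega>. of_bool (\<tau> \<eta> \<le> ennreal t) * (lap (F (U - t) \<omega>) (G t \<eta>) - lap x0 (G t \<eta>)) \<partial>M) \<partial>N)"

abbreviation boundary_N :: "ennreal \<Rightarrow> real \<Rightarrow> real \<Rightarrow> real" where
  "boundary_N y0 U s \<equiv> (\<integral>\<omega>. (\<integral>\<eta>. of_bool (\<sigma> \<omega> \<le> ennreal s) * (lap (F s \<omega>) (G (U - s) \<eta>) - lap (F s \<omega>) y0) \<partial>N) \<partial>M)"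

text \<open>The indicator of being alive at \<open>t\<close> is 1 minus the indicator of being
  stopped. The first part yields the full increment of the kernel, the second the boundary
  term.\<close>

lemma side_M:
  "(\<integral>\<eta>. of_bool (ennreal t < \<tau> \<eta>) * ((\<integral>\<omega>. lap (F (U - t) \<omega>) (G t \<eta>) \<partial>M) - lap x0 (G t \<eta>)) \<partial>N)
    = (\<integral>\<eta>. (\<integral>\<omega>. lap (F (U - t) \<omega>) (G t \<eta>) \<partial>M) \<partial>N) - (\<integral>\<eta>. lap x0 (G t \<eta>) \<partial>N) - boundary_M x0 U t"
proof -
  define l where "l \<eta> = (\<integral>\<omega>. lap (F (U - t) \<omega>) (G t \<eta>) \<partial>M)" for \<eta>
  have lm [measurable]: "l \<in> borel_measurable N" unfolding l_def by measurable
  have int: "integrable M (\<lambda>\<omega>. lap (F (U - t) \<omega>) (G t \<eta>))" "\<bar>l \<eta>\<bar> \<le> 1" for \<eta>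
    unfolding l_def by (rule M.abs_expectation_le[of _ 1]; (simp add: lap_bounds)?; measurable)+
  have b: "(\<integral>\<omega>. of_bool (\<tau> \<eta> \<le> ennreal t) * (lap (F (U - t) \<omega>) (G t \<eta>) - lap x0 (G t \<eta>)) \<partial>M)
      = of_bool (\<tau> \<eta> \<le> ennreal t) * (l \<eta> - lap x0 (G t \<eta>))" for \<eta>
    using int(1) by (simp add: l_def M.prob_space)
  have i1: "integrable N l" by (rule N.abs_expectation_le[OF lm int(2)])
  have i2: "integrable N (\<lambda>\<eta>. lap x0 (G t \<eta>))" by (rule N.abs_expectation_le[of _ 1]) (auto simp: lap_bounds)
  have i3: "integrable N (\<lambda>\<eta>. of_bool (\<tau> \<eta> \<le> ennreal t) * (l \<eta> - lap x0 (G t \<eta>)))"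
  proof (rule N.abs_expectation_le[of _ 2])
    show "\<bar>of_bool (\<tau> \<eta> \<le> ennreal t) * (l \<eta> - lap x0 (G t \<eta>))\<bar> \<le> 2" for \<eta>
      using int(2)[of \<eta>] lap_bounds(3)[of x0 "G t \<eta>"] by (auto simp: of_bool_def)
  qed measurable
  have "(\<integral>\<eta>. of_bool (ennreal t < \<tau> \<eta>) * (l \<eta> - lap x0 (G t \<eta>)) \<partial>N)
     = (\<integral>\<eta>. (l \<eta> - lap x0 (G t \<eta>)) - of_bool (\<tau> \<eta> \<le> ennreal t) * (l \<eta> - lap x0 (G t \<eta>)) \<partial>N)"
    by (rule Bochner_Integration.integral_cong) (auto simp: not_less)
  also have "\<dots> = (\<integral>\<eta>. l \<eta> \<partial>N) - (\<integral>\<eta>. lap x0 (G t \<eta>) \<partial>N) - (\<integral>\<eta>. of_bool (\<tau> \<eta> \<le> ennreal t) * (l \<eta> - lap x0 (G t \<eta>)) \<partial>N)"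
    using i1 i2 i3 by simp
  finally show ?thesis unfolding b by (simp add: l_def)
qed

lemma side_N:
  "(\<integral>\<omega>. of_bool (ennreal s < \<sigma> \<omega>) * ((\<integral>\<eta>. lap (F s \<omega>) (G (U - s) \<eta>) \<partial>N) - lap (F s \<omega>) y0) \<partial>M)
    = (\<integral>\<omega>. (\<integral>\<eta>. lap (F s \<omega>) (G (U - s) \<eta>) \<partial>N) \<partial>M) - (\<integral>\<omega>. lap (F s \<omega>) y0 \<partial>M) - boundary_N y0 U s"
  using stopped_pair.side_M[OF stopped_pair_swap[OF stopped_pair_axioms], of s U y0]
  by (simp add: lap_commute)

lemma triangle_identity:
  assumes dynM: "\<And>t. 0 \<le> t \<Longrightarrow> AE \<eta> in N. dynkin_M x0 (G t \<eta>)"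
    and dynN: "\<And>s. 0 \<le> s \<Longrightarrow> AE \<omega> in M. dynkin N G \<tau> (\<lambda>y. lap (F s \<omega>) y) (\<lambda>y. \<phi> (F s \<omega>) y) (lap (F s \<omega>) y0)"
    and e: "e = 1 \<or> e = -1"
    and fin: "(\<integral>\<^sup>+ t\<in>{0..U}. (\<integral>\<^sup>+ s\<in>{0..U}. (\<integral>\<^sup>+ (\<omega>, \<eta>). ennreal (max (e * \<phi> (F s \<omega>) (G t \<eta>)) 0) \<partial>(M \<Otimes>\<^sub>M N))
          * indicator {0..U} (s + t) \<partial>lborel) \<partial>lborel) < \<infinity>"
  shows "(\<integral>s. indicator {0..U} s * ((\<integral>\<omega>. lap (F s \<omega>) y0 \<partial>M) - (\<integral>\<eta>. lap x0 (G s \<eta>) \<partial>N)) \<partial>lborel)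
    = (\<integral>t. indicator {0..U} t * (boundary_M x0 U t - boundary_N y0 U t) \<partial>lborel)"
proof -
  interpret S: stopped_pair N M G \<tau> F \<sigma> "\<lambda>y x. \<phi> x y" by (rule stopped_pair_swap[OF stopped_pair_axioms])
  have int: "integrable (time_M \<Otimes>\<^sub>M time_N) (kernel U)"
    by (rule integrable_kernel_pos[OF dynM e fin])
  have sw: "S.kernel U = (\<lambda>(q, p). kernel U (p, q))"
    using kernel_swap[OF stopped_pair_axioms] by auto
  have int': "integrable (time_N \<Otimes>\<^sub>M time_M) (S.kernel U)"
    unfolding sw by (rule PQ.integrable_product_swap[OF int])
  have swi: "(\<integral>z. S.kernel U z \<partial>(time_N \<Otimes>\<^sub>M time_M)) = (\<integral>z. kernel U z \<partial>(time_M \<Otimes>\<^sub>M time_N))"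
    unfolding sw by (rule PQ.integral_product_swap) measurable
  define f where "f s t = (\<integral>\<omega>. (\<integral>\<eta>. lap (F s \<omega>) (G t \<eta>) \<partial>N) \<partial>M)" for s t
  have f: "(\<integral>\<eta>. (\<integral>\<omega>. lap (F s \<omega>) (G t \<eta>) \<partial>M) \<partial>N) = f s t" for s t
    unfolding f_def
  proof (rule MN.Fubini_integral)
    interpret MN': pair_prob_space M N ..
    show "integrable (M \<Otimes>\<^sub>M N) (\<lambda>(\<omega>, \<eta>). lap (F s \<omega>) (G t \<eta>))"
      by (rule MN'.integrable_const_bound[of _ 1]) (auto simp: lap_bounds case_prod_beta)
  qed
  have fm [measurable]: "(\<lambda>s. f (U - s) s) \<in> borel_measurable borel" "(\<lambda>s. f s (U - s)) \<in> borel_measurable borel"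
    unfolding f_def by measurable
  have fb: "\<bar>f s t\<bar> \<le> 1" for s t
    unfolding f_def
  proof (rule M.abs_expectation_le)
    show "\<bar>\<integral>\<eta>. lap (F s \<omega>) (G t \<eta>) \<partial>N\<bar> \<le> 1" for \<omega>
      by (rule N.abs_expectation_le) (auto simp: lap_bounds)
  qed measurable
  define g where "g s = (\<integral>\<omega>. lap (F s \<omega>) y0 \<partial>M)" for s
  define g' where "g' t = (\<integral>\<eta>. lap x0 (G t \<eta>) \<partial>N)" for t
  have gm [measurable]: "g \<in> borel_measurable borel" "g' \<in> borel_measurable borel"
    unfolding g_def g'_def by measurable
  have gb: "\<bar>g s\<bar> \<le> 1" "\<bar>g' s\<bar> \<le> 1" for s
    unfolding g_def g'_def
    by (rule M.abs_expectation_le N.abs_expectation_le; auto simp: lap_bounds)+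
  have bm [measurable]: "boundary_M x0 U \<in> borel_measurable borel" "boundary_N y0 U \<in> borel_measurable borel"
    by measurable
  have two: "\<bar>of_bool P * (lap a b - lap c d)\<bar> \<le> 2" for P a b c d
    using lap_bounds(3)[of a b] lap_bounds(3)[of c d] by (auto simp: of_bool_def)
  have bb: "\<bar>boundary_M x0 U t\<bar> \<le> 2" "\<bar>boundary_N y0 U t\<bar> \<le> 2" for t
  proof -
    show "\<bar>boundary_M x0 U t\<bar> \<le> 2"
      by (rule N.abs_expectation_le[OF _ M.abs_expectation_le(2)]) (auto simp: two)
    show "\<bar>boundary_N y0 U t\<bar> \<le> 2"
      by (rule M.abs_expectation_le[OF _ N.abs_expectation_le(2)]) (auto simp: two)
  qed
  note ints = integrable_indicator_bounded[OF fm(1) fb, of 0 U] integrable_indicator_bounded[OF fm(2) fb, of 0 U]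
    integrable_indicator_bounded[OF gm(1) gb(1), of 0 U] integrable_indicator_bounded[OF gm(2) gb(2), of 0 U]
    integrable_indicator_bounded[OF bm(1) bb(1), of 0 U] integrable_indicator_bounded[OF bm(2) bb(2), of 0 U]
  have "(\<integral>t. indicator {0..U} t * (f (U - t) t - g' t - boundary_M x0 U t) \<partial>lborel)
      = (\<integral>z. kernel U z \<partial>(time_M \<Otimes>\<^sub>M time_N))"
    using half_identity[OF dynM int] unfolding side_M f g'_def by (rule sym)
  also have "\<dots> = (\<integral>s. indicator {0..U} s * (f s (U - s) - g s - boundary_N y0 U s) \<partial>lborel)"
  proof -
    have "AE \<omega> in M. dynkin N G \<tau> (\<lambda>y. lap y (F s \<omega>)) (\<lambda>y. \<phi> (F s \<omega>) y) (lap y0 (F s \<omega>))" if "0 \<le> s" for s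
      using dynN[OF that] by (simp add: lap_commute)
    from S.half_identity[OF this int']
    have "(\<integral>z. kernel U z \<partial>(time_M \<Otimes>\<^sub>M time_N)) =
      (\<integral>s. indicator {0..U} s * (\<integral>\<omega>. of_bool (ennreal s < \<sigma> \<omega>) * ((\<integral>\<eta>. lap (F s \<omega>) (G (U - s) \<eta>) \<partial>N) - lap (F s \<omega>) y0) \<partial>M) \<partial>lborel)"
      unfolding swi by (simp add: lap_commute)
    then show ?thesis unfolding side_N f_def g_def .
  qed
  finally have "(\<integral>t. indicator {0..U} t * f (U - t) t \<partial>lborel) - (\<integral>t. indicator {0..U} t * g' t \<partial>lborel) - (\<integral>t. indicator {0..U} t * boundary_M x0 U t \<partial>lborel)
     = (\<integral>t. indicator {0..U} t * f t (U - t) \<partial>lborel) - (\<integral>t. indicator {0..U} t * g t \<partial>lborel) - (\<integral>t. indicator {0..U} t * boundary_N y0 U t \<partial>lborel)"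
    using ints by (simp add: right_diff_distrib)
  \<comment> \<open>The reflection of [0,U] exchanges the two parametrizations of the antidiagonal,
    so the terms with both processes running agree and drop out.\<close>
  moreover have "(\<integral>t. indicator {0..U} t * f t (U - t) \<partial>lborel) = (\<integral>t. indicator {0..U} t * f (U - t) t \<partial>lborel)"
  proof -
    have "(\<integral>t. indicator {0..U} t * f t (U - t) \<partial>lborel) = (\<integral>t. indicator {0..U} (U + (-1) * t) * f (U + (-1) * t) (U - (U + (-1) * t)) \<partial>lborel)"
      using lborel_integral_real_affine[of "-1" "\<lambda>t. indicator {0..U} t * f t (U - t)" U] by simp
    also have "\<dots> = (\<integral>t. indicator {0..U} t * f (U - t) t \<partial>lborel)"
      by (rule Bochner_Integration.integral_cong) (auto simp: indicator_def)
    finally show ?thesis .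
  qed
  ultimately have "(\<integral>t. indicator {0..U} t * g t \<partial>lborel) - (\<integral>t. indicator {0..U} t * g' t \<partial>lborel)
      = (\<integral>t. indicator {0..U} t * boundary_M x0 U t \<partial>lborel) - (\<integral>t. indicator {0..U} t * boundary_N y0 U t \<partial>lborel)"
    by linarith
  then show ?thesis
    using ints unfolding g_def[symmetric] g'_def[symmetric] by (simp add: right_diff_distrib)
qed

end

section \<open>Passing to the limit\<close>

text \<open>If \<open>d t\<close> were nonzero, \<open>d\<close> would stay within half of its
  modulus on some interval (t,U]. Its integral there is the difference of two vanishing integrals,
  hence 0, a contradiction.\<close>

lemma right_continuous_zero_if_integrals_zero:
  fixes d :: "real \<Rightarrow> real"
  assumes m: "d \<in> borel_measurable borel" and b: "\<And>t. \<bar>d t\<bar> \<le> C"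
    and zero: "\<And>U. 0 \<le> U \<Longrightarrow> (\<integral>s. indicator {0..U} s * d s \<partial>lborel) = 0"
    and rc: "(d \<longlongrightarrow> d t) (at_right t)" and t: "0 \<le> t"
  shows "d t = 0"
proof (rule ccontr)
  assume nz: "d t \<noteq> 0"
  note int = integrable_indicator_bounded[OF m b]
  have "\<forall>\<^sub>F r in at_right t. dist (d r) (d t) < \<bar>d t\<bar> / 2"
    by (rule tendstoD[OF rc]) (use nz in simp)
  then obtain c where c: "t < c" "\<And>r. t < r \<Longrightarrow> r < c \<Longrightarrow> \<bar>d r - d t\<bar> < \<bar>d t\<bar> / 2"
    unfolding eventually_at_right_field by (auto simp: dist_real_def)
  define U where "U = (t + c) / 2"
  have U: "t < U" "U < c" using c by (auto simp: U_def)
  have io: "integrable lborel (\<lambda>s. a * indicator {t<..U} s)" for a :: real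
    using U by (intro integrable_mult_right integrable_real_indicator) auto
  have eq: "indicator {0..U} s * d s - indicator {0..t} s * d s = indicator {t<..U} s * d s" for s
    using U t by (auto simp: indicator_def)
  have id: "integrable lborel (\<lambda>s. indicator {t<..U} s * d s)"
    using Bochner_Integration.integrable_diff[OF int[of 0 U] int[of 0 t]] unfolding eq .
  have "(\<integral>s. indicator {t<..U} s * d s \<partial>lborel) = 0"
    using Bochner_Integration.integral_diff[OF int[of 0 U] int[of 0 t]] zero[of U] zero[of t] t U unfolding eq by simp
  then have "(\<integral>s. indicator {t<..U} s * d s - d t * indicator {t<..U} s \<partial>lborel) = - (d t * (U - t))"
    using id io[of "d t"] U by simp
  then have "\<bar>d t\<bar> * (U - t) = \<bar>\<integral>s. indicator {t<..U} s * d s - d t * indicator {t<..U} s \<partial>lborel\<bar>"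
    using U by (simp add: abs_mult)
  also have "\<dots> \<le> (\<integral>s. \<bar>d t\<bar> / 2 * indicator {t<..U} s \<partial>lborel)"
  proof (rule order_trans[OF integral_abs_bound integral_mono])
    show "integrable lborel (\<lambda>s. \<bar>indicator {t<..U} s * d s - d t * indicator {t<..U} s\<bar>)"
      by (intro integrable_abs Bochner_Integration.integrable_diff id io)
    show "\<bar>indicator {t<..U} s * d s - d t * indicator {t<..U} s\<bar> \<le> \<bar>d t\<bar> / 2 * indicator {t<..U} s" for s
      using c(2)[of s] U by (auto simp: indicator_def)
  qed (rule io)
  also have "\<dots> = \<bar>d t\<bar> / 2 * (U - t)" using U by simp
  finally have "\<bar>d t\<bar> * (U - t) \<le> \<bar>d t\<bar> / 2 * (U - t)" .
  then have "\<bar>d t\<bar> \<le> \<bar>d t\<bar> / 2" by (rule mult_right_le_imp_le) (use U in simp)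
  then show False using nz by simp
qed

lemma (in prob_space) expectation_tendsto:
  fixes f :: "nat \<Rightarrow> 'a \<Rightarrow> real"
  assumes "\<And>k. f k \<in> borel_measurable M" "g \<in> borel_measurable M" "\<And>k \<omega>. \<omega> \<in> space M \<Longrightarrow> \<bar>f k \<omega>\<bar> \<le> C"
    "AE \<omega> in M. (\<lambda>k. f k \<omega>) \<longlonglongrightarrow> g \<omega>"
  shows "(\<lambda>k. \<integral>\<omega>. f k \<omega> \<partial>M) \<longlonglongrightarrow> (\<integral>\<omega>. g \<omega> \<partial>M)"
  by (rule integral_dominated_convergence[where w = "\<lambda>_. C"]) (use assms in auto)

text \<open>Bounded convergence in the inner and then in the outer variable. The exceptional null
  set in the inner variable may depend on the outer one, which is how the boundary terms are
  controlled later.\<close>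

lemma iterated_expectation_tendsto_zero:
  fixes h :: "nat \<Rightarrow> 'b \<Rightarrow> 'a \<Rightarrow> real"
  assumes "prob_space M" "prob_space N"
    and m [measurable]: "\<And>k. (\<lambda>(\<eta>, \<omega>). h k \<eta> \<omega>) \<in> borel_measurable (N \<Otimes>\<^sub>M M)" and b: "\<And>k \<eta> \<omega>. \<bar>h k \<eta> \<omega>\<bar> \<le> C"
    and lim: "AE \<eta> in N. AE \<omega> in M. (\<lambda>k. h k \<eta> \<omega>) \<longlonglongrightarrow> 0"
  shows "(\<lambda>k. \<integral>\<eta>. (\<integral>\<omega>. h k \<eta> \<omega> \<partial>M) \<partial>N) \<longlonglongrightarrow> 0"
proof -
  interpret M: prob_space M by fact
  interpret N: prob_space N by fact
  have m': "h k \<eta> \<in> borel_measurable M" if "\<eta> \<in> space N" for k \<eta>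
    using measurable_Pair2[OF m that] by simp
  have "(\<lambda>k. \<integral>\<eta>. (\<integral>\<omega>. h k \<eta> \<omega> \<partial>M) \<partial>N) \<longlonglongrightarrow> (\<integral>\<eta>. 0 \<partial>N)"
  proof (rule N.expectation_tendsto)
    show "AE \<eta> in N. (\<lambda>k. \<integral>\<omega>. h k \<eta> \<omega> \<partial>M) \<longlonglongrightarrow> 0"
      using lim AE_space
    proof eventually_elim
      case (elim \<eta>)
      have "(\<lambda>k. \<integral>\<omega>. h k \<eta> \<omega> \<partial>M) \<longlonglongrightarrow> (\<integral>\<omega>. 0 \<partial>M)"
        by (rule M.expectation_tendsto[OF m'[OF elim(2)] _ b elim(1)]) simp
      then show ?case by simp
    qed
  qed (use M.abs_expectation_le(2)[OF m' b] in auto)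
  then show ?thesis by simp
qed

lemma (in prob_space) expectation_right_continuous:
  fixes f :: "real \<Rightarrow> 'a \<Rightarrow> real"
  assumes m: "\<And>r. t \<le> r \<Longrightarrow> f r \<in> borel_measurable M" and b: "\<And>r \<omega>. \<bar>f r \<omega>\<bar> \<le> C"
    and rc: "\<And>\<omega>. \<omega> \<in> space M \<Longrightarrow> ((\<lambda>r. f r \<omega>) \<longlongrightarrow> f t \<omega>) (at_right t)"
  shows "((\<lambda>r. \<integral>\<omega>. f r \<omega> \<partial>M) \<longlongrightarrow> (\<integral>\<omega>. f t \<omega> \<partial>M)) (at_right t)"
proof (rule tendsto_at_right_sequentially[of t "t + 1"])
  fix S :: "nat \<Rightarrow> real" assume S: "\<And>n. t < S n" "S \<longlonglongrightarrow> t"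
  then have "filterlim S (at_right t) sequentially"
    by (auto simp: filterlim_at intro!: always_eventually less_imp_neq[symmetric])
  then show "(\<lambda>n. \<integral>\<omega>. f (S n) \<omega> \<partial>M) \<longlonglongrightarrow> (\<integral>\<omega>. f t \<omega> \<partial>M)"
    using S(1) by (intro expectation_tendsto[OF m m b]) (auto intro!: AE_I2 filterlim_compose[OF rc] less_imp_le)
qed simp

lemma integral_Icc_tendsto:
  fixes f :: "nat \<Rightarrow> real \<Rightarrow> real"
  assumes [measurable]: "\<And>k. f k \<in> borel_measurable borel" "g \<in> borel_measurable borel"
    and b: "\<And>k t. \<bar>f k t\<bar> \<le> C" and l: "\<And>t. 0 \<le> t \<Longrightarrow> t \<le> U \<Longrightarrow> (\<lambda>k. f k t) \<longlonglongrightarrow> g t"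
  shows "(\<lambda>k. \<integral>t. indicator {0..U} t * f k t \<partial>lborel) \<longlonglongrightarrow> (\<integral>t. indicator {0..U} t * g t \<partial>lborel)"
proof (rule integral_dominated_convergence[where w = "\<lambda>t. C * indicator {0..U} t"])
  show "integrable lborel (\<lambda>t. C * indicator {0..U} t)"
    by (intro integrable_mult_right integrable_real_indicator) (auto simp: emeasure_lborel_Icc_eq)
  show "AE t in lborel. (\<lambda>k. indicator {0..U} t * f k t) \<longlonglongrightarrow> indicator {0..U} t * g t"
    using l by (auto simp: indicator_def)
  show "AE t in lborel. norm (indicator {0..U} t * f k t) \<le> C * indicator {0..U} t" for k
    using b[of k] by (auto simp: indicator_def)
qed measurable

text \<open>All convergence is required at fixed times only: the kernel is bounded by 1, so bounded
  convergence passes through expectations and time integrals. The sign \<open>e\<close> may vary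
  with \<open>k\<close>, but not with \<open>U\<close>.\<close>

lemma duality_of_limits:
  fixes F :: "nat \<Rightarrow> real \<Rightarrow> 'a \<Rightarrow> ennreal" and G :: "nat \<Rightarrow> real \<Rightarrow> 'b \<Rightarrow> ennreal"
  assumes MX: "cadlag_process M X" and NY: "cadlag_process N Y"
    and pair: "\<And>k. stopped_pair M N (F k) (\<sigma> k) (G k) (\<tau> k) \<phi>"
    and dynM: "\<And>k t. 0 \<le> t \<Longrightarrow> AE \<eta> in N. dynkin M (F k) (\<sigma> k) (\<lambda>x. lap x (G k t \<eta>)) (\<lambda>x. \<phi> x (G k t \<eta>)) (lap x0 (G k t \<eta>))"
    and dynN: "\<And>k s. 0 \<le> s \<Longrightarrow> AE \<omega> in M. dynkin N (G k) (\<tau> k) (\<lambda>y. lap (F k s \<omega>) y) (\<lambda>y. \<phi> (F k s \<omega>) y) (lap (F k s \<omega>) y0)"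
    and fin: "\<And>k. \<exists>e. (e = 1 \<or> e = -1) \<and> (\<forall>U\<ge>0. (\<integral>\<^sup>+ t\<in>{0..U}. (\<integral>\<^sup>+ s\<in>{0..U}. (\<integral>\<^sup>+ (\<omega>, \<eta>). ennreal (max (e * \<phi> (F k s \<omega>) (G k t \<eta>)) 0) \<partial>(M \<Otimes>\<^sub>M N))
          * indicator {0..U} (s + t) \<partial>lborel) \<partial>lborel) < \<infinity>)"
    and rcX: "\<And>\<omega> t. \<omega> \<in> space M \<Longrightarrow> 0 \<le> t \<Longrightarrow> ((\<lambda>r. lap (X r \<omega>) y0) \<longlongrightarrow> lap (X t \<omega>) y0) (at_right t)"
    and rcY: "\<And>\<eta> t. \<eta> \<in> space N \<Longrightarrow> 0 \<le> t \<Longrightarrow> ((\<lambda>r. lap x0 (Y r \<eta>)) \<longlongrightarrow> lap x0 (Y t \<eta>)) (at_right t)"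
    and limX: "\<And>s. 0 \<le> s \<Longrightarrow> AE \<omega> in M. (\<lambda>k. lap (F k s \<omega>) y0) \<longlonglongrightarrow> lap (X s \<omega>) y0"
    and limY: "\<And>t. 0 \<le> t \<Longrightarrow> AE \<eta> in N. (\<lambda>k. lap x0 (G k t \<eta>)) \<longlonglongrightarrow> lap x0 (Y t \<eta>)"
    and bdM: "\<And>s t. 0 \<le> s \<Longrightarrow> 0 \<le> t \<Longrightarrow> AE \<eta> in N. AE \<omega> in M.
       (\<lambda>k. of_bool (\<tau> k \<eta> \<le> ennreal t) * (lap (F k s \<omega>) (G k t \<eta>) - lap x0 (G k t \<eta>))) \<longlonglongrightarrow> 0"
    and bdN: "\<And>s t. 0 \<le> s \<Longrightarrow> 0 \<le> t \<Longrightarrow> AE \<omega> in M. AE \<eta> in N.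
       (\<lambda>k. of_bool (\<sigma> k \<omega> \<le> ennreal s) * (lap (F k s \<omega>) (G k t \<eta>) - lap (F k s \<omega>) y0)) \<longlonglongrightarrow> 0"
    and t: "0 \<le> t"
  shows "(\<integral>\<omega>. lap (X t \<omega>) y0 \<partial>M) = (\<integral>\<eta>. lap x0 (Y t \<eta>) \<partial>N)"
proof -
  interpret M: cadlag_process M X by fact
  interpret N: cadlag_process N Y by fact
  interpret S: stopped_pair M N "F k" "\<sigma> k" "G k" "\<tau> k" \<phi> for k by (rule pair)
  note M.measurable_process [measurable] N.measurable_process [measurable]
  \<comment> \<open>Times are clipped at 0 to make \<open>d\<close> measurable on the whole
    line.\<close>
  define d where "d s = (\<integral>\<omega>. lap (X (max 0 s) \<omega>) y0 \<partial>M) - (\<integral>\<eta>. lap x0 (Y (max 0 s) \<eta>) \<partial>N)" for s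
  define f where "f k s = (\<integral>\<omega>. lap (F k s \<omega>) y0 \<partial>M) - (\<integral>\<eta>. lap x0 (G k s \<eta>) \<partial>N)" for k s
  have dm [measurable]: "d \<in> borel_measurable borel" unfolding d_def by measurable
  have fm [measurable]: "f k \<in> borel_measurable borel" for k unfolding f_def by measurable
  have Xm [measurable]: "X s \<in> borel_measurable M" if "0 \<le> s" for s by (rule M.measurable_at[OF that])
  have Ym [measurable]: "Y s \<in> borel_measurable N" if "0 \<le> s" for s by (rule N.measurable_at[OF that])
  have one: "\<bar>\<integral>\<omega>. lap (u \<omega>) y \<partial>M\<bar> \<le> 1" if "u \<in> borel_measurable M" for u y
    using that by (intro M.abs_expectation_le) (auto simp: lap_bounds)
  have one': "\<bar>\<integral>\<omega>. lap x (u \<omega>) \<partial>N\<bar> \<le> 1" if "u \<in> borel_measurable N" for u x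
    using that by (intro N.abs_expectation_le) (auto simp: lap_bounds)
  have db: "\<bar>d s\<bar> \<le> 2" for s
    using one[OF Xm, of "max 0 s" y0] one'[OF Ym, of "max 0 s" x0] unfolding d_def by simp
  have fb: "\<bar>f k s\<bar> \<le> 2" for k s
    using one[of "F k s" y0] one'[of "G k s" x0] unfolding f_def by simp
  have two: "\<bar>of_bool P * (lap a b - lap c e)\<bar> \<le> 2" for P a b c e
    using lap_bounds(3)[of a b] lap_bounds(3)[of c e] by (auto simp: of_bool_def)
  have f_lim: "(\<lambda>k. f k s) \<longlonglongrightarrow> d s" if s: "0 \<le> s" for s
  proof -
    have "(\<lambda>k. \<integral>\<omega>. lap (F k s \<omega>) y0 \<partial>M) \<longlonglongrightarrow> (\<integral>\<omega>. lap (X s \<omega>) y0 \<partial>M)"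
      by (rule M.expectation_tendsto[OF _ _ lap_bounds(3) limX[OF s]]) (use s in measurable)
    moreover have "(\<lambda>k. \<integral>\<eta>. lap x0 (G k s \<eta>) \<partial>N) \<longlonglongrightarrow> (\<integral>\<eta>. lap x0 (Y s \<eta>) \<partial>N)"
      by (rule N.expectation_tendsto[OF _ _ lap_bounds(3) limY[OF s]]) (use s in measurable)
    ultimately show ?thesis using s unfolding f_def d_def by (simp add: tendsto_diff max_def)
  qed
  have bM_lim: "(\<lambda>k. S.boundary_M k x0 U t) \<longlonglongrightarrow> 0" and bN_lim: "(\<lambda>k. S.boundary_N k y0 U t) \<longlonglongrightarrow> 0"
    if "0 \<le> t" "t \<le> U" for t U
  proof -
    have U: "0 \<le> U - t" using that by simp
    show "(\<lambda>k. S.boundary_M k x0 U t) \<longlonglongrightarrow> 0"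
      by (rule iterated_expectation_tendsto_zero[OF M.prob_space_axioms N.prob_space_axioms _ two bdM[OF U that(1)]]) measurable
    show "(\<lambda>k. S.boundary_N k y0 U t) \<longlonglongrightarrow> 0"
      by (rule iterated_expectation_tendsto_zero[OF N.prob_space_axioms M.prob_space_axioms _ two bdN[OF that(1) U]]) measurable
  qed
  have zero: "(\<integral>s. indicator {0..U} s * d s \<partial>lborel) = 0" if U: "0 \<le> U" for U
  proof -
    let ?b = "\<lambda>k t. S.boundary_M k x0 U t - S.boundary_N k y0 U t"
    have "(\<lambda>k. \<integral>s. indicator {0..U} s * f k s \<partial>lborel) \<longlonglongrightarrow> (\<integral>s. indicator {0..U} s * d s \<partial>lborel)"
      by (rule integral_Icc_tendsto[OF fm dm fb f_lim])
    moreover have "(\<lambda>k. \<integral>s. indicator {0..U} s * ?b k s \<partial>lborel) \<longlonglongrightarrow> (\<integral>s. indicator {0..U} s * (0::real) \<partial>lborel)"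
    proof (rule integral_Icc_tendsto)
      show "(\<lambda>k. ?b k t) \<longlonglongrightarrow> 0" if "0 \<le> t" "t \<le> U" for t
        using tendsto_diff[OF bM_lim[OF that] bN_lim[OF that]] by simp
      show "\<bar>?b k t\<bar> \<le> 4" for k t
      proof -
        have "\<bar>S.boundary_M k x0 U t\<bar> \<le> 2"
          by (rule N.abs_expectation_le[OF _ M.abs_expectation_le(2)]) (auto simp: two)
        moreover have "\<bar>S.boundary_N k y0 U t\<bar> \<le> 2"
          by (rule M.abs_expectation_le[OF _ N.abs_expectation_le(2)]) (auto simp: two)
        ultimately show ?thesis by linarith
      qed
    qed measurable
    moreover have "(\<integral>s. indicator {0..U} s * f k s \<partial>lborel) = (\<integral>s. indicator {0..U} s * ?b k s \<partial>lborel)" for k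
    proof -
      obtain e where e: "e = 1 \<or> e = -1" and
        fin': "\<forall>U\<ge>0. (\<integral>\<^sup>+ t\<in>{0..U}. (\<integral>\<^sup>+ s\<in>{0..U}. (\<integral>\<^sup>+ (\<omega>, \<eta>). ennreal (max (e * \<phi> (F k s \<omega>) (G k t \<eta>)) 0) \<partial>(M \<Otimes>\<^sub>M N))
          * indicator {0..U} (s + t) \<partial>lborel) \<partial>lborel) < \<infinity>"
        using fin[of k] by (elim exE conjE)
      show ?thesis
        unfolding f_def by (rule S.triangle_identity[OF dynM dynN e fin'[rule_format, OF U]])
    qed
    ultimately have "(\<lambda>k. \<integral>s. indicator {0..U} s * f k s \<partial>lborel) \<longlonglongrightarrow> (\<integral>s. indicator {0..U} s * d s \<partial>lborel)"
      "(\<lambda>k. \<integral>s. indicator {0..U} s * f k s \<partial>lborel) \<longlonglongrightarrow> (\<integral>s. indicator {0..U} s * (0::real) \<partial>lborel)"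
      by simp_all
    then show ?thesis by (simp add: LIMSEQ_unique)
  qed
  have "d t = 0"
  proof (rule right_continuous_zero_if_integrals_zero[OF dm db zero _ t])
    have rM: "((\<lambda>r. \<integral>\<omega>. lap (X r \<omega>) y0 \<partial>M) \<longlongrightarrow> (\<integral>\<omega>. lap (X t \<omega>) y0 \<partial>M)) (at_right t)"
      by (rule M.expectation_right_continuous[OF _ lap_bounds(3) rcX]) (use t in auto)
    have rN: "((\<lambda>r. \<integral>\<eta>. lap x0 (Y r \<eta>) \<partial>N) \<longlongrightarrow> (\<integral>\<eta>. lap x0 (Y t \<eta>) \<partial>N)) (at_right t)"
      by (rule N.expectation_right_continuous[OF _ lap_bounds(3) rcY]) (use t in auto)
    have "\<forall>\<^sub>F r in at_right t. (\<integral>\<omega>. lap (X r \<omega>) y0 \<partial>M) - (\<integral>\<eta>. lap x0 (Y r \<eta>) \<partial>N) = d r"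
      by (rule eventually_at_rightI[of t "t + 1"]) (use t in \<open>auto simp: d_def max_def\<close>)
    moreover have "((\<lambda>r. (\<integral>\<omega>. lap (X r \<omega>) y0 \<partial>M) - (\<integral>\<eta>. lap x0 (Y r \<eta>) \<partial>N)) \<longlongrightarrow> d t) (at_right t)"
      using tendsto_diff[OF rM rN] t by (simp add: d_def max_def)
    ultimately show "(d \<longlongrightarrow> d t) (at_right t)" by (simp add: tendsto_cong)
  qed
  then show ?thesis using t by (simp add: d_def max_def)
qed

lemma boundary_tendsto:
  fixes B :: "nat \<Rightarrow> ennreal set"
  assumes p: "cadlag p" and anti: "antimono B" and t: "0 \<le> t"
    and B: "\<And>y. (\<And>k. y k \<in> closure (B k)) \<Longrightarrow> y \<longlonglongrightarrow> z"
    and x: "u \<longlonglongrightarrow> x" "\<not> (x = 0 \<and> z = top)" "\<not> (x = top \<and> z = 0)"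
    and x0: "\<not> (x0 = 0 \<and> z = top)" "\<not> (x0 = top \<and> z = 0)" and eq: "lap x z = lap x0 z"
  shows "(\<lambda>k. of_bool (hit_time (B k) p \<le> ennreal t) *
    (lap (u k) (stop_path p (hit_time (B k) p) t) - lap x0 (stop_path p (hit_time (B k) p) t))) \<longlonglongrightarrow> 0"
proof (cases "\<exists>K. ennreal t < hit_time (B K) p")
  case True
  then obtain K where K: "ennreal t < hit_time (B K) p" by auto
  have "\<not> hit_time (B k) p \<le> ennreal t" if "K \<le> k" for k
    using less_le_trans[OF K hit_time_antimono[OF antimonoD[OF anti that]]] by (simp add: not_le)
  then show ?thesis
    by (intro tendsto_eventually eventually_sequentiallyI[of K]) auto
next
  case False
  then have le: "hit_time (B k) p \<le> ennreal t" for k by (simp add: not_less)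
  have "(\<lambda>k. stop_path p (hit_time (B k) p) t) \<longlonglongrightarrow> z"
    by (rule B) (rule stop_path_closure[OF p t le])
  then have "(\<lambda>k. lap (u k) (stop_path p (hit_time (B k) p) t) - lap x0 (stop_path p (hit_time (B k) p) t)) \<longlonglongrightarrow> lap x z - lap x0 z"
    using x x0 by (intro tendsto_diff tendsto_lap tendsto_const)
  then show ?thesis using le eq by simp
qed

text \<open>A path that was stopped at \<open>top\<close> has been absorbed there, so non-stickiness
  of the process at time \<open>s\<close> passes to the stopped process.\<close>

lemma stop_path_top:
  assumes "p \<in> cadlag_absorbed top" "0 \<le> s" "stop_path p \<sigma> s = top"
  shows "p s = top"
proof -
  have le: "enn2real (min (ennreal s) \<sigma>) \<le> s"
    using assms(2) by (metis enn2real_ennreal enn2real_mono ennreal_less_top min.cobounded1)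
  then show ?thesis
    using absorbedD[OF assms(1) _ _ le] assms(3) by (simp add: stop_path_def)
qed

section \<open>Sets shrinking to infinity and to zero\<close>

lemma closure_greaterThan_ennreal: "closure {c<..} \<subseteq> {c..}" for c :: ennreal
  by (rule closure_minimal) auto

lemma closure_lessThan_ennreal: "closure {..<c} \<subseteq> {..c}" for c :: ennreal
  by (rule closure_minimal) auto

text \<open>The successor keeps the integer levels in the range starting at 1 of the assumptions,
  and the levels of \<open>below\<close> positive, while \<open>k\<close> starts at 0.\<close>

definition above :: "nat \<Rightarrow> ennreal set" where "above k = {of_nat (Suc k)<..}"
definition below :: "nat \<Rightarrow> ennreal set" where "below k = {..<ennreal (1 / real (Suc k))}"

lemma open_above_below [simp]: "open (above k)" "open (below k)" by (auto simp: above_def below_def)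

lemma antimono_above: "antimono above"
  by (rule antimonoI) (auto simp: above_def intro: le_less_trans[rotated])

lemma antimono_below: "antimono below"
proof (rule antimonoI)
  fix j k :: nat assume "j \<le> k"
  then have "ennreal (1 / real (Suc k)) \<le> ennreal (1 / real (Suc j))"
    by (intro ennreal_leI) (auto simp: frac_le)
  then show "below k \<subseteq> below j" by (auto simp: below_def)
qed

lemma closure_above_tendsto:
  assumes "\<And>k. y k \<in> closure (above k)"
  shows "y \<longlonglongrightarrow> top"
proof (rule tendsto_sandwich)
  show "(\<lambda>k. of_nat (Suc k) :: ennreal) \<longlonglongrightarrow> top" by (rule LIMSEQ_Suc[OF of_nat_tendsto_top_ennreal])
  show "\<forall>\<^sub>F k in sequentially. of_nat (Suc k) \<le> y k"
    using assms closure_greaterThan_ennreal by (intro always_eventually) (force simp: above_def)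
qed auto

lemma inverse_Suc_tendsto: "(\<lambda>k. ennreal (1 / real (Suc k))) \<longlonglongrightarrow> 0"
  using tendsto_ennrealI[OF LIMSEQ_Suc[OF lim_1_over_n]] by simp

lemma closure_below_tendsto:
  assumes "\<And>k. y k \<in> closure (below k)"
  shows "y \<longlonglongrightarrow> 0"
proof (rule tendsto_sandwich[of "\<lambda>_. 0" y _ "\<lambda>k. ennreal (1 / real (Suc k))"])
  show "(\<lambda>k. ennreal (1 / real (Suc k))) \<longlonglongrightarrow> 0" by (rule inverse_Suc_tendsto)
  show "\<forall>\<^sub>F k in sequentially. y k \<le> ennreal (1 / real (Suc k))"
    using assms closure_lessThan_ennreal by (intro always_eventually) (force simp: below_def)
qed auto

text \<open>Such a sequence may oscillate between the two ends, so convergence is assumed. A limit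
  strictly between 0 and \<open>top\<close> has a neighbourhood that the sets eventually
  leave.\<close>

lemma closure_outside_tendsto:
  assumes y: "\<And>k. y k \<in> closure (above k \<union> below k)" and l: "y \<longlonglongrightarrow> l"
  shows "l = 0 \<or> l = top"
proof (rule ccontr)
  assume "\<not> (l = 0 \<or> l = top)"
  then have "0 < l" "l < top" by (auto simp: less_top zero_less_iff_neq_zero)
  then obtain c d where c: "0 < c" "c < l" and d: "l < d" "d < top" using dense by metis
  have "\<forall>\<^sub>F k in sequentially. ennreal (1 / real (Suc k)) < c"
    using order_tendstoD(2)[OF inverse_Suc_tendsto c(1)] .
  moreover have "\<forall>\<^sub>F k in sequentially. d < of_nat (Suc k)"
    using order_tendstoD(1)[OF LIMSEQ_Suc[OF of_nat_tendsto_top_ennreal] d(2)] .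
  moreover have "\<forall>\<^sub>F k in sequentially. c < y k" by (rule order_tendstoD(1)[OF l c(2)])
  moreover have "\<forall>\<^sub>F k in sequentially. y k < d" by (rule order_tendstoD(2)[OF l d(1)])
  ultimately have "\<forall>\<^sub>F k in sequentially. False"
  proof eventually_elim
    case (elim k)
    have "y k \<in> {of_nat (Suc k)..} \<union> {..ennreal (1 / real (Suc k))}"
      using y[of k] closure_greaterThan_ennreal[of "of_nat (Suc k)"] closure_lessThan_ennreal[of "ennreal (1 / real (Suc k))"]
      unfolding closure_Un above_def below_def by blast
    then show ?case using elim by auto
  qed
  then show False by simp
qed

section \<open>Duality of absorbed processes\<close>

context cadlag_process begin

lemma expectation_start:
  fixes f :: "ennreal \<Rightarrow> real"
  assumes "AE \<omega> in M. X 0 \<omega> = x0" "f \<in> borel_measurable borel"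
  shows "(\<integral>\<omega>. f (X 0 \<omega>) \<partial>M) = f x0"
proof -
  have [measurable]: "X 0 \<in> borel_measurable M" by (rule measurable_at) simp
  have "(\<integral>\<omega>. f (X 0 \<omega>) \<partial>M) = (\<integral>\<omega>. f x0 \<partial>M)"
    by (rule integral_cong_AE) (use assms in \<open>auto elim: eventually_mono\<close>)
  then show ?thesis by (simp add: prob_space)
qed

text \<open>The exponent 0 is excluded because that kernel function is discontinuous at \<infinity>
  and outside the domain of the generator. For the exponent \<open>top\<close> both sides are
  0.\<close>

lemma dynkin_lap:
  assumes start: "AE \<omega> in M. X 0 \<omega> = x0" and A: "open A" and y: "y \<noteq> 0"
    and mart: "y < top \<Longrightarrow> compensated_martingale M X (\<lambda>x. lap x y) g"
    and g: "g \<in> borel_measurable borel" "y < top \<Longrightarrow> \<exists>C. \<forall>x. \<bar>g x\<bar> \<le> C" "y = top \<Longrightarrow> g = (\<lambda>_. 0)"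
  shows "dynkin M (stopped X (hit A)) (hit A) (\<lambda>x. lap x y) g (lap x0 y)"
proof (cases "y = top")
  case True
  then show ?thesis using g(3) by (simp add: dynkin_def case_prod_unfold)
next
  case False
  then have yt: "y < top" by (simp add: less_top)
  obtain C where C: "\<And>x. \<bar>g x\<bar> \<le> C" using g(2)[OF yt] by blast
  have cont: "continuous_on UNIV (\<lambda>x. lap x y)"
    unfolding continuous_on_def using y False by (auto intro!: tendsto_lap tendsto_ident_at)
  have "(\<integral>\<omega>. lap (X 0 \<omega>) y \<partial>M) = lap x0 y"
    by (rule expectation_start[OF start]) measurable
  with dynkin_bounded[OF cont lap_bounds(3) g(1) C mart[OF yt] A] show ?thesis by simp
qed

text \<open>The formula with exponent 0 when \<open>\<phi>\<close> vanishes on the axis: a stopped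
  process that avoids \<open>top\<close> almost surely has kernel value 1, and so has the starting
  point, which leaves 1 - 1 = 0.\<close>

lemma dynkin_lap_zero:
  assumes \<sigma>: "\<sigma> \<in> borel_measurable M" and F: "\<And>s. 0 \<le> s \<Longrightarrow> AE \<omega> in M. stopped X \<sigma> s \<omega> \<noteq> top" and x0: "x0 \<noteq> top"
  shows "dynkin M (stopped X \<sigma>) \<sigma> (\<lambda>x. lap x 0) (\<lambda>_. 0) (lap x0 0)"
  unfolding dynkin_def
proof (intro allI impI conjI)
  fix s :: real assume s: "0 \<le> s"
  have [measurable]: "stopped X \<sigma> s \<in> borel_measurable M"
    using measurable_compose_Pair1[OF _ measurable_stopped[OF \<sigma>], of s] by simp
  have "(\<integral>\<omega>. lap (stopped X \<sigma> s \<omega>) 0 \<partial>M) = (\<integral>\<omega>. 1 \<partial>M)"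
    by (rule integral_cong_AE) (use F[OF s] in \<open>auto elim!: eventually_mono simp: lap_zero less_top\<close>)
  then show "(\<integral>\<omega>. lap (stopped X \<sigma> s \<omega>) 0 \<partial>M) - lap x0 0 =
       (\<integral>(r, \<omega>). indicator {0..s} r * of_bool (ennreal r < \<sigma> \<omega>) * 0 \<partial>(lborel \<Otimes>\<^sub>M M))"
    using x0 by (simp add: lap_zero less_top prob_space case_prod_unfold)
qed (simp add: case_prod_unfold)

text \<open>In contrast to \<open>\<phi>(x,\<cdot>)\<close> for positive \<open>x\<close>, the function \<open>\<phi>(0,\<cdot>)\<close> is unbounded; its sign replaces the bound.\<close>
lemma dynkin_unstopped_nonpos:
  assumes mart: "compensated_martingale M X f g"
    and f: "f \<in> borel_measurable borel" "\<And>x. \<bar>f x\<bar> \<le> B" and g [measurable]: "g \<in> borel_measurable borel"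
    and neg: "\<And>r. 0 \<le> r \<Longrightarrow> AE \<omega> in M. g (X r \<omega>) \<le> 0"
  shows "dynkin M (stopped X (\<lambda>_. top)) (\<lambda>_. top) f g (\<integral>\<omega>. f (X 0 \<omega>) \<partial>M)"
  unfolding dynkin_def
proof (intro allI impI)
  fix s :: real assume s: "0 \<le> s"
  interpret P: pair_sigma_finite lborel M ..
  note [measurable] = f(1) measurable_process
  define k where "k r \<omega> = indicator {0..s} r * g (X (max 0 r) \<omega>)" for r \<omega>
  have km [measurable]: "(\<lambda>(r, \<omega>). k r \<omega>) \<in> borel_measurable (lborel \<Otimes>\<^sub>M M)" unfolding k_def by measurable
  have keq: "indicator {0..s} r * of_bool (ennreal r < top) * g (stopped X (\<lambda>_. top) r \<omega>) = k r \<omega>" for r \<omega>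
    by (auto simp: k_def stopped_def at_time_def indicator_def max_def)
  have kI: "(LINT r:{0..s}|lborel. g (X r \<omega>)) = (\<integral>r. k r \<omega> \<partial>lborel)" for \<omega>
    unfolding set_lebesgue_integral_def k_def by (rule Bochner_Integration.integral_cong) (auto simp: indicator_def)
  have ki: "set_integrable lborel {0..s} (\<lambda>r. g (X r \<omega>)) \<longleftrightarrow> integrable lborel (\<lambda>r. k r \<omega>)" for \<omega>
    unfolding set_integrable_def k_def by (rule Bochner_Integration.integrable_cong) (auto simp: indicator_def)
  have Xs [measurable]: "X r \<in> borel_measurable M" if "0 \<le> r" for r by (rule measurable_at[OF that])
  have fi: "integrable M (\<lambda>\<omega>. f (X r \<omega>))" if "0 \<le> r" for r
    by (rule abs_expectation_le[OF _ f(2)]) (use that in measurable)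
  define Z where "Z t \<omega> = f (X t \<omega>) - (LINT r:{0..t}|lborel. g (X r \<omega>))" for t \<omega>
  have Z: "martingale M (natural_filtration M X) Z" and ae: "AE \<omega> in M. integrable lborel (\<lambda>r. k r \<omega>)"
    using mart s unfolding compensated_martingale_def Z_def ki[symmetric] by auto
  have Zi: "integrable M (Z t)" if "0 \<le> t" for t using Z that by (auto simp: martingale_def)
  have Z0: "Z 0 \<omega> = f (X 0 \<omega>)" for \<omega>
  proof -
    have "AE r in lborel. indicator {0..0} r *\<^sub>R g (X r \<omega>) = 0"
      using AE_lborel_singleton[of "0::real"] by eventually_elim (auto simp: indicator_def)
    then show ?thesis unfolding Z_def set_lebesgue_integral_def by (simp add: integral_eq_zero_AE)
  qed
  have "(\<integral>\<omega>. indicator (space M) \<omega> * (Z s \<omega> - Z 0 \<omega>) \<partial>M) = 0"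
    by (rule martingale_increment[OF prob_space_axioms Z]) (use s sets.top[of "natural_filtration M X 0"] in auto)
  moreover have "(\<integral>\<omega>. indicator (space M) \<omega> * (Z s \<omega> - Z 0 \<omega>) \<partial>M) = (\<integral>\<omega>. Z s \<omega> \<partial>M) - (\<integral>\<omega>. Z 0 \<omega> \<partial>M)"
    by (subst Bochner_Integration.integral_diff[symmetric]) (auto intro: Zi s intro!: Bochner_Integration.integral_cong)
  ultimately have EZ: "(\<integral>\<omega>. Z s \<omega> \<partial>M) = (\<integral>\<omega>. f (X 0 \<omega>) \<partial>M)" by (simp add: Z0)
  have I: "(\<integral>r. k r \<omega> \<partial>lborel) = f (X s \<omega>) - Z s \<omega>" for \<omega> by (simp add: Z_def kI)
  have Ii: "integrable M (\<lambda>\<omega>. \<integral>r. k r \<omega> \<partial>lborel)" unfolding I by (intro Bochner_Integration.integrable_diff fi Zi s)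
  have EI: "(\<integral>\<omega>. (\<integral>r. k r \<omega> \<partial>lborel) \<partial>M) = (\<integral>\<omega>. f (X s \<omega>) \<partial>M) - (\<integral>\<omega>. f (X 0 \<omega>) \<partial>M)"
    unfolding I using fi[OF s] Zi[OF s] EZ by simp
  have "AE \<omega> in M. k r \<omega> \<le> 0" for r
    using neg[of "max 0 r"] by (auto elim!: eventually_mono simp: k_def indicator_def)
  then have neg2: "AE r in lborel. AE \<omega> in M. k r \<omega> \<le> 0" by simp
  have set: "{x \<in> space (lborel \<Otimes>\<^sub>M M). k (fst x) (snd x) \<le> 0} \<in> sets (lborel \<Otimes>\<^sub>M M)"
  proof -
    have [measurable]: "(\<lambda>z. k (fst z) (snd z)) \<in> borel_measurable (lborel \<Otimes>\<^sub>M M)"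
      using km by (simp only: case_prod_unfold)
    show ?thesis by measurable
  qed
  \<comment> \<open>The sign is known for each time almost surely. It is needed for almost every
    path at almost every time, to be combined with the integrability of the path.\<close>
  have neg3: "AE \<omega> in M. AE r in lborel. k r \<omega> \<le> 0"
    using P.AE_commute[OF set] neg2 by simp
  have negP: "AE z in lborel \<Otimes>\<^sub>M M. k (fst z) (snd z) \<le> 0"
    by (rule P.AE_pair_measure[OF set]) (use neg2 in simp)
  \<comment> \<open>Tonelli applies thanks to the sign. The outcome is finite since the path
    integral equals \<open>f(X)\<close> minus the martingale at time \<open>s\<close>, a difference
    of integrable variables.\<close>
  have "(\<integral>\<^sup>+ z. ennreal (- k (fst z) (snd z)) \<partial>(lborel \<Otimes>\<^sub>M M)) = (\<integral>\<^sup>+ \<omega>. (\<integral>\<^sup>+ r. ennreal (- k r \<omega>) \<partial>lborel) \<partial>M)"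
    by (subst P.nn_integral_snd[symmetric]) (use km in \<open>auto simp: case_prod_beta\<close>)
  also have "\<dots> = (\<integral>\<^sup>+ \<omega>. ennreal (- (\<integral>r. k r \<omega> \<partial>lborel)) \<partial>M)"
  proof (rule nn_integral_cong_AE)
    show "AE \<omega> in M. (\<integral>\<^sup>+ r. ennreal (- k r \<omega>) \<partial>lborel) = ennreal (- (\<integral>r. k r \<omega> \<partial>lborel))"
      using ae neg3
    proof eventually_elim
      case (elim \<omega>)
      have "(\<integral>\<^sup>+ r. ennreal (- k r \<omega>) \<partial>lborel) = ennreal (\<integral>r. - k r \<omega> \<partial>lborel)"
        by (rule nn_integral_eq_integral) (use elim in \<open>auto elim: eventually_mono\<close>)
      then show ?case by simp
    qed
  qed
  also have "\<dots> < \<infinity>"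
    using Ii by (simp add: real_integrable_def less_top)
  finally have fin: "(\<integral>\<^sup>+ z. ennreal (- k (fst z) (snd z)) \<partial>(lborel \<Otimes>\<^sub>M M)) < \<infinity>" .
  have "integrable (lborel \<Otimes>\<^sub>M M) (\<lambda>z. - k (fst z) (snd z))"
    by (rule integrableI_nonneg) (use km negP fin in \<open>auto simp: case_prod_beta\<close>)
  then have int: "integrable (lborel \<Otimes>\<^sub>M M) (\<lambda>(r, \<omega>). k r \<omega>)" by (simp add: case_prod_unfold)
  have "(\<integral>(r, \<omega>). k r \<omega> \<partial>(lborel \<Otimes>\<^sub>M M)) = (\<integral>\<omega>. (\<integral>r. k r \<omega> \<partial>lborel) \<partial>M)"
    by (rule P.integral_snd[symmetric, OF int])
  then show "integrable (lborel \<Otimes>\<^sub>M M) (\<lambda>(r, \<omega>). indicator {0..s} r * of_bool (ennreal r < top) * g (stopped X (\<lambda>_. top) r \<omega>)) \<and>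
     (\<integral>\<omega>. f (stopped X (\<lambda>_. top) s \<omega>) \<partial>M) - (\<integral>\<omega>. f (X 0 \<omega>) \<partial>M) =
       (\<integral>(r, \<omega>). indicator {0..s} r * of_bool (ennreal r < top) * g (stopped X (\<lambda>_. top) r \<omega>) \<partial>(lborel \<Otimes>\<^sub>M M))"
    unfolding keq using int EI s by (simp add: stopped_def at_time_def)
qed

lemma nonstickyD:
  assumes "nonsticky M X x0 z" "x0 \<noteq> z" "0 \<le> t"
  shows "AE \<omega> in M. X t \<omega> \<noteq> z"
proof -
  have [measurable]: "X t \<in> borel_measurable M" by (rule measurable_at) fact
  have "{\<omega> \<in> space M. X t \<omega> \<noteq> z} \<in> sets M" by measurable
  then show ?thesis
    using assms prob_Collect_eq_1[of "\<lambda>\<omega>. X t \<omega> \<noteq> z"] by (simp add: nonsticky_def)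
qed

end

text \<open>The interface between symbols and processes: from here on only the measurability of
  \<open>\<phi>\<close>, its bounds in one variable at interior values of the other, and the two
  families of martingales are used, besides starting points, absorption and the values at
  \<open>top\<close>.\<close>

locale dual_processes = MX: cadlag_process M X + NY: cadlag_process N Y
  for M :: "'a measure" and X and N :: "'b measure" and Y +
  fixes \<phi> :: "ennreal \<Rightarrow> ennreal \<Rightarrow> real" and x0 y0 :: ennreal
  assumes measurable_\<phi>: "(\<lambda>(x, y). \<phi> x y) \<in> borel_measurable (borel \<Otimes>\<^sub>M borel)"
    and X_absorbed: "\<And>\<omega>. \<omega> \<in> space M \<Longrightarrow> (\<lambda>t. X t \<omega>) \<in> cadlag_absorbed top"
    and Y_absorbed: "\<And>\<eta>. \<eta> \<in> space N \<Longrightarrow> (\<lambda>t. Y t \<eta>) \<in> cadlag_absorbed top"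
    and X_start: "AE \<omega> in M. X 0 \<omega> = x0" and Y_start: "AE \<eta> in N. Y 0 \<eta> = y0"
    and \<phi>_top [simp]: "\<And>y. \<phi> top y = 0" "\<And>x. \<phi> x top = 0"
    and \<phi>_bounded_left: "\<And>y. 0 < y \<Longrightarrow> y < top \<Longrightarrow> \<exists>C. \<forall>x. \<bar>\<phi> x y\<bar> \<le> C"
    and \<phi>_bounded_right: "\<And>x. 0 < x \<Longrightarrow> x < top \<Longrightarrow> \<exists>C. \<forall>y. \<bar>\<phi> x y\<bar> \<le> C"
    and X_martingale: "\<And>y. 0 < y \<Longrightarrow> y < top \<Longrightarrow> compensated_martingale M X (\<lambda>x. lap x y) (\<lambda>x. \<phi> x y)"
    and Y_martingale: "\<And>x. 0 < x \<Longrightarrow> x < top \<Longrightarrow> compensated_martingale N Y (\<lambda>y. lap x y) (\<lambda>y. \<phi> x y)"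
begin

abbreviation stopped_X :: "ennreal set \<Rightarrow> real \<Rightarrow> 'a \<Rightarrow> ennreal" where
  "stopped_X A \<equiv> stopped X (MX.hit A)"

abbreviation stopped_Y :: "ennreal set \<Rightarrow> real \<Rightarrow> 'b \<Rightarrow> ennreal" where
  "stopped_Y A \<equiv> stopped Y (NY.hit A)"

abbreviation dynkin_X :: "ennreal set \<Rightarrow> ennreal \<Rightarrow> bool" where
  "dynkin_X A y \<equiv> dynkin M (stopped_X A) (MX.hit A) (\<lambda>x. lap x y) (\<lambda>x. \<phi> x y) (lap x0 y)"

abbreviation dynkin_Y :: "ennreal set \<Rightarrow> ennreal \<Rightarrow> bool" where
  "dynkin_Y A x \<equiv> dynkin N (stopped_Y A) (NY.hit A) (lap x) (\<phi> x) (lap x y0)"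

lemma measurable_\<phi>_left: "(\<lambda>x. \<phi> x y) \<in> borel_measurable borel"
  using measurable_Pair1[OF measurable_\<phi>, of y] by simp

lemma measurable_\<phi>_right: "\<phi> x \<in> borel_measurable borel"
  using measurable_Pair2[OF measurable_\<phi>, of x] by simp

lemma dynkin_X_nonzero:
  assumes "open A" "y \<noteq> 0"
  shows "dynkin_X A y"
  by (rule MX.dynkin_lap[OF X_start assms])
     (use assms in \<open>auto intro: X_martingale \<phi>_bounded_left measurable_\<phi>_left simp: zero_less_iff_neq_zero\<close>)

lemma dynkin_Y_nonzero:
  assumes "open A" "x \<noteq> 0"
  shows "dynkin_Y A x"
proof -
  have "compensated_martingale N Y (\<lambda>y. lap y x) (\<phi> x)" if "x < top"
    using Y_martingale[of x] that assms(2) by (simp add: lap_commute[of _ x] zero_less_iff_neq_zero)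
  then have "dynkin N (stopped_Y A) (NY.hit A) (\<lambda>y. lap y x) (\<phi> x) (lap y0 x)"
    by (rule NY.dynkin_lap[OF Y_start assms])
       (use assms in \<open>auto intro: \<phi>_bounded_right measurable_\<phi>_right simp: zero_less_iff_neq_zero\<close>)
  then show ?thesis by (simp add: lap_commute[of _ x])
qed

text \<open>Frozen values other than 0 satisfy Dynkin's formula by boundedness. Only the exponent 0
  is left to the individual cases, as an implication that is void whenever the stopped process
  almost surely avoids 0.\<close>

lemma duality:
  assumes A: "\<And>k. open (A k)" and B: "\<And>k. open (B k)"
    and cond: "\<And>k. cond_A M N \<phi> X Y (MX.hit (A k)) (NY.hit (B k))"
    and dynM: "\<And>k t. 0 \<le> t \<Longrightarrow> AE \<eta> in N. stopped_Y (B k) t \<eta> = 0 \<longrightarrow>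
      dynkin_X (A k) 0"
    and dynN: "\<And>k s. 0 \<le> s \<Longrightarrow> AE \<omega> in M. stopped_X (A k) s \<omega> = 0 \<longrightarrow>
      dynkin_Y (B k) 0"
    and limX: "\<And>s. 0 \<le> s \<Longrightarrow> AE \<omega> in M. (\<lambda>k. lap (stopped_X (A k) s \<omega>) y0) \<longlonglongrightarrow> lap (X s \<omega>) y0"
    and limY: "\<And>t. 0 \<le> t \<Longrightarrow> AE \<eta> in N. (\<lambda>k. lap x0 (stopped_Y (B k) t \<eta>)) \<longlonglongrightarrow> lap x0 (Y t \<eta>)"
    and bdM: "\<And>s t. 0 \<le> s \<Longrightarrow> 0 \<le> t \<Longrightarrow> AE \<eta> in N. AE \<omega> in M.
       (\<lambda>k. of_bool (NY.hit (B k) \<eta> \<le> ennreal t) * (lap (stopped_X (A k) s \<omega>) (stopped_Y (B k) t \<eta>)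
          - lap x0 (stopped_Y (B k) t \<eta>))) \<longlonglongrightarrow> 0"
    and bdN: "\<And>s t. 0 \<le> s \<Longrightarrow> 0 \<le> t \<Longrightarrow> AE \<omega> in M. AE \<eta> in N.
       (\<lambda>k. of_bool (MX.hit (A k) \<omega> \<le> ennreal s) * (lap (stopped_X (A k) s \<omega>) (stopped_Y (B k) t \<eta>)
          - lap (stopped_X (A k) s \<omega>) y0)) \<longlonglongrightarrow> 0"
    and t: "0 \<le> t"
  shows "(\<integral>\<omega>. lap (X t \<omega>) y0 \<partial>M) = (\<integral>\<eta>. lap x0 (Y t \<eta>) \<partial>N)"
proof (rule duality_of_limits[OF MX.cadlag_process_axioms NY.cadlag_process_axioms _ _ _ _ _ _ limX limY bdM bdN t])
  show "stopped_pair M N (stopped_X (A k)) (MX.hit (A k)) (stopped_Y (B k)) (NY.hit (B k)) \<phi>" for k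
    by unfold_locales (intro MX.measurable_stopped NY.measurable_stopped MX.measurable_hit NY.measurable_hit A B measurable_\<phi>)+
  show "AE \<eta> in N. dynkin M (stopped_X (A k)) (MX.hit (A k)) (\<lambda>x. lap x (stopped_Y (B k) t \<eta>))
      (\<lambda>x. \<phi> x (stopped_Y (B k) t \<eta>)) (lap x0 (stopped_Y (B k) t \<eta>))" if "0 \<le> t" for k t
    using dynM[OF that, of k]
  proof eventually_elim
    case (elim \<eta>)
    then show ?case using dynkin_X_nonzero[OF A, of "stopped_Y (B k) t \<eta>" k]
      by (cases "stopped_Y (B k) t \<eta> = 0") auto
  qed
  show "AE \<omega> in M. dynkin N (stopped_Y (B k)) (NY.hit (B k)) (\<lambda>y. lap (stopped_X (A k) s \<omega>) y)
      (\<lambda>y. \<phi> (stopped_X (A k) s \<omega>) y) (lap (stopped_X (A k) s \<omega>) y0)" if "0 \<le> s" for k s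
    using dynN[OF that, of k]
  proof eventually_elim
    case (elim \<omega>)
    then show ?case using dynkin_Y_nonzero[OF B, of "stopped_X (A k) s \<omega>" k]
      by (cases "stopped_X (A k) s \<omega> = 0") auto
  qed
  show "\<exists>e. (e = 1 \<or> e = -1) \<and> (\<forall>U\<ge>0. (\<integral>\<^sup>+ t\<in>{0..U}. (\<integral>\<^sup>+ s\<in>{0..U}. (\<integral>\<^sup>+ (\<omega>, \<eta>). ennreal (max (e * \<phi> (stopped_X (A k) s \<omega>) (stopped_Y (B k) t \<eta>)) 0) \<partial>(M \<Otimes>\<^sub>M N))
          * indicator {0..U} (s + t) \<partial>lborel) \<partial>lborel) < \<infinity>)" for k
    using cond[of k] unfolding cond_A_def
  proof (elim disjE, goal_cases)
    case 1
    then show ?case by (intro exI[of _ 1]) (simp only: mult_1_left simp_thms)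
  next
    case 2
    then show ?case by (intro exI[of _ "-1"]) (simp only: mult_minus1 simp_thms)
  qed
  show "((\<lambda>r. lap (X r \<omega>) y0) \<longlongrightarrow> lap (X t \<omega>) y0) (at_right t)" if "\<omega> \<in> space M" "0 \<le> t" for \<omega> t
    by (rule lap_right_continuous[OF X_absorbed[OF that(1)] that(2)])
  show "((\<lambda>r. lap x0 (Y r \<eta>)) \<longlongrightarrow> lap x0 (Y t \<eta>)) (at_right t)" if "\<eta> \<in> space N" "0 \<le> t" for \<eta> t
    using lap_right_continuous[OF Y_absorbed[OF that(1)] that(2), of x0] by (simp add: lap_commute)
qed

section \<open>The four cases\<close>

lemma hit_empty [simp]: "MX.hit {} = (\<lambda>_. top)" "NY.hit {} = (\<lambda>_. top)"
  by (simp_all add: fun_eq_iff)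

lemma stopped_top: "0 \<le> s \<Longrightarrow> stopped X (\<lambda>_. top) s \<omega> = X s \<omega>" "0 \<le> s \<Longrightarrow> stopped Y (\<lambda>_. top) s \<eta> = Y s \<eta>"
  by (simp_all add: stopped_def at_time_def)

text \<open>The empty set is never hit, so nothing is stopped and the boundary terms vanish
  identically. With exponent 0, the formula for \<open>X\<close> is void as \<open>Y\<close> avoids
  0, and the one for \<open>Y\<close> comes from the assumed martingale.\<close>

lemma duality_I:
  assumes cond: "cond_A M N \<phi> X Y (\<lambda>_. top) (\<lambda>_. top)"
    and mart: "compensated_martingale N Y (indicator {y. y < \<infinity>}) (\<phi> 0)"
    and ns: "nonsticky N Y y0 0" "y0 > 0"
    and neg: "\<And>y. 0 < y \<Longrightarrow> y < top \<Longrightarrow> \<phi> 0 y \<le> 0"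
    and t: "0 \<le> t"
  shows "(\<integral>\<omega>. lap (X t \<omega>) y0 \<partial>M) = (\<integral>\<eta>. lap x0 (Y t \<eta>) \<partial>N)"
proof (rule duality[of "\<lambda>_. {}" "\<lambda>_. {}", OF _ _ _ _ _ _ _ _ _ t]; (simp only: hit_empty)?)
  have Yn: "AE \<eta> in N. Y r \<eta> \<noteq> 0" if "0 \<le> r" for r
    by (rule NY.nonstickyD[OF ns(1) _ that]) (use ns in auto)
  show "cond_A M N \<phi> X Y (\<lambda>_. top) (\<lambda>_. top)" by (rule cond)
  show "AE \<eta> in N. stopped Y (\<lambda>_. top) t \<eta> = 0 \<longrightarrow>
      dynkin M (stopped X (\<lambda>_. top)) (\<lambda>_. top) (\<lambda>x. lap x 0) (\<lambda>x. \<phi> x 0) (lap x0 0)" if "0 \<le> t" for t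
    using Yn[OF that] by eventually_elim (simp add: stopped_top that)
  have l0: "lap 0 = indicator {y. y < \<infinity>}" by (auto simp: fun_eq_iff lap_zero indicator_def)
  have "dynkin N (stopped Y (\<lambda>_. top)) (\<lambda>_. top) (lap 0) (\<phi> 0) (\<integral>\<eta>. lap 0 (Y 0 \<eta>) \<partial>N)"
  proof (rule NY.dynkin_unstopped_nonpos[OF _ _ lap_bounds(3)])
    show "compensated_martingale N Y (lap 0) (\<phi> 0)" unfolding l0 by (rule mart)
    show "AE \<eta> in N. \<phi> 0 (Y r \<eta>) \<le> 0" if "0 \<le> r" for r
      using Yn[OF that]
    proof eventually_elim
      case (elim \<eta>)
      then show ?case using neg[of "Y r \<eta>"] by (cases "Y r \<eta> = top") (auto simp: less_top zero_less_iff_neq_zero)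
    qed
  qed (use measurable_\<phi>_right in measurable)
  then have "dynkin N (stopped Y (\<lambda>_. top)) (\<lambda>_. top) (lap 0) (\<phi> 0) (lap 0 y0)"
    using NY.expectation_start[OF Y_start, of "lap 0"] by simp
  then show "AE \<omega> in M. stopped X (\<lambda>_. top) s \<omega> = 0 \<longrightarrow>
      dynkin N (stopped Y (\<lambda>_. top)) (\<lambda>_. top) (lap 0) (\<phi> 0) (lap 0 y0)" for s
    by simp
qed (auto simp: stopped_top top_unique)

lemma X_cadlag: "\<omega> \<in> space M \<Longrightarrow> cadlag (\<lambda>t. X t \<omega>)"
  and Y_cadlag: "\<eta> \<in> space N \<Longrightarrow> cadlag (\<lambda>t. Y t \<eta>)"
  by (rule MX.cadlag_paths NY.cadlag_paths; assumption)+

text \<open>Up to the hit the value is \<open>p s\<close>; afterwards it is frozen at a level of at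
  least k + 1.\<close>

lemma stop_path_above_nonzero:
  assumes "cadlag p" "0 \<le> s" "p s \<noteq> 0"
  shows "stop_path p (hit_time (above k) p) s \<noteq> 0"
proof (cases "ennreal s < hit_time (above k) p")
  case True
  then show ?thesis using assms by (simp add: stop_path_before)
next
  case False
  then have "stop_path p (hit_time (above k) p) s \<in> closure (above k)"
    using assms by (intro stop_path_closure) (auto simp: not_less)
  then have "of_nat (Suc k) \<le> stop_path p (hit_time (above k) p) s"
    using closure_greaterThan_ennreal by (auto simp: above_def)
  then show ?thesis by (metis le_zero_eq of_nat_eq_0_iff nat.distinct(1))
qed

text \<open>The common core of (II), with \<open>z = top\<close> and \<open>w = 0\<close>, and (IV),
  with \<open>z = 0\<close> and \<open>w = top\<close>. Absorption makes the stopped processes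
  converge, and avoiding the opposite end \<open>w\<close> keeps the kernel off its corners. In the
  boundary terms one argument tends to \<open>z\<close>, where the kernel does not depend on the
  other: it is 0 for \<open>z = top\<close> and 1 for \<open>z = 0\<close>.\<close>

lemma duality_absorbing:
  assumes zw: "z = 0 \<and> w = top \<or> z = top \<and> w = 0"
    and A: "\<And>k. open (A k)" "antimono A" "\<And>y. (\<And>k. y k \<in> closure (A k)) \<Longrightarrow> y \<longlonglongrightarrow> z"
    and X: "\<And>\<omega>. \<omega> \<in> space M \<Longrightarrow> (\<lambda>t. X t \<omega>) \<in> cadlag_absorbed z"
    and Y: "\<And>\<eta>. \<eta> \<in> space N \<Longrightarrow> (\<lambda>t. Y t \<eta>) \<in> cadlag_absorbed z"
    and ns: "nonsticky M X x0 w" "nonsticky N Y y0 w" "x0 \<noteq> w" "y0 \<noteq> w"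
    and cond: "\<And>k. cond_A M N \<phi> X Y (MX.hit (A k)) (NY.hit (A k))"
    and dynM: "\<And>k t. 0 \<le> t \<Longrightarrow> AE \<eta> in N. stopped_Y (A k) t \<eta> = 0 \<longrightarrow>
      dynkin_X (A k) 0"
    and dynN: "\<And>k s. 0 \<le> s \<Longrightarrow> AE \<omega> in M. stopped_X (A k) s \<omega> = 0 \<longrightarrow>
      dynkin_Y (A k) 0"
    and t: "0 \<le> t"
  shows "(\<integral>\<omega>. lap (X t \<omega>) y0 \<partial>M) = (\<integral>\<eta>. lap x0 (Y t \<eta>) \<partial>N)"
proof (rule duality[of A A, OF A(1) A(1) cond dynM dynN _ _ _ _ t])
  have Xn: "AE \<omega> in M. X r \<omega> \<noteq> w" if "0 \<le> r" for r by (rule MX.nonstickyD[OF ns(1,3) that])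
  have Yn: "AE \<eta> in N. Y r \<eta> \<noteq> w" if "0 \<le> r" for r by (rule NY.nonstickyD[OF ns(2,4) that])
  have limX: "(\<lambda>k. stopped_X (A k) s \<omega>) \<longlonglongrightarrow> X s \<omega>" if "0 \<le> s" "\<omega> \<in> space M" for s \<omega>
    unfolding MX.stopped_eq_stop_path by (rule stop_path_absorbed_tendsto[OF X[OF that(2)] A(2,3) that(1)])
  have limY: "(\<lambda>k. stopped_Y (A k) s \<omega>) \<longlonglongrightarrow> Y s \<omega>" if "0 \<le> s" "\<omega> \<in> space N" for s \<omega>
    unfolding NY.stopped_eq_stop_path by (rule stop_path_absorbed_tendsto[OF Y[OF that(2)] A(2,3) that(1)])
  show "AE \<omega> in M. (\<lambda>k. lap (stopped_X (A k) s \<omega>) y0) \<longlonglongrightarrow> lap (X s \<omega>) y0" if "0 \<le> s" for s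
    using Xn[OF that] AE_space
    by eventually_elim (use ns zw in \<open>auto intro!: tendsto_lap limX that\<close>)
  show "AE \<eta> in N. (\<lambda>k. lap x0 (stopped_Y (A k) s \<eta>)) \<longlonglongrightarrow> lap x0 (Y s \<eta>)" if "0 \<le> s" for s
    using Yn[OF that] AE_space
    by eventually_elim (use ns zw in \<open>auto intro!: tendsto_lap limY that\<close>)
  fix s t :: real assume st: "0 \<le> s" "0 \<le> t"
  show "AE \<eta> in N. AE \<omega> in M. (\<lambda>k. of_bool (NY.hit (A k) \<eta> \<le> ennreal t) *
      (lap (stopped_X (A k) s \<omega>) (stopped_Y (A k) t \<eta>) - lap x0 (stopped_Y (A k) t \<eta>))) \<longlonglongrightarrow> 0"
  proof (rule AE_I2)
    fix \<eta> assume \<eta>: "\<eta> \<in> space N"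
    show "AE \<omega> in M. (\<lambda>k. of_bool (NY.hit (A k) \<eta> \<le> ennreal t) *
        (lap (stopped_X (A k) s \<omega>) (stopped_Y (A k) t \<eta>) - lap x0 (stopped_Y (A k) t \<eta>))) \<longlonglongrightarrow> 0"
      using Xn[OF st(1)] AE_space
    proof eventually_elim
      case (elim \<omega>)
      show ?case
        unfolding NY.stopped_eq_stop_path
        by (rule boundary_tendsto[OF Y_cadlag[OF \<eta>] A(2) st(2) A(3) limX[OF st(1) elim(2)]])
           (use elim ns zw in \<open>auto simp: lap_zero less_top\<close>)
    qed
  qed
  show "AE \<omega> in M. AE \<eta> in N. (\<lambda>k. of_bool (MX.hit (A k) \<omega> \<le> ennreal s) *
      (lap (stopped_X (A k) s \<omega>) (stopped_Y (A k) t \<eta>) - lap (stopped_X (A k) s \<omega>) y0)) \<longlonglongrightarrow> 0"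
  proof (rule AE_I2)
    fix \<omega> assume \<omega>: "\<omega> \<in> space M"
    show "AE \<eta> in N. (\<lambda>k. of_bool (MX.hit (A k) \<omega> \<le> ennreal s) *
        (lap (stopped_X (A k) s \<omega>) (stopped_Y (A k) t \<eta>) - lap (stopped_X (A k) s \<omega>) y0)) \<longlonglongrightarrow> 0"
      using Yn[OF st(2)] AE_space
    proof eventually_elim
      case (elim \<eta>)
      show ?case
        unfolding MX.stopped_eq_stop_path lap_commute[of "stop_path _ _ _"]
        by (rule boundary_tendsto[OF X_cadlag[OF \<omega>] A(2) st(1) A(3) limY[OF st(2) elim(2)]])
           (use elim ns zw in \<open>auto simp: lap_zero less_top\<close>)
    qed
  qed
qed

lemma duality_II:
  assumes cond: "\<And>k. cond_A M N \<phi> X Y (MX.hit (above k)) (NY.hit (above k))"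
    and ns: "nonsticky M X x0 0" "nonsticky N Y y0 0" "x0 > 0" "y0 > 0"
    and t: "0 \<le> t"
  shows "(\<integral>\<omega>. lap (X t \<omega>) y0 \<partial>M) = (\<integral>\<eta>. lap x0 (Y t \<eta>) \<partial>N)"
proof (rule duality_absorbing[OF _ _ antimono_above closure_above_tendsto X_absorbed Y_absorbed ns(1,2) _ _ cond _ _ t])
  have ns': "x0 \<noteq> 0" "y0 \<noteq> 0" using ns by auto
  show "AE \<eta> in N. stopped_Y (above k) t \<eta> = 0 \<longrightarrow>
      dynkin_X (above k) 0" if "0 \<le> t" for t k
    using NY.nonstickyD[OF ns(2) ns'(2) that] AE_space
    by eventually_elim (simp add: NY.stopped_eq_stop_path stop_path_above_nonzero Y_cadlag that)
  show "AE \<omega> in M. stopped_X (above k) s \<omega> = 0 \<longrightarrow>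
      dynkin_Y (above k) 0" if "0 \<le> s" for s k
    using MX.nonstickyD[OF ns(1) ns'(1) that] AE_space
    by eventually_elim (simp add: MX.stopped_eq_stop_path stop_path_above_nonzero X_cadlag that)
qed (use ns in auto)

text \<open>Non-stickiness at \<open>top\<close> says nothing for a process started there, so these
  starting points are treated apart. Absorption and the convention for the kernel make both sides
  0.\<close>

lemma duality_start_top:
  assumes "x0 = top \<or> y0 = top" "0 \<le> t"
  shows "(\<integral>\<omega>. lap (X t \<omega>) y0 \<partial>M) = (\<integral>\<eta>. lap x0 (Y t \<eta>) \<partial>N)"
proof -
  have "AE \<omega> in M. lap (X t \<omega>) y0 = 0"
    using X_start AE_space
    by eventually_elim (use absorbedD[OF X_absorbed, of _ 0 t] assms in auto)
  moreover have "AE \<eta> in N. lap x0 (Y t \<eta>) = 0"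
    using Y_start AE_space
    by eventually_elim (use absorbedD[OF Y_absorbed, of _ 0 t] assms in auto)
  ultimately show ?thesis by (simp add: integral_eq_zero_AE)
qed

text \<open>The limit \<open>x \<rightarrow> 0+\<close> of \<open>dynkin_Y_nonzero\<close>.\<close>
lemma dynkin_zero_Y:
  assumes B: "open B" and sub: "UNIV - {ennreal e..ennreal n} \<subseteq> B" and e: "0 < e"
    and cont: "\<And>y. y < top \<Longrightarrow> isCont (\<lambda>x. \<phi> x y) 0"
    and bd: "\<And>m n e :: real. m > 0 \<Longrightarrow> n > 0 \<Longrightarrow> e > 0 \<Longrightarrow>
          bdd_above ((\<lambda>(x, y). \<bar>\<phi> x y\<bar>) ` ({0..ennreal m} \<times> {ennreal e<..<ennreal n}))"
  shows "dynkin_Y B 0"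
  unfolding dynkin_def
proof (intro allI impI conjI)
  fix s :: real assume s: "0 \<le> s"
  \<comment> \<open>An open interval around [e,n], slightly enlarged because the boundedness
    assumption concerns open intervals; the maximum with 1 keeps its upper end positive.\<close>
  define J where "J = {ennreal (e / 2)<..<ennreal (max 1 (n + 1))}"
  obtain C where C: "\<And>x y. x \<le> 1 \<Longrightarrow> y \<in> J \<Longrightarrow> \<bar>\<phi> x y\<bar> \<le> C"
    using bd[of 1 "max 1 (n + 1)" "e / 2"] e unfolding bdd_above_def J_def by fastforce
  define C' where "C' = max C 0"
  \<comment> \<open>Cutting \<open>\<phi>\<close> off outside \<open>J\<close> makes it bounded
    uniformly in x \<le> 1. Before the hit the process lies in [e,n], so Dynkin's formula does not
    see the cut.\<close>
  define g where "g x y = indicator J y * \<phi> x y" for x y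
  have gb: "\<bar>g x y\<bar> \<le> C'" if "x \<le> 1" for x y
    using C[OF that, of y] by (auto simp: g_def C'_def indicator_def)
  have gm: "g x \<in> borel_measurable borel" for x
    unfolding g_def J_def using measurable_\<phi>_right by measurable
  have alive: "of_bool (ennreal r < NY.hit B \<eta>) * g x (stopped_Y B r \<eta>) = of_bool (ennreal r < NY.hit B \<eta>) * \<phi> x (stopped_Y B r \<eta>)"
    if r: "0 \<le> r" for r \<eta> x
  proof (cases "ennreal r < NY.hit B \<eta>")
    case True
    then have "stopped_Y B r \<eta> = Y r \<eta>" using r by (simp add: NY.stopped_eq_stop_path stop_path_before)
    moreover have "Y r \<eta> \<notin> B" using hit_time_le[of r "\<lambda>t. Y t \<eta>" B] True r by (auto simp: not_le)
    then have "ennreal e \<le> Y r \<eta>" "Y r \<eta> \<le> ennreal n" using sub by auto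
    moreover have "ennreal (e / 2) < ennreal e" using e by (simp add: ennreal_less_iff)
    moreover have "ennreal n < ennreal (max 1 (n + 1))"
      by (cases "0 \<le> n") (auto simp: ennreal_less_iff ennreal_neg)
    ultimately have "stopped_Y B r \<eta> \<in> J" unfolding J_def by (auto intro: less_le_trans le_less_trans)
    then show ?thesis by (simp add: g_def)
  qed simp
  let ?k = "\<lambda>x (r, \<eta>). indicator {0..s} r * of_bool (ennreal r < NY.hit B \<eta>) * \<phi> x (stopped_Y B r \<eta>)"
  let ?h = "\<lambda>x (r, \<eta>). indicator {0..s} r * of_bool (ennreal r < NY.hit B \<eta>) * g x (stopped_Y B r \<eta>)"
  have kh: "?k x = ?h x" for x
  proof (rule ext)
    fix z :: "real \<times> 'b"
    obtain r \<eta> where z: "z = (r, \<eta>)" by (cases z)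
    show "?k x z = ?h x z"
    proof (cases "r \<in> {0..s}")
      case True
      then have "0 \<le> r" by simp
      from alive[OF this] show ?thesis by (simp add: z mult.assoc)
    qed (simp add: z)
  qed
  note hm = NY.measurable_hit[OF B]
  have int: "integrable (lborel \<Otimes>\<^sub>M N) (?h x)" if "x \<le> 1" for x
    by (rule NY.integrable_alive_bounded[OF hm gm gb[OF that]])
  show "integrable (lborel \<Otimes>\<^sub>M N) (?k 0)" unfolding kh by (rule int) simp
  \<comment> \<open>Positive exponents, for which the formula is known, that tend to 0 within the
    range x \<le> 1 of the uniform bound.\<close>
  define x where "x j = ennreal (1 / real (Suc j))" for j
  have x: "x \<longlonglongrightarrow> 0" "x j \<noteq> 0" "x j \<le> 1" for j
  proof -
    show "x \<longlonglongrightarrow> 0" unfolding x_def by (rule inverse_Suc_tendsto)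
    show "x j \<noteq> 0" by (simp add: x_def ennreal_eq_0_iff)
    show "x j \<le> 1" unfolding x_def ennreal_1[symmetric] by (rule ennreal_leI) simp
  qed
  have eq: "(\<integral>\<eta>. lap (x j) (stopped_Y B s \<eta>) \<partial>N) - lap (x j) y0 = (\<integral>z. ?h (x j) z \<partial>(lborel \<Otimes>\<^sub>M N))" for j
  proof -
    have "(\<integral>\<eta>. lap (x j) (stopped_Y B s \<eta>) \<partial>N) - lap (x j) y0 = integral\<^sup>L (lborel \<Otimes>\<^sub>M N) (?k (x j))"
      by (rule conjunct2[OF dynkin_Y_nonzero[OF B x(2)[of j], unfolded dynkin_def, rule_format, OF s]])
    then show ?thesis by (simp only: kh)
  qed
  have lap0: "(\<lambda>j. lap (x j) y) \<longlonglongrightarrow> lap 0 y" for y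
    by (cases "y = top") (auto intro!: tendsto_lap x(1))
  have [measurable]: "stopped_Y B s \<in> borel_measurable N"
    using measurable_compose_Pair1[OF _ NY.measurable_stopped[OF hm], of s] by simp
  have "(\<lambda>j. (\<integral>\<eta>. lap (x j) (stopped_Y B s \<eta>) \<partial>N) - lap (x j) y0) \<longlonglongrightarrow> (\<integral>\<eta>. lap 0 (stopped_Y B s \<eta>) \<partial>N) - lap 0 y0"
    by (intro tendsto_diff lap0 NY.expectation_tendsto[OF _ _ lap_bounds(3)]) (auto intro: lap0)
  moreover have "(\<lambda>j. \<integral>z. ?h (x j) z \<partial>(lborel \<Otimes>\<^sub>M N)) \<longlonglongrightarrow> (\<integral>z. ?h 0 z \<partial>(lborel \<Otimes>\<^sub>M N))"
  proof (rule integral_dominated_convergence)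
    show "integrable (lborel \<Otimes>\<^sub>M N) (\<lambda>(r, \<eta>). indicator {0..s} r * of_bool (ennreal r < NY.hit B \<eta>) * C')"
      by (rule NY.integrable_alive_bounded[OF hm, of "\<lambda>_. C'" C']) (auto simp: C'_def)
    show "?h 0 \<in> borel_measurable (lborel \<Otimes>\<^sub>M N)" by (rule borel_measurable_integrable[OF int]) simp
    show "?h (x j) \<in> borel_measurable (lborel \<Otimes>\<^sub>M N)" for j by (rule borel_measurable_integrable[OF int[OF x(3)]])
    have g0: "(\<lambda>j. g (x j) y) \<longlonglongrightarrow> g 0 y" for y
    proof (cases "y = top")
      case False
      then have "(\<lambda>j. \<phi> (x j) y) \<longlonglongrightarrow> \<phi> 0 y"
        using isCont_tendsto_compose[OF cont x(1)] by (simp add: less_top)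
      then show ?thesis unfolding g_def by (intro tendsto_mult tendsto_const)
    qed (simp add: g_def)
    show "AE z in lborel \<Otimes>\<^sub>M N. (\<lambda>j. ?h (x j) z) \<longlonglongrightarrow> ?h 0 z"
      by (intro always_eventually allI) (auto simp: case_prod_unfold intro!: tendsto_mult tendsto_const g0)
    show "AE z in lborel \<Otimes>\<^sub>M N. norm (?h (x j) z) \<le> (\<lambda>(r, \<eta>). indicator {0..s} r * of_bool (ennreal r < NY.hit B \<eta>) * C') z" for j
      using gb[OF x(3), of j] by (intro always_eventually allI) (auto simp: indicator_def)
  qed
  ultimately have "(\<integral>\<eta>. lap 0 (stopped_Y B s \<eta>) \<partial>N) - lap 0 y0 = (\<integral>z. ?h 0 z \<partial>(lborel \<Otimes>\<^sub>M N))"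
    unfolding eq by (rule LIMSEQ_unique)
  then show "(\<integral>\<eta>. lap 0 (stopped_Y B s \<eta>) \<partial>N) - lap 0 y0 = (\<integral>z. ?k 0 z \<partial>(lborel \<Otimes>\<^sub>M N))"
    unfolding kh .
qed

text \<open>Only \<open>Y\<close> is stopped, when it leaves an interval growing to (0,\<infinity>).
  A frozen value is eventually exactly \<open>top\<close>, where the kernel is 0, or tends to 0,
  where the kernel tends to 1 because \<open>X\<close> and its starting point are finite.\<close>

lemma duality_III:
  assumes cond: "\<And>k. cond_A M N \<phi> X Y (\<lambda>_. top) (NY.hit (above k \<union> below k))"
    and cont: "\<And>y. y < top \<Longrightarrow> isCont (\<lambda>x. \<phi> x y) 0"
    and bd: "\<And>m n e :: real. m > 0 \<Longrightarrow> n > 0 \<Longrightarrow> e > 0 \<Longrightarrow>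
          bdd_above ((\<lambda>(x, y). \<bar>\<phi> x y\<bar>) ` ({0..ennreal m} \<times> {ennreal e<..<ennreal n}))"
    and \<phi>0: "\<And>x. \<phi> x 0 = 0"
    and ns: "nonsticky M X x0 top"
    and ne: "AE \<eta> in N. no_continuous_explosion (\<lambda>t. Y t \<eta>)"
    and Y0: "\<And>\<eta>. \<eta> \<in> space N \<Longrightarrow> (\<lambda>t. Y t \<eta>) \<in> cadlag_absorbed 0"
    and t: "0 \<le> t"
  shows "(\<integral>\<omega>. lap (X t \<omega>) y0 \<partial>M) = (\<integral>\<eta>. lap x0 (Y t \<eta>) \<partial>N)"
proof (cases "x0 = top")
  case True
  then show ?thesis using t by (intro duality_start_top) auto
next
  case False
  let ?B = "\<lambda>k. above k \<union> below k"
  have Xn: "AE \<omega> in M. X r \<omega> \<noteq> top" if "0 \<le> r" for r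
    by (rule MX.nonstickyD[OF ns False that])
  have anti: "antimono ?B"
    using antimonoD[OF antimono_above] antimonoD[OF antimono_below] by (intro antimonoI) blast
  have two: "(\<exists>K. \<forall>k\<ge>K. stopped_Y (?B k) s \<eta> = Y s \<eta> \<and> (ennreal s < NY.hit (?B k) \<eta> \<or> Y s \<eta> = top))
     \<or> (Y s \<eta> = 0 \<and> (\<lambda>k. stopped_Y (?B k) s \<eta>) \<longlonglongrightarrow> 0)"
    if "\<eta> \<in> space N" "no_continuous_explosion (\<lambda>t. Y t \<eta>)" "0 \<le> s" for \<eta> s
    unfolding NY.stopped_eq_stop_path
    by (rule stop_path_two_sided[OF Y0[OF that(1)] Y_absorbed[OF that(1)] that(2) anti closure_outside_tendsto that(3)])
  show ?thesis
  proof (rule duality[of "\<lambda>_. {}" ?B, OF _ _ _ _ _ _ _ _ _ t]; (simp only: hit_empty)?)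
    show "cond_A M N \<phi> X Y (\<lambda>_. top) (NY.hit (?B k))" for k by (rule cond)
    show "AE \<eta> in N. stopped_Y (?B k) t \<eta> = 0 \<longrightarrow>
        dynkin M (stopped X (\<lambda>_. top)) (\<lambda>_. top) (\<lambda>x. lap x 0) (\<lambda>x. \<phi> x 0) (lap x0 0)" for t k
      unfolding \<phi>0 using MX.dynkin_lap_zero[of "\<lambda>_. top" x0] Xn False by (simp add: stopped_top)
    show "AE \<omega> in M. stopped X (\<lambda>_. top) s \<omega> = 0 \<longrightarrow>
        dynkin_Y (?B k) 0" for s k
    proof -
      have "UNIV - {ennreal (1 / real (Suc k))..ennreal (real (Suc k))} \<subseteq> ?B k"
        by (auto simp: above_def below_def not_le ennreal_of_nat_eq_real_of_nat simp del: of_nat_Suc)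
      then have "dynkin_Y (?B k) 0"
        by (rule dynkin_zero_Y[OF _ _ _ cont bd, rotated]) auto
      then show ?thesis by simp
    qed
    show "AE \<omega> in M. (\<lambda>k. lap (stopped X (\<lambda>_. top) s \<omega>) y0) \<longlonglongrightarrow> lap (X s \<omega>) y0" if "0 \<le> s" for s
      using that by (simp add: stopped_top)
    show "AE \<eta> in N. (\<lambda>k. lap x0 (stopped_Y (?B k) s \<eta>)) \<longlonglongrightarrow> lap x0 (Y s \<eta>)" if "0 \<le> s" for s
      using ne AE_space
    proof eventually_elim
      case (elim \<eta>)
      from two[OF elim(2,1) that] show ?case
      proof (elim disjE exE conjE)
        fix K assume "\<forall>k\<ge>K. stopped_Y (?B k) s \<eta> = Y s \<eta> \<and> (ennreal s < NY.hit (?B k) \<eta> \<or> Y s \<eta> = top)"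
        then show ?thesis by (intro tendsto_eventually eventually_sequentiallyI[of K]) auto
      next
        assume "Y s \<eta> = 0" "(\<lambda>k. stopped_Y (?B k) s \<eta>) \<longlonglongrightarrow> 0"
        then show ?thesis using False by (intro tendsto_lap) auto
      qed
    qed
    show "AE \<eta> in N. AE \<omega> in M.
       (\<lambda>k. of_bool (NY.hit (?B k) \<eta> \<le> ennreal t) * (lap (stopped X (\<lambda>_. top) s \<omega>) (stopped_Y (?B k) t \<eta>)
          - lap x0 (stopped_Y (?B k) t \<eta>))) \<longlonglongrightarrow> 0" if st: "0 \<le> s" "0 \<le> t" for s t
      using ne AE_space
    proof eventually_elim
      case (elim \<eta>)
      show ?case
        using Xn[OF st(1)]
      proof eventually_elim
        case (elim \<omega>)
        from two[OF \<open>\<eta> \<in> space N\<close> \<open>no_continuous_explosion (\<lambda>t. Y t \<eta>)\<close> st(2)] show ?case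
        proof (elim disjE exE conjE)
          fix K assume "\<forall>k\<ge>K. stopped_Y (?B k) t \<eta> = Y t \<eta> \<and> (ennreal t < NY.hit (?B k) \<eta> \<or> Y t \<eta> = top)"
          then show ?thesis by (intro tendsto_eventually eventually_sequentiallyI[of K]) (auto simp: not_le[symmetric])
        next
          assume G: "Y t \<eta> = 0" "(\<lambda>k. stopped_Y (?B k) t \<eta>) \<longlonglongrightarrow> 0"
          have "(\<lambda>k. lap (X s \<omega>) (stopped_Y (?B k) t \<eta>) - lap x0 (stopped_Y (?B k) t \<eta>)) \<longlonglongrightarrow> lap (X s \<omega>) 0 - lap x0 0"
            using G elim False by (intro tendsto_diff tendsto_lap) auto
          then have "(\<lambda>k. lap (X s \<omega>) (stopped_Y (?B k) t \<eta>) - lap x0 (stopped_Y (?B k) t \<eta>)) \<longlonglongrightarrow> 0"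
            using elim False by (simp add: lap_zero less_top)
          then have "(\<lambda>k. \<bar>lap (X s \<omega>) (stopped_Y (?B k) t \<eta>) - lap x0 (stopped_Y (?B k) t \<eta>)\<bar>) \<longlonglongrightarrow> 0"
            by (rule tendsto_rabs_zero)
          \<comment> \<open>The indicator may vary with \<open>k\<close>, but it is at most 1, so
            comparison with the modulus suffices.\<close>
          then show ?thesis
            by (rule Lim_null_comparison[rotated]) (use st in \<open>simp add: stopped_top of_bool_def\<close>)
        qed
      qed
    qed
  qed (auto simp: top_unique)
qed

lemma duality_IV:
  assumes cond: "\<And>k. cond_A M N \<phi> X Y (MX.hit (below k)) (NY.hit (below k))"
    and \<phi>0: "\<And>y. \<phi> 0 y = 0" "\<And>x. \<phi> x 0 = 0"
    and X0: "\<And>\<omega>. \<omega> \<in> space M \<Longrightarrow> (\<lambda>t. X t \<omega>) \<in> cadlag_absorbed 0"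
    and Y0: "\<And>\<eta>. \<eta> \<in> space N \<Longrightarrow> (\<lambda>t. Y t \<eta>) \<in> cadlag_absorbed 0"
    and ns: "nonsticky M X x0 top" "nonsticky N Y y0 top"
    and t: "0 \<le> t"
  shows "(\<integral>\<omega>. lap (X t \<omega>) y0 \<partial>M) = (\<integral>\<eta>. lap x0 (Y t \<eta>) \<partial>N)"
proof -
  consider "x0 = top \<or> y0 = top" | "x0 \<noteq> top" "y0 \<noteq> top" by blast
  then show ?thesis
  proof cases
    case 1
    then show ?thesis using t by (rule duality_start_top)
  next
    case 2
    show ?thesis
    proof (rule duality_absorbing[OF _ _ antimono_below closure_below_tendsto X0 Y0 ns 2 cond _ _ t])
      have "AE \<omega> in M. stopped_X (below k) s \<omega> \<noteq> top" if "0 \<le> s" for s k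
        using MX.nonstickyD[OF ns(1) 2(1) that] AE_space
        by eventually_elim (use stop_path_top[OF X_absorbed that] in \<open>auto simp: MX.stopped_eq_stop_path\<close>)
      then have "dynkin_X (below k) 0" for k
        unfolding \<phi>0 by (intro MX.dynkin_lap_zero MX.measurable_hit 2) auto
      then show "AE \<eta> in N. stopped_Y (below k) t \<eta> = 0 \<longrightarrow>
          dynkin_X (below k) 0" for t k
        by simp
      have "AE \<omega> in N. stopped_Y (below k) s \<omega> \<noteq> top" if "0 \<le> s" for s k
        using NY.nonstickyD[OF ns(2) 2(2) that] AE_space
        by eventually_elim (use stop_path_top[OF Y_absorbed that] in \<open>auto simp: NY.stopped_eq_stop_path\<close>)
      then have "dynkin N (stopped_Y (below k)) (NY.hit (below k)) (\<lambda>x. lap x 0) (\<lambda>_. 0) (lap y0 0)" for k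
        by (intro NY.dynkin_lap_zero NY.measurable_hit 2) auto
      then have "dynkin_Y (below k) 0" for k
        unfolding \<phi>0(1)[abs_def] lap_commute[of _ 0] by simp
      then show "AE \<omega> in M. stopped_X (below k) s \<omega> = 0 \<longrightarrow>
          dynkin_Y (below k) 0" for s k
        by simp
    qed auto
  qed
qed

end

section \<open>From symbols and martingale problems to dual processes\<close>

lemma time_above_eq_hit: "time_above X r = (\<lambda>\<omega>. hit_time {r<..} (\<lambda>t. X t \<omega>))"
  by (simp add: fun_eq_iff time_above_def hit_time_def)

lemma time_below_eq_hit: "time_below X r = (\<lambda>\<omega>. hit_time {..<r} (\<lambda>t. X t \<omega>))"
  by (simp add: fun_eq_iff time_below_def hit_time_def)

lemma martingale_problem_exp:
  assumes mp: "solves_martingale_problem (pregenerator \<psi>) \<mu> M X" and y: "0 < y" "y < top"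
    and g: "\<And>x. g x = (if x = top then \<psi> top (enn2real y) else \<psi> x (enn2real y) * lap x y)"
  shows "compensated_martingale M X (\<lambda>x. lap x y) g"
proof -
  define r where "r = enn2real y"
  have r: "0 < r" "y = ennreal r" using y by (auto simp: r_def enn2real_positive_iff)
  have "lap_comb {r} (\<lambda>_. 1) \<in> lap_span" unfolding lap_span_def using r by auto
  then have "compensated_martingale M X (lap_comb {r} (\<lambda>_. 1)) (pregenerator \<psi> (lap_comb {r} (\<lambda>_. 1)))"
    using mp by (simp add: solves_martingale_problem_def)
  moreover have "lap_comb {r} (\<lambda>_. 1) = (\<lambda>x. lap x y)" by (simp add: lap_comb_def r)
  moreover have "pregenerator \<psi> (lap_comb {r} (\<lambda>_. 1)) = g"
    using r(1) by (subst pregenerator_lap_comb) (auto simp: pregenerator_exp_def g fun_eq_iff r(2))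
  ultimately show ?thesis by simp
qed

lemma martingale_problem_start:
  assumes "solves_martingale_problem G (return borel x0) M X" "X 0 \<in> borel_measurable M"
  shows "AE \<omega> in M. X 0 \<omega> = x0"
proof -
  have "AE x in distr M borel (X 0). x = x0"
  proof -
    have "AE x in return borel x0. x = x0" by (subst AE_return) auto
    moreover have "distr M borel (X 0) = return borel x0"
      using assms(1) by (simp add: solves_martingale_problem_def)
    ultimately show ?thesis by metis
  qed
  then show ?thesis by (subst (asm) AE_distr_iff) (use assms(2) in auto)
qed

lemma laplace_symbol_damped_bounded:
  assumes \<psi>: "laplace_symbol \<psi>" and x: "0 < x" "x < top"
    and g: "\<And>y. 0 < y \<Longrightarrow> y < top \<Longrightarrow> g y = \<psi> x (enn2real y) * lap x y" "g top = 0"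
  shows "\<exists>C. \<forall>y. \<bar>g y\<bar> \<le> C"
proof -
  define r where "r = enn2real x"
  have r: "0 < r" "x = ennreal r" using x by (auto simp: r_def enn2real_positive_iff)
  obtain C where C: "\<And>y. 0 < y \<Longrightarrow> \<bar>\<psi> (ennreal r) y * exp (- (r * y))\<bar> \<le> C"
    using laplace_symbol_interior_bounded[OF \<psi> r(1)] by blast
  \<comment> \<open>The bound from the symbol covers 0 < y < \<infinity>. The value at 0 is outside
    its reach and enters the maximum as a number of its own.\<close>
  have "\<bar>g y\<bar> \<le> max (max C \<bar>g 0\<bar>) 0" for y
  proof (cases "y = 0 \<or> y = top")
    case False
    then have "0 < y" "y < top" by (auto simp: less_top zero_less_iff_neq_zero)
    then show ?thesis
      using C[of "enn2real y"] g(1)[of y] False r by (auto simp: enn2real_positive_iff lap_def)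
  qed (use g(2) in auto)
  then show ?thesis by blast
qed

lemma dual_processesI:
  assumes symbol: "laplace_dual_symbol \<psi>" "vanishes_at_infinity \<psi>"
    and phi: "\<And>x y. \<phi> x y = \<psi> x y * lap x y"
    and X: "solves_martingale_problem (pregenerator (\<lambda>x y. \<psi> x (ennreal y))) (return borel x0) M X"
      "\<And>\<omega>. \<omega> \<in> space M \<Longrightarrow> (\<lambda>t. X t \<omega>) \<in> cadlag_absorbed top"
    and Y: "solves_martingale_problem (pregenerator (\<lambda>y x. \<psi> (ennreal x) y)) (return borel y0) N Y"
      "\<And>\<eta>. \<eta> \<in> space N \<Longrightarrow> (\<lambda>t. Y t \<eta>) \<in> cadlag_absorbed top"
  shows "dual_processes M X N Y \<phi> x0 y0"
proof -
  have \<psi>1: "laplace_symbol (\<lambda>x y. \<psi> x (ennreal y))" and \<psi>2: "laplace_symbol (\<lambda>y x. \<psi> (ennreal x) y)"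
    using symbol(1) by (auto simp: laplace_dual_symbol_def)
  have top: "\<psi> top y = 0" "\<psi> x top = 0" for x y using symbol(2) by (auto simp: vanishes_at_infinity_def)
  interpret MX: cadlag_process M X
    by (rule cadlag_processI) (use X in \<open>auto simp: solves_martingale_problem_def intro: absorbed_cadlag\<close>)
  interpret NY: cadlag_process N Y
    by (rule cadlag_processI) (use Y in \<open>auto simp: solves_martingale_problem_def intro: absorbed_cadlag\<close>)
  show ?thesis
  proof unfold_locales
    note [measurable] = measurable_dual_symbol[OF symbol]
    show "(\<lambda>(x, y). \<phi> x y) \<in> borel_measurable (borel \<Otimes>\<^sub>M borel)" unfolding phi by measurable
    show "AE \<omega> in M. X 0 \<omega> = x0" by (rule martingale_problem_start[OF X(1)]) (rule MX.measurable_at, simp)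
    show "AE \<eta> in N. Y 0 \<eta> = y0" by (rule martingale_problem_start[OF Y(1)]) (rule NY.measurable_at, simp)
    show "\<exists>C. \<forall>x. \<bar>\<phi> x y\<bar> \<le> C" if "0 < y" "y < top" for y
      \<comment> \<open>A bound in \<open>x\<close> for fixed \<open>y\<close> comes from the dual
        symbol, in which \<open>y\<close> is the state and \<open>x\<close> the exponent.\<close>
      by (rule laplace_symbol_damped_bounded[OF \<psi>2 that]) (auto simp: phi top lap_commute[of y] less_top)
    show "\<exists>C. \<forall>y. \<bar>\<phi> x y\<bar> \<le> C" if "0 < x" "x < top" for x
      by (rule laplace_symbol_damped_bounded[OF \<psi>1 that]) (auto simp: phi top less_top)
    show "compensated_martingale M X (\<lambda>x. lap x y) (\<lambda>x. \<phi> x y)" if "0 < y" "y < top" for y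
      by (rule martingale_problem_exp[OF X(1) that]) (use that in \<open>auto simp: phi top less_top\<close>)
    have Y': "compensated_martingale N Y (\<lambda>y. lap y x) (\<lambda>y. \<phi> x y)" if "0 < x" "x < top" for x
      by (rule martingale_problem_exp[OF Y(1) that]) (use that in \<open>auto simp: phi top lap_commute[of x] less_top\<close>)
    show "compensated_martingale N Y (\<lambda>y. lap x y) (\<lambda>y. \<phi> x y)" if "0 < x" "x < top" for x
      using Y'[OF that] by (simp add: lap_commute[of _ x])
  qed (auto simp: phi X Y)
qed

theorem theorem5p2:
  fixes \<psi> \<phi> :: "ennreal \<Rightarrow> ennreal \<Rightarrow> real"
    and x0 y0 :: ennreal
    and M :: "'a measure" and X :: "real \<Rightarrow> 'a \<Rightarrow> ennreal"
    and N :: "'b measure" and Y :: "real \<Rightarrow> 'b \<Rightarrow> ennreal"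
  assumes symbol: "laplace_dual_symbol \<psi>" "vanishes_at_infinity \<psi>"
    and phi: "\<And>x y. \<phi> x y = \<psi> x y * lap x y"
    and X: "solves_martingale_problem (pregenerator (\<lambda>x y. \<psi> x (ennreal y))) (return borel x0) M X"
      "\<And>\<omega>. \<omega> \<in> space M \<Longrightarrow> (\<lambda>t. X t \<omega>) \<in> cadlag_absorbed top"
    and Y: "solves_martingale_problem (pregenerator (\<lambda>y x. \<psi> (ennreal x) y)) (return borel y0) N Y"
      "\<And>\<eta>. \<eta> \<in> space N \<Longrightarrow> (\<lambda>t. Y t \<eta>) \<in> cadlag_absorbed top"
    and cases: "
      \<comment> \<open>(I)\<close>
      (cond_A M N \<phi> X Y (\<lambda>_. top) (\<lambda>_. top) \<and>
       compensated_martingale N Y (indicator {y. y < \<infinity>}) (\<phi> 0) \<and>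
       nonsticky N Y y0 0 \<and> y0 > 0)
      \<or> \<comment> \<open>(II)\<close>
      ((\<forall>m n :: nat. m \<ge> 1 \<longrightarrow> n \<ge> 1 \<longrightarrow>
          cond_A M N \<phi> X Y (time_above X (of_nat m)) (time_above Y (of_nat n)) \<and>
          cond_B M N \<phi> X Y (time_above X (of_nat m)) (time_above Y (of_nat n))) \<and>
       (\<forall>x. 0 < x \<and> x < \<infinity> \<longrightarrow> ((\<lambda>y. \<phi> x y) \<longlongrightarrow> 0) (at top)) \<and>
       (\<forall>y. 0 < y \<and> y < \<infinity> \<longrightarrow> ((\<lambda>x. \<phi> x y) \<longlongrightarrow> 0) (at top)) \<and>
       nonsticky M X x0 0 \<and> nonsticky N Y y0 0 \<and> x0 > 0 \<and> y0 > 0)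
      \<or> \<comment> \<open>(III)\<close>
      ((\<forall>(n :: nat) (\<epsilon> :: real). n \<ge> 1 \<longrightarrow> \<epsilon> > 0 \<longrightarrow>
          cond_A M N \<phi> X Y (\<lambda>_. top)
            (\<lambda>\<eta>. min (time_above Y (of_nat n) \<eta>) (time_below Y (ennreal \<epsilon>) \<eta>))) \<and>
       (\<forall>y < \<infinity>. isCont (\<lambda>x. \<phi> x y) 0) \<and>
       (\<forall>m n \<epsilon> :: real. m > 0 \<longrightarrow> n > 0 \<longrightarrow> \<epsilon> > 0 \<longrightarrow>
          bdd_above ((\<lambda>(x, y). \<bar>\<phi> x y\<bar>) ` ({0..ennreal m} \<times> {ennreal \<epsilon><..<ennreal n}))) \<and>
       (\<forall>x. \<phi> x 0 = 0) \<and>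
       nonsticky M X x0 top \<and>
       (AE \<eta> in N. no_continuous_explosion (\<lambda>t. Y t \<eta>)) \<and>
       (\<forall>\<eta> \<in> space N. (\<lambda>t. Y t \<eta>) \<in> cadlag_absorbed 0))
      \<or> \<comment> \<open>(IV)\<close>
      ((\<forall>\<delta> \<epsilon> :: real. \<delta> > 0 \<longrightarrow> \<epsilon> > 0 \<longrightarrow>
          cond_A M N \<phi> X Y (time_below X (ennreal \<delta>)) (time_below Y (ennreal \<epsilon>)) \<and>
          cond_B M N \<phi> X Y (time_below X (ennreal \<delta>)) (time_below Y (ennreal \<epsilon>))) \<and>
       (\<forall>x < \<infinity>. isCont (\<lambda>y. \<phi> x y) 0) \<and> (\<forall>y < \<infinity>. isCont (\<lambda>x. \<phi> x y) 0) \<and>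
       (\<forall>m :: real. m \<ge> 0 \<longrightarrow>
          bdd_above ((\<lambda>(x, y). \<bar>\<phi> x y\<bar>) ` ({0..ennreal m} \<times> {0..ennreal m}))) \<and>
       (\<forall>y. \<phi> 0 y = 0) \<and> (\<forall>x. \<phi> x 0 = 0) \<and>
       (\<forall>\<omega> \<in> space M. (\<lambda>t. X t \<omega>) \<in> cadlag_absorbed 0) \<and>
       (\<forall>\<eta> \<in> space N. (\<lambda>t. Y t \<eta>) \<in> cadlag_absorbed 0) \<and>
       nonsticky M X x0 top \<and> nonsticky N Y y0 top)"
  shows "\<forall>t\<ge>0. (\<integral>\<omega>. lap (X t \<omega>) y0 \<partial>M) = (\<integral>\<eta>. lap x0 (Y t \<eta>) \<partial>N)"
proof (intro allI impI)
  fix t :: real assume t: "0 \<le> t"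
  interpret dual_processes M X N Y \<phi> x0 y0
    by (rule dual_processesI[OF symbol phi X Y])
  have above: "MX.hit (above k) = time_above X (of_nat (Suc k))" "NY.hit (above k) = time_above Y (of_nat (Suc k))" for k
    by (simp_all add: time_above_eq_hit above_def del: of_nat_Suc)
  have below: "MX.hit (below k) = time_below X (ennreal (1 / real (Suc k)))"
      "NY.hit (below k) = time_below Y (ennreal (1 / real (Suc k)))" for k
    by (simp_all add: time_below_eq_hit below_def del: of_nat_Suc)
  from cases show "(\<integral>\<omega>. lap (X t \<omega>) y0 \<partial>M) = (\<integral>\<eta>. lap x0 (Y t \<eta>) \<partial>N)"
  proof (elim disjE, goal_cases)
    case I: 1
    have "cond_A M N \<phi> X Y (\<lambda>_. top) (\<lambda>_. top)" "compensated_martingale N Y (indicator {y. y < \<infinity>}) (\<phi> 0)"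
      "nonsticky N Y y0 0" "y0 > 0"
      using I by - (elim conjE, assumption)+
    \<comment> \<open>The sign that replaces a bound for Dynkin's formula with exponent 0: at state
      0 the symbol is nonpositive.\<close>
    moreover have "\<phi> 0 y \<le> 0" if "0 < y" "y < top" for y
    proof -
      have "\<psi> 0 (ennreal (enn2real y)) \<le> 0"
        using laplace_symbol_zero(2)[of "\<lambda>x y. \<psi> x (ennreal y)" "enn2real y"] symbol(1) that
        by (simp add: laplace_dual_symbol_def enn2real_positive_iff)
      then show ?thesis using that by (simp add: phi lap_bounds(1) mult_nonpos_nonneg)
    qed
    ultimately show ?case using t by (rule duality_I)
  next
    case II: 2
    have "cond_A M N \<phi> X Y (MX.hit (above k)) (NY.hit (above k))" for k
      unfolding above
      by (rule conjunct1[OF II[THEN conjunct1, THEN spec, THEN spec, THEN mp, THEN mp]]) simp_all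
    moreover have "nonsticky M X x0 0" "nonsticky N Y y0 0" "x0 > 0" "y0 > 0"
      using II by - (elim conjE, assumption)+
    ultimately show ?case using t by (rule duality_II)
  next
    case III: 3
    have "cond_A M N \<phi> X Y (\<lambda>_. top) (NY.hit (above k \<union> below k))" for k
      unfolding hit_time_Un fun_cong[OF above(2)] fun_cong[OF below(2)]
      by (rule III[THEN conjunct1, THEN spec, THEN spec, THEN mp, THEN mp]) simp_all
    moreover have cont: "\<forall>y<\<infinity>. isCont (\<lambda>x. \<phi> x y) 0"
      and bd: "\<forall>m n \<epsilon> :: real. m > 0 \<longrightarrow> n > 0 \<longrightarrow> \<epsilon> > 0 \<longrightarrow>
         bdd_above ((\<lambda>(x, y). \<bar>\<phi> x y\<bar>) ` ({0..ennreal m} \<times> {ennreal \<epsilon><..<ennreal n}))"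
      and zero: "\<forall>x. \<phi> x 0 = 0" and ns: "nonsticky M X x0 top"
      and ne: "AE \<eta> in N. no_continuous_explosion (\<lambda>t. Y t \<eta>)" and Y0: "\<forall>\<eta> \<in> space N. (\<lambda>t. Y t \<eta>) \<in> cadlag_absorbed 0"
      using III by - (elim conjE, assumption)+
    ultimately show ?case
      by (intro duality_III[OF _ cont[unfolded infinity_ennreal_def, rule_format] bd[rule_format] zero[rule_format] ns ne Y0[rule_format] t])
  next
    case IV: 4
    have "cond_A M N \<phi> X Y (MX.hit (below k)) (NY.hit (below k))" for k
      unfolding below
      by (rule conjunct1[OF IV[THEN conjunct1, THEN spec, THEN spec, THEN mp, THEN mp]]) simp_all
    moreover have zero: "\<forall>y. \<phi> 0 y = 0" "\<forall>x. \<phi> x 0 = 0"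
      and X0: "\<forall>\<omega> \<in> space M. (\<lambda>t. X t \<omega>) \<in> cadlag_absorbed 0" and Y0: "\<forall>\<eta> \<in> space N. (\<lambda>t. Y t \<eta>) \<in> cadlag_absorbed 0"
      and ns: "nonsticky M X x0 top" "nonsticky N Y y0 top"
      using IV by - (elim conjE, assumption)+
    ultimately show ?case
      by (intro duality_IV[OF _ zero(1)[rule_format] zero(2)[rule_format] X0[rule_format] Y0[rule_format] ns t])
  qed
qed

end
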